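(* Let $\nu_0\in M_1(E)$, and assume that $\alpha\to\infty$, $\beta\to\infty$ and $\alpha/\beta\to c$ for some $c\in(0,\infty)$. Let $\Pi_{\alpha,\beta,\nu_0}$ be the distribution of the hierarchical Dirichlet process $\Xi_{\alpha,\beta,\nu_0}$ on $M_1(E)$. Then the family $\{\Pi_{\alpha,\beta,\nu_0}:\alpha>0,\beta>0\}$ satisfies a large deviation principle on the space $M_1(E)$ with speed $\gamma=\max\{\alpha,\beta\}$ and good rate function $$J(\mu)=\begin{cases}\displaystyle\inf_{\nu\in M_1(E),\ \mathrm{supp}(\nu)\subset\mathrm{supp}(\nu_0)}\left\{a\,H(\nu_0|\nu)+b\,H(\nu|\mu)\right\}, & \mathrm{supp}(\mu)\subset\mathrm{supp}(\nu_0),\\[2mm] +\infty, & \text{otherwise},\end{cases}$$ where $(a,b)=(c,1)$ if $c<1$, $(a,b)=(1,c^{-1})$ if $c>1$, $(a,b)=(1,1)$ if $c=1$, and $\mathrm{supp}(\cdot)$ denotes the topological support of an element of $M_1(E)$.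
   Context: $E=[0,1]$ with its Borel $\sigma$-algebra. $M_1(E)$ is the space of probability measures on $E$ with the weak topology (metrized by $\rho(\mu,\nu)=\sum_{i=1}^\infty 2^{-i}(|\langle\mu-\nu,f_i\rangle|\wedge1)$ with $\{f_i:i\ge1\}$ a dense subset of $C(E)$ and $\langle\mu,f\rangle=\int_E f\,d\mu$). For $\mu,\nu\in M_1(E)$ the relative entropy is $H(\mu|\nu)=\int_E\log\frac{d\mu}{d\nu}\,d\mu$ if $\mu\ll\nu$, and $H(\mu|\nu)=\infty$ otherwise. Let $\alpha>0$, $\beta>0$, $\nu_0\in M_1(E)$. Let $\xi_1,\xi_2,\ldots$ be i.i.d. with distribution $\nu_0$ and, independently, let $U_1,U_2,\ldots$ be i.i.d. with the Beta$(1,\alpha)$ distribution. Set $V_1=U_1$, $V_n=(1-U_1)\cdots(1-U_{n-1})U_n$ for $n\ge2$, and $\mathbb{V}_\alpha=(V_1,V_2,\ldots)$. The Dirichlet process with concentration parameter $\alpha$ and base distribution $\nu_0$ is $\Xi_{\alpha,\nu_0}=\sum_{i=1}^\infty V_i\delta_{\xi_i}$. The hierarchical Dirichlet process with level two concentration parameter $\beta$, level one concentration parameter $\alpha$ and base distribution $\nu_0$ is the random probability measure $\Xi_{\alpha,\beta,\nu_0}$ which, conditionally on $\Xi_{\alpha,\nu_0}$, is a Dirichlet process with concentration parameter $\beta$ and base distribution $\Xi_{\alpha,\nu_0}$. Equivalently, in distribution, $\Xi_{\alpha,\beta,\nu_0}=\sum_{i=1}^\infty Z_i\delta_{\xi_i}$,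 where, given $\mathbb{V}_\alpha$, $W_1,W_2,\ldots$ are conditionally independent (and independent of the $\xi_i$) with $W_n$ having the Beta$\left(\beta V_n,\ \beta(1-\sum_{k=1}^nV_k)\right)$ distribution, and $Z_1=W_1$, $Z_n=(1-W_1)\cdots(1-W_{n-1})W_n$ for $n\ge2$. Large deviation principle: a family $\{P_\lambda\}$ of probability measures on a Polish space $S$ satisfies a large deviation principle with speed $a(\lambda)\to\infty$ and good rate function $I:S\to[0,\infty]$ if $\{s\in S:I(s)\le r\}$ is compact for every finite $r\ge0$ and, for every measurable $G\subset S$ with interior $G^\circ$ and closure $\bar G$, $$-\inf_{s\in G^\circ}I(s)\le\liminf\frac{1}{a(\lambda)}\log P_\lambda(G)\le\limsup\frac{1}{a(\lambda)}\log P_\lambda(G)\le-\inf_{s\in\bar G}I(s).$$ Here the index is $\lambda=(\alpha,\beta)$, and the limits are taken along the limiting procedure $\alpha\to\infty$, $\beta\to\infty$, $\alpha/\beta\to c$ (i.e. along any sequence of pairs $(\alpha,\beta)$ with these properties). *)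

theory Defs
  imports "HOL-Probability.Probability"
begin

section \<open>The space of probability measures on the unit interval\<close>

definition unit_borel :: "real measure" where
  "unit_borel = restrict_space borel {0..1}"

abbreviation M1 :: "real measure set" where
  "M1 \<equiv> space (prob_algebra unit_borel)"

text \<open>The coarsest topology on \<open>M1\<close> that makes integration against every continuous
  function on the unit interval continuous.\<close>

definition weak_topology :: "real measure topology" where
  "weak_topology = topology_generated_by
     {{\<mu> \<in> M1. integral\<^sup>L \<mu> f \<in> U} | f U. continuous_on {0..1} f \<and> open (U :: real set)}"

definition borel_of :: "'a topology \<Rightarrow> 'a measure" where
  "borel_of X = sigma (topspace X) {U. openin X U}"

definition supp :: "real measure \<Rightarrow> real set" where
  "supp \<mu> = {x \<in> {0..1}. \<forall>U. open U \<and> x \<in> U \<longrightarrow> 0 < emeasure \<mu> (U \<inter> {0..1})}"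

text \<open>\<open>rel_entropy \<mu> \<nu>\<close> is \<open>H(\<mu>|\<nu>)\<close>; note the order of arguments of \<open>absolutely_continuous\<close> and
  \<open>KL_divergence\<close>. The negative part of \<open>ln (d\<mu>/d\<nu>)\<close> is always \<open>\<mu>\<close>-integrable for probability
  measures, so if the logarithm is not integrable then its integral is \<open>\<infinity>\<close> (whereas the
  real-valued \<open>KL_divergence\<close> would be \<open>0\<close>).\<close>

definition rel_entropy :: "real measure \<Rightarrow> real measure \<Rightarrow> ereal" where
  "rel_entropy \<mu> \<nu> =
     (if absolutely_continuous \<nu> \<mu> \<and> integrable \<mu> (entropy_density (exp 1) \<nu> \<mu>)
      then ereal (KL_divergence (exp 1) \<nu> \<mu>) else \<infinity>)"

section \<open>Dirichlet processes\<close>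

definition beta_distribution :: "real \<Rightarrow> real \<Rightarrow> real measure" where
  "beta_distribution a b = density lborel
     (\<lambda>x. ennreal (indicator {0<..<1} x * x powr (a - 1) * (1 - x) powr (b - 1) / Beta a b))"

definition stick_breaking :: "(nat \<Rightarrow> real) \<Rightarrow> nat \<Rightarrow> real" where
  "stick_breaking U n = (\<Prod>k<n. 1 - U k) * U n"

text \<open>\<open>\<Sum>i. V i \<delta>\<^bsub>\<xi> i\<^esub>\<close>, with the arbitrary value \<open>\<delta>\<^bsub>\<xi> 0\<^esub>\<close> if \<open>V\<close> is not a probability vector. For the
  stick-breaking weights of a Dirichlet process the latter happens with probability \<open>0\<close> only.\<close>

definition atomic_measure :: "(nat \<Rightarrow> real) \<Rightarrow> (nat \<Rightarrow> real) \<Rightarrow> real measure" where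
  "atomic_measure V \<xi> =
     (if (\<forall>i. 0 \<le> V i) \<and> V sums 1
      then measure_of {0..1} (sets unit_borel) (\<lambda>A. \<Sum>i. ennreal (V i) * indicator A (\<xi> i))
      else return unit_borel (\<xi> 0))"

text \<open>The law on \<open>M1\<close> of the Dirichlet process with concentration parameter \<open>\<alpha>\<close> and base
  distribution \<open>\<nu>\<close>. The atoms and the stick-breaking proportions are drawn from a product measure,
  so they are all independent.\<close>

definition dirichlet_process :: "real \<Rightarrow> real measure \<Rightarrow> real measure measure" where
  "dirichlet_process \<alpha> \<nu> =
     distr ((\<Pi>\<^sub>M i\<in>(UNIV :: nat set). \<nu>) \<Otimes>\<^sub>M (\<Pi>\<^sub>M i\<in>(UNIV :: nat set). beta_distribution 1 \<alpha>))
       (borel_of weak_topology) (\<lambda>(\<xi>, U). atomic_measure (stick_breaking U) \<xi>)"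

text \<open>The law of a random measure that, conditionally on a Dirichlet process \<open>\<Xi>\<close> with parameters
  \<open>\<alpha>\<close> and \<open>\<nu>\<^sub>0\<close>, is a Dirichlet process with parameters \<open>\<beta>\<close> and \<open>\<Xi>\<close>.\<close>

definition hierarchical_dirichlet_process ::
    "real \<Rightarrow> real \<Rightarrow> real measure \<Rightarrow> real measure measure" where
  "hierarchical_dirichlet_process \<alpha> \<beta> \<nu>\<^sub>0 =
     dirichlet_process \<alpha> \<nu>\<^sub>0 \<bind> (\<lambda>\<nu>. dirichlet_process \<beta> \<nu>)"

section \<open>Large deviations\<close>

definition ln_ext :: "real \<Rightarrow> ereal" where
  "ln_ext p = (if p = 0 then - \<infinity> else ereal (ln p))"

definition large_deviation_principle ::
    "'s topology \<Rightarrow> 'i filter \<Rightarrow> ('i \<Rightarrow> 's measure) \<Rightarrow> ('i \<Rightarrow> real) \<Rightarrow> ('s \<Rightarrow> ereal) \<Rightarrow> bool" where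
  "large_deviation_principle X F P a I \<longleftrightarrow>
     (\<forall>i. prob_space (P i) \<and> sets (P i) = sets (borel_of X)) \<and>
     filterlim a at_top F \<and>
     (\<forall>s\<in>topspace X. 0 \<le> I s) \<and>
     (\<forall>r::real. 0 \<le> r \<longrightarrow> compactin X {s \<in> topspace X. I s \<le> ereal r}) \<and>
     (\<forall>G\<in>sets (borel_of X).
        - (INF s\<in>X interior_of G. I s) \<le> Liminf F (\<lambda>i. ereal (1 / a i) * ln_ext (measure (P i) G)) \<and>
        Liminf F (\<lambda>i. ereal (1 / a i) * ln_ext (measure (P i) G))
          \<le> Limsup F (\<lambda>i. ereal (1 / a i) * ln_ext (measure (P i) G)) \<and>
        Limsup F (\<lambda>i. ereal (1 / a i) * ln_ext (measure (P i) G)) \<le> - (INF s\<in>X closure_of G. I s))"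

definition coeff_a :: "real \<Rightarrow> real" where
  "coeff_a c = (if c < 1 then c else 1)"

definition coeff_b :: "real \<Rightarrow> real" where
  "coeff_b c = (if c > 1 then 1 / c else 1)"

definition rate_J :: "real \<Rightarrow> real measure \<Rightarrow> real measure \<Rightarrow> ereal" where
  "rate_J c \<nu>\<^sub>0 \<mu> =
     (if supp \<mu> \<subseteq> supp \<nu>\<^sub>0
      then INF \<nu>\<in>{\<nu> \<in> M1. supp \<nu> \<subseteq> supp \<nu>\<^sub>0}.
             ereal (coeff_a c) * rel_entropy \<nu>\<^sub>0 \<nu> + ereal (coeff_b c) * rel_entropy \<nu> \<mu>
      else \<infinity>)"

end

theory Submission
  imports Defs "HOL-Real_Asymp.Real_Asymp"
begin

text \<open>
  Everything rests on the Markov-Krein identity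
  \<open>E \<langle>\<Xi>, e\<^sup>f\<rangle>\<^sup>-\<^sup>\<alpha> = exp (- \<alpha> \<langle>\<nu>, f\<rangle>)\<close> for a Dirichlet process \<open>\<Xi>\<close> with parameters \<open>\<alpha>\<close>, \<open>\<nu>\<close>. It follows from
  \<open>\<Xi> = U \<delta>\<^bsub>\<xi>\<^esub> + (1 - U) \<Xi>'\<close> in law: with \<open>g = e\<^sup>f\<close>, the Beta integral
  \<open>E (U x + (1 - U) y)\<^sup>-\<^sup>\<alpha>\<^sup>-\<^sup>1 = x\<^sup>-\<^sup>1 y\<^sup>-\<^sup>\<alpha>\<close> turns this equation into the differential equation
  \<open>\<Phi>' = - \<alpha> \<langle>\<nu>, 1 / (t + g)\<rangle> \<Phi>\<close> for \<open>\<Phi> t = E (t + \<langle>\<Xi>, g\<rangle>)\<^sup>-\<^sup>\<alpha>\<close>, whose solution is fixed by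
  the limit \<open>t \<rightarrow> \<infinity>\<close>.

  Let \<open>X f g \<nu> \<mu> = a (\<langle>\<nu>\<^sub>0, f\<rangle> - log \<langle>\<nu>, e\<^sup>f\<rangle>) + b (\<langle>\<nu>, g\<rangle> - log \<langle>\<mu>, e\<^sup>g\<rangle>)\<close>. By the variational formula
  for the relative entropy, \<open>sup X = a H(\<nu>\<^sub>0|\<nu>) + b H(\<nu>|\<mu>)\<close> over continuous \<open>f\<close>, \<open>g\<close>. By the identity, applied
  on both levels, \<open>exp (\<gamma> X f g)\<close> (with \<open>\<alpha> / \<gamma>\<close>, \<open>\<beta> / \<gamma>\<close> in place of their limits \<open>a\<close>, \<open>b\<close>) has expectation 1
  under the joint law of the two levels. Covering a compact set by finitely many sets \<open>{X f g > r}\<close>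
  therefore gives the upper bound. For the lower bound, use \<open>exp (\<gamma> X f g)\<close> as a change of measure:
  the same covering argument shows that the tilted law concentrates at the pair \<open>(\<nu>', \<mu>')\<close> with
  \<open>d\<nu>' = e\<^sup>-\<^sup>f d\<nu>\<^sub>0\<close> and \<open>d\<mu>' = e\<^sup>-\<^sup>g d\<nu>'\<close>, which is the only pair at which \<open>(f, g)\<close> maximises \<open>X\<close>. Pairs of this
  form, with continuous densities, approximate arbitrary ones without increasing the rate.
\<close>

section \<open>The space of probability measures on the unit interval\<close>

text \<open>The identity contains the base measure linearly and the random measure only inside a
  logarithm; this is why each entropy in the rate has the random measure as its second argument. The
  identity is exact for each pair of parameters, so the limit enters only through the ratios of
  \<alpha> and \<beta> to the speed. Compactness of \<open>M1\<close> makes exponential tightness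
  automatic. A principle for the pair of levels is never stated: working with product sets and
  projecting along the compact first factor produces the infimum over \<nu> directly.

  The pairs reached by continuous tilts play the part of exposed points in the Gaertner-Ellis
  theorem, for functionals that are not linear in the measures. The obstacle is to approximate every
  pair of finite rate by such pairs. Finite entropies give only that \<open>\<nu>\<^sub>0\<close> is
  absolutely continuous with respect to \<nu>, and \<nu> with respect to \<mu>. The reverse
  comparison, for continuous functions only, comes from the condition on the supports. This suffices
  for smoothing by a finite partition of unity, where it only matters which cells have positive
  mass.\<close>

lemma space_unit_borel [simp]: "space unit_borel = {0..1}"
  by (simp add: unit_borel_def space_restrict_space)

lemma sets_unit_borel: "sets unit_borel = sets (restrict_space borel {0..1})"
  by (simp add: unit_borel_def)

lemma measurable_unit_borel: "(\<lambda>x. x) \<in> borel_measurable unit_borel"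
  unfolding unit_borel_def by (intro measurable_restrict_space1) simp

lemma M1_D:
  assumes "\<mu> \<in> M1"
  shows "prob_space \<mu>" "sets \<mu> = sets unit_borel" "space \<mu> = {0..1}"
  using assms sets_eq_imp_space_eq[of \<mu> unit_borel] by (auto simp: space_prob_algebra)

lemma continuous_unit_measurable:
  fixes f :: "real \<Rightarrow> real"
  assumes "continuous_on {0..1} f" shows "f \<in> borel_measurable unit_borel"
  unfolding unit_borel_def by (rule borel_measurable_continuous_on_restrict[OF assms])

lemma M1_measurable:
  assumes "\<mu> \<in> M1" "f \<in> unit_borel \<rightarrow>\<^sub>M N" shows "f \<in> \<mu> \<rightarrow>\<^sub>M N"
  using assms(2) measurable_cong_sets[OF M1_D(2)[OF assms(1)] refl] by blast

lemma continuous_unit_bounded: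
  fixes f :: "real \<Rightarrow> real"
  assumes "continuous_on {0..1} f"
  obtains B where "0 \<le> B" "\<And>x. x \<in> {0..1} \<Longrightarrow> \<bar>f x\<bar> \<le> B"
proof -
  have "bounded (f ` {0..1})"
    using assms by (intro compact_imp_bounded compact_continuous_image) auto
  then obtain B where "\<forall>y\<in>f ` {0..1}. norm y \<le> B" by (auto simp: bounded_iff)
  then show thesis by (intro that[of "max B 0"]) force+
qed

lemma M1_integrable_bounded:
  fixes f :: "real \<Rightarrow> real"
  assumes "\<mu> \<in> M1" "f \<in> borel_measurable unit_borel" "\<And>x. x \<in> {0..1} \<Longrightarrow> \<bar>f x\<bar> \<le> B"
  shows "integrable \<mu> f"
proof -
  interpret prob_space \<mu> using M1_D[OF assms(1)] by simp
  show ?thesis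
    using assms M1_D[OF assms(1)] by (intro integrable_const_bound[of _ B]) (auto intro: M1_measurable)
qed

lemma M1_integrable_continuous:
  fixes f :: "real \<Rightarrow> real"
  assumes "\<mu> \<in> M1" "continuous_on {0..1} f"
  shows "integrable \<mu> f"
proof -
  obtain B where "\<And>x. x \<in> {0..1} \<Longrightarrow> \<bar>f x\<bar> \<le> B"
    using continuous_unit_bounded[OF assms(2)] by metis
  with assms show ?thesis by (intro M1_integrable_bounded[of _ _ B] continuous_unit_measurable) auto
qed

lemma M1_integral_dist_le:
  fixes f g :: "real \<Rightarrow> real"
  assumes "\<mu> \<in> M1" "continuous_on {0..1} f" "continuous_on {0..1} g"
    and "\<And>x. x \<in> {0..1} \<Longrightarrow> \<bar>f x - g x\<bar> \<le> e"
  shows "\<bar>integral\<^sup>L \<mu> f - integral\<^sup>L \<mu> g\<bar> \<le> e"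
proof -
  interpret prob_space \<mu> using M1_D[OF assms(1)] by simp
  have i: "integrable \<mu> f" "integrable \<mu> g" using assms by (auto intro: M1_integrable_continuous)
  have "\<bar>integral\<^sup>L \<mu> f - integral\<^sup>L \<mu> g\<bar> = \<bar>\<integral>x. f x - g x \<partial>\<mu>\<bar>"
    using i by simp
  also have "\<dots> \<le> (\<integral>x. \<bar>f x - g x\<bar> \<partial>\<mu>)" by (rule integral_abs_bound)
  also have "\<dots> \<le> (\<integral>x. e \<partial>\<mu>)"
    using i assms(4) M1_D[OF assms(1)] by (intro integral_mono) auto
  finally show ?thesis by (simp add: prob_space)
qed

lemma M1_integral_pos:
  fixes f :: "real \<Rightarrow> real"
  assumes "\<mu> \<in> M1" "continuous_on {0..1} f" "\<And>x. x \<in> {0..1} \<Longrightarrow> 0 < f x"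
  shows "0 < integral\<^sup>L \<mu> f"
proof -
  interpret prob_space \<mu> using M1_D[OF assms(1)] by simp
  obtain z where z: "z \<in> {0..1}" "\<And>x. x \<in> {0..1} \<Longrightarrow> f z \<le> f x"
    using continuous_attains_inf[of "{0..1}" f] assms(2) by auto
  have "f z \<le> integral\<^sup>L \<mu> f"
    using z M1_D[OF assms(1)] by (intro integral_ge_const M1_integrable_continuous assms AE_I2) auto
  with assms(3)[OF z(1)] show ?thesis by simp
qed

section \<open>The weak topology and its moment coordinates\<close>

lemma openin_weak_generator:
  assumes "continuous_on {0..1} f" "open (U :: real set)"
  shows "openin weak_topology {\<mu> \<in> M1. integral\<^sup>L \<mu> f \<in> U}"
  unfolding weak_topology_def by (rule topology_generated_by_Basis) (use assms in blast)

lemma topspace_weak [simp]: "topspace weak_topology = M1"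
proof -
  have "M1 \<in> {{\<mu> \<in> M1. integral\<^sup>L \<mu> f \<in> U} | f U. continuous_on {0..1} f \<and> open (U :: real set)}"
  proof (intro CollectI exI conjI)
    show "M1 = {\<mu> \<in> M1. integral\<^sup>L \<mu> (\<lambda>x. 0) \<in> (UNIV :: real set)}" by simp
  qed (rule continuous_on_const, rule open_UNIV)
  from Union_upper[OF this] show ?thesis
    unfolding weak_topology_def topology_generated_by_topspace
    by (intro equalityI Union_least) auto
qed

lemma continuous_map_integral:
  assumes "continuous_on {0..1} f"
  shows "continuous_map weak_topology euclideanreal (\<lambda>\<mu>. integral\<^sup>L \<mu> f)"
  unfolding continuous_map_def using openin_weak_generator[OF assms] by auto

text \<open>By Weierstrass the powers span a dense subspace of the continuous functions, so they can
  take the place of the countable family that metrizes the weak topology.\<close>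

definition moments :: "real measure \<Rightarrow> nat \<Rightarrow> real" where
  "moments \<mu> k = (\<integral>x. x ^ k \<partial>\<mu>)"

lemma continuous_map_moments: "continuous_map weak_topology euclidean moments"
proof -
  have "continuous_map weak_topology (product_topology (\<lambda>_. euclideanreal) UNIV) moments"
    unfolding continuous_map_componentwise_UNIV moments_def
    by (intro allI continuous_map_integral continuous_intros)
  then show ?thesis by (simp add: euclidean_product_topology)
qed

lemma polynomial_approx:
  fixes f :: "real \<Rightarrow> real"
  assumes "continuous_on {0..1} f" "0 < e"
  obtains a n where "\<And>x. x \<in> {0..1} \<Longrightarrow> \<bar>f x - (\<Sum>i\<le>(n::nat). a i * x ^ i)\<bar> < e"
proof -
  obtain g where g: "real_polynomial_function g" "\<And>x. x \<in> {0..1} \<Longrightarrow> \<bar>f x - g x\<bar> < e"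
    using Stone_Weierstrass_real_polynomial_function[OF _ assms] by auto
  then obtain a n where "g = (\<lambda>x. \<Sum>i\<le>n. a i * x ^ i)"
    by (auto simp: real_polynomial_function_iff_sum)
  with g that show thesis by auto
qed

lemma integral_polynomial:
  assumes "\<mu> \<in> M1"
  shows "(\<integral>x. (\<Sum>i\<le>(n::nat). a i * x ^ i) \<partial>\<mu>) = (\<Sum>i\<le>n. a i * moments \<mu> i)"
proof -
  have "integrable \<mu> (\<lambda>x. x ^ i)" for i
    by (intro M1_integrable_continuous[OF assms] continuous_intros)
  then show ?thesis by (simp add: moments_def)
qed

text \<open>One polynomial approximates \<open>f\<close> with the same error under all probability
  measures, so finitely many moments control the integral up to that error.\<close>

lemma integral_tendsto_if_moments:
  fixes f :: "real \<Rightarrow> real"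
  assumes M: "\<And>n. \<mu> n \<in> M1" "\<nu> \<in> M1" and conv: "\<And>k. (\<lambda>n. moments (\<mu> n) k) \<longlonglongrightarrow> moments \<nu> k"
    and f: "continuous_on {0..1} f"
  shows "(\<lambda>n. integral\<^sup>L (\<mu> n) f) \<longlonglongrightarrow> integral\<^sup>L \<nu> f"
proof (rule LIMSEQ_I)
  fix e :: real assume "0 < e"
  then have "0 < e / 4" by simp
  then obtain a m where p: "\<And>x. x \<in> {0..1} \<Longrightarrow> \<bar>f x - (\<Sum>i\<le>(m::nat). a i * x ^ i)\<bar> < e/4"
    using polynomial_approx[OF f] by blast
  let ?p = "\<lambda>x. \<Sum>i\<le>m. a i * x ^ i"
  have d: "\<bar>integral\<^sup>L \<rho> f - (\<Sum>i\<le>m. a i * moments \<rho> i)\<bar> \<le> e/4" if "\<rho> \<in> M1" for \<rho>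
    unfolding integral_polynomial[OF that, symmetric]
    by (intro M1_integral_dist_le that f continuous_intros) (use p less_imp_le in blast)
  have "(\<lambda>n. \<Sum>i\<le>m. a i * moments (\<mu> n) i) \<longlonglongrightarrow> (\<Sum>i\<le>m. a i * moments \<nu> i)"
    by (intro tendsto_intros conv)
  from LIMSEQ_D[OF this \<open>0 < e / 4\<close>] obtain N where
    N: "\<forall>n\<ge>N. norm ((\<Sum>i\<le>m. a i * moments (\<mu> n) i) - (\<Sum>i\<le>m. a i * moments \<nu> i)) < e / 4" by blast
  show "\<exists>N. \<forall>n\<ge>N. norm (integral\<^sup>L (\<mu> n) f - integral\<^sup>L \<nu> f) < e"
  proof (intro exI allI impI)
    fix n assume "N \<le> n"
    with N have "\<bar>(\<Sum>i\<le>m. a i * moments (\<mu> n) i) - (\<Sum>i\<le>m. a i * moments \<nu> i)\<bar> < e / 4" by simp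
    with d[OF M(1)[of n]] d[OF M(2)] \<open>0 < e\<close> show "norm (integral\<^sup>L (\<mu> n) f - integral\<^sup>L \<nu> f) < e"
      unfolding real_norm_def by linarith
  qed
qed

text \<open>The weak topology is pulled back from the countable product \<open>nat \<Rightarrow> real\<close>, which makes the
  sequential notions of the metric space \<open>nat \<Rightarrow> real\<close> available.\<close>

lemma openin_weak_iff_moments:
  "openin weak_topology U \<longleftrightarrow> (\<exists>V. open V \<and> U = {\<mu> \<in> M1. moments \<mu> \<in> V})"
proof
  assume U: "openin weak_topology U"
  have gen: "\<exists>V. open V \<and> {\<mu> \<in> M1. integral\<^sup>L \<mu> f \<in> W} = {\<mu> \<in> M1. moments \<mu> \<in> V}"
    if f: "continuous_on {0..1} f" and W: "open (W :: real set)" for f W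
  proof -
    \<comment> \<open>A neighbourhood of each single point suffices, since the union of these
      neighbourhoods is the open set asked for.\<close>
    have "\<exists>V. open V \<and> moments \<mu> \<in> V \<and> (\<forall>\<rho>\<in>M1. moments \<rho> \<in> V \<longrightarrow> integral\<^sup>L \<rho> f \<in> W)"
      if \<mu>: "\<mu> \<in> M1" "integral\<^sup>L \<mu> f \<in> W" for \<mu>
    proof -
      obtain e where e: "0 < e" "\<And>y. \<bar>y - integral\<^sup>L \<mu> f\<bar> < e \<Longrightarrow> y \<in> W"
        using W \<mu>(2) unfolding open_dist dist_real_def by metis
      then have "0 < e/3" by simp
      then obtain a m where p: "\<And>x. x \<in> {0..1} \<Longrightarrow> \<bar>f x - (\<Sum>i\<le>(m::nat). a i * x ^ i)\<bar> < e/3"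
        using polynomial_approx[OF f] by blast
      have d: "\<bar>integral\<^sup>L \<rho> f - (\<Sum>i\<le>m. a i * moments \<rho> i)\<bar> \<le> e/3" if "\<rho> \<in> M1" for \<rho>
        unfolding integral_polynomial[OF that, symmetric]
        by (intro M1_integral_dist_le that f continuous_intros) (use p less_imp_le in blast)
      \<comment> \<open>Only finitely many coordinates are restricted, hence \<open>?V\<close> is
        open in the product topology. The three thirds of \<open>e\<close> pay for the polynomial at
        \<open>\<rho>\<close>, the polynomial at \<open>\<mu>\<close> and the change of
        moments.\<close>
      let ?V = "{z :: nat \<Rightarrow> real. \<bar>(\<Sum>i\<le>m. a i * z i) - (\<Sum>i\<le>m. a i * moments \<mu> i)\<bar> < e/3}"
      have "open ?V"
        by (intro open_Collect_less continuous_intros continuous_on_product_coordinates)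
      moreover have "integral\<^sup>L \<rho> f \<in> W" if "\<rho> \<in> M1" "moments \<rho> \<in> ?V" for \<rho>
      proof -
        have "\<bar>(\<Sum>i\<le>m. a i * moments \<rho> i) - (\<Sum>i\<le>m. a i * moments \<mu> i)\<bar> < e/3"
          using that(2) by simp
        with d[OF that(1)] d[OF \<mu>(1)] have "\<bar>integral\<^sup>L \<rho> f - integral\<^sup>L \<mu> f\<bar> < e" by linarith
        then show ?thesis by (rule e(2))
      qed
      ultimately show ?thesis using \<open>0 < e\<close> by (intro exI[of _ ?V]) auto
    qed
    then obtain V where V: "\<And>\<mu>. \<mu> \<in> M1 \<Longrightarrow> integral\<^sup>L \<mu> f \<in> W \<Longrightarrow> open (V \<mu>) \<and> moments \<mu> \<in> V \<mu> \<and>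
        (\<forall>\<rho>\<in>M1. moments \<rho> \<in> V \<mu> \<longrightarrow> integral\<^sup>L \<rho> f \<in> W)" by metis
    show ?thesis
      by (rule exI[of _ "\<Union>\<mu>\<in>{\<mu>\<in>M1. integral\<^sup>L \<mu> f \<in> W}. V \<mu>"]) (use V in blast)
  qed
  have "generate_topology_on {{\<mu> \<in> M1. integral\<^sup>L \<mu> f \<in> U} | f U. continuous_on {0..1} f \<and> open (U :: real set)} U"
    using U unfolding weak_topology_def openin_topology_generated_by_iff .
  then show "\<exists>V. open V \<and> U = {\<mu> \<in> M1. moments \<mu> \<in> V}"
  proof induction
    case Empty show ?case by (rule exI[of _ "{}"]) auto
  next
    case (Int a b)
    then obtain V W where "open V" "open W" "a = {\<mu> \<in> M1. moments \<mu> \<in> V}" "b = {\<mu> \<in> M1. moments \<mu> \<in> W}"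
      by blast
    then show ?case by (intro exI[of _ "V \<inter> W"]) auto
  next
    case (UN K)
    then have "\<forall>k. \<exists>V. k \<in> K \<longrightarrow> open V \<and> k = {\<mu> \<in> M1. moments \<mu> \<in> V}" by blast
    then obtain V where V: "\<And>k. k \<in> K \<Longrightarrow> open (V k)"
      "\<And>k. k \<in> K \<Longrightarrow> k = {\<mu> \<in> M1. moments \<mu> \<in> V k}"
      unfolding choice_iff by blast
    have "\<Union>K = (\<Union>k\<in>K. {\<mu> \<in> M1. moments \<mu> \<in> V k})" using V(2) by (simp cong: SUP_cong)
    with V(1) show ?case by (intro exI[of _ "\<Union>k\<in>K. V k"]) auto
  next
    case (Basis s)
    then show ?case using gen by force
  qed
next
  assume "\<exists>V. open V \<and> U = {\<mu> \<in> M1. moments \<mu> \<in> V}"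
  then show "openin weak_topology U"
    using continuous_map_moments unfolding continuous_map_def by auto
qed

text \<open>Helly selection. Since \<open>nat \<Rightarrow> real\<close> is metrizable, it is enough
  to extract convergent subsequences. Pushed forward to the real line, the measures are trivially
  tight and have a weak limit point there.\<close>

lemma compact_moments: "compact (moments ` M1)"
  unfolding compact_eq_seq_compact_metric seq_compact_def
proof (intro allI impI)
  fix z :: "nat \<Rightarrow> nat \<Rightarrow> real" assume "\<forall>n. z n \<in> moments ` M1"
  then have "\<forall>n. \<exists>\<rho>. \<rho> \<in> M1 \<and> z n = moments \<rho>" by blast
  then obtain \<mu> where \<mu>: "\<And>n. \<mu> n \<in> M1" "\<And>n. z n = moments (\<mu> n)"
    unfolding choice_iff by blast
  define \<rho> where "\<rho> n = distr (\<mu> n) borel (\<lambda>x. x)" for n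
  have meas: "(\<lambda>x. x) \<in> borel_measurable (\<mu> n)" for n
    by (rule M1_measurable[OF \<mu>(1) measurable_unit_borel])
  have rd: "real_distribution (\<rho> n)" for n
  proof -
    interpret prob_space "\<mu> n" using M1_D[OF \<mu>(1)] by simp
    show ?thesis unfolding \<rho>_def by (rule real_distribution_distr[OF meas])
  qed
  have "tight \<rho>"
    unfolding tight_def
  proof (intro conjI allI impI rd)
    fix e :: real assume "0 < e"
    \<comment> \<open>The left endpoint lies below 0 because the interval is open on that side and a
      possible atom at 0 must be included.\<close>
    have "measure (\<rho> n) {-1<..1} = 1" for n
    proof -
      interpret prob_space "\<mu> n" using M1_D[OF \<mu>(1)] by simp
      have "measure (\<rho> n) {-1<..1} = prob (space (\<mu> n))"
        unfolding \<rho>_def using M1_D(3)[OF \<mu>(1)[of n]] 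
        by (subst measure_distr[OF meas]) (auto intro!: arg_cong[where f=prob])
      then show ?thesis by (simp add: prob_space)
    qed
    then show "\<exists>a b. a < b \<and> (\<forall>n. 1 - e < measure (\<rho> n) {a<..b})"
      using \<open>0 < e\<close> by (intro exI[of _ "-1"] exI[of _ 1]) auto
  qed
  from tight_imp_convergent_subsubsequence[OF this strict_mono_id] obtain r M where
    r: "strict_mono (r :: nat \<Rightarrow> nat)" and M: "real_distribution M" and conv: "weak_conv_m (\<rho> \<circ> r) M"
    by (auto simp: comp_def)
  interpret M: real_distribution M by fact
  \<comment> \<open>Clamping makes the powers bounded and continuous on the whole line without
    changing them on the unit interval, and it turns the limit on the line into an element of
    \<open>M1\<close>.\<close>
  let ?c = "\<lambda>x::real. min 1 (max 0 x)"
  have c: "?c \<in> M \<rightarrow>\<^sub>M unit_borel"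
    unfolding unit_borel_def by (intro measurable_restrict_space2) auto
  define \<nu> where "\<nu> = distr M unit_borel ?c"
  have \<nu>: "\<nu> \<in> M1"
    unfolding \<nu>_def space_prob_algebra using M.prob_space_distr[OF c] by simp
  have "(\<lambda>n. moments (\<mu> (r n)) k) \<longlonglongrightarrow> moments \<nu> k" for k
  proof -
    have "(\<lambda>n. integral\<^sup>L ((\<rho> \<circ> r) n) (\<lambda>x. ?c x ^ k)) \<longlonglongrightarrow> integral\<^sup>L M (\<lambda>x. ?c x ^ k)"
    proof (rule weak_conv_imp_integral_bdd_continuous_conv[OF _ _ conv, where B=1])
      show "real_distribution ((\<rho> \<circ> r) n)" for n using rd by simp
      show "norm (?c x ^ k) \<le> 1" for x by (auto simp: power_le_one)
      show "isCont (\<lambda>x. ?c x ^ k) x" for x by (intro continuous_intros)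
    qed fact
    moreover have "integral\<^sup>L ((\<rho> \<circ> r) n) (\<lambda>x. ?c x ^ k) = moments (\<mu> (r n)) k" for n
      unfolding \<rho>_def comp_def moments_def using M1_D(3)[OF \<mu>(1)[of "r n"]]
      by (subst integral_distr[OF meas]) (auto intro!: Bochner_Integration.integral_cong)
    moreover have "integral\<^sup>L M (\<lambda>x. ?c x ^ k) = moments \<nu> k"
      unfolding \<nu>_def moments_def by (subst integral_distr[OF c]) (auto intro!: borel_measurable_power measurable_unit_borel)
    ultimately show ?thesis by simp
  qed
  then have "limitin (product_topology (\<lambda>_. euclideanreal) UNIV) (\<lambda>n. moments (\<mu> (r n))) (moments \<nu>) sequentially"
    by (auto simp: limitin_componentwise)
  then have "(z \<circ> r) \<longlonglongrightarrow> moments \<nu>"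
    by (simp add: \<mu>(2) comp_def euclidean_product_topology)
  then show "\<exists>l\<in>moments ` M1. \<exists>r. strict_mono r \<and> (z \<circ> r) \<longlonglongrightarrow> l"
    using \<nu> r by blast
qed

text \<open>Each member of an open cover is the preimage of an open set of sequences. These open
  sets cover the compact image of \<open>moments\<close>, and a finite subcover pulls back.\<close>

lemma compact_space_weak: "compact_space weak_topology"
  unfolding compact_space
proof (intro allI impI)
  fix \<U> assume "(\<forall>U\<in>\<U>. openin weak_topology U) \<and> \<Union> \<U> = topspace weak_topology"
  then have U: "\<And>U. U \<in> \<U> \<Longrightarrow> openin weak_topology U" and cov: "\<Union> \<U> = M1" by auto
  obtain V where V: "\<And>U. U \<in> \<U> \<Longrightarrow> open (V U) \<and> U = {\<mu> \<in> M1. moments \<mu> \<in> V U}"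
    using U unfolding openin_weak_iff_moments by metis
  have "moments ` M1 \<subseteq> (\<Union>U\<in>\<U>. V U)"
    using cov V by fastforce
  from compactE_image[OF compact_moments _ this] V obtain C where
    C: "C \<subseteq> \<U>" "finite C" "moments ` M1 \<subseteq> (\<Union>U\<in>C. V U)" by metis
  have "\<mu> \<in> \<Union>C" if "\<mu> \<in> M1" for \<mu>
  proof -
    obtain U where "U \<in> C" "moments \<mu> \<in> V U" using C(3) \<open>\<mu> \<in> M1\<close> by blast
    moreover have "U = {\<mu> \<in> M1. moments \<mu> \<in> V U}" using V C(1) \<open>U \<in> C\<close> by blast
    ultimately show ?thesis using \<open>\<mu> \<in> M1\<close> by blast
  qed
  then have "\<Union>C = M1" using C(1) cov by blast
  with C show "\<exists>\<F>. finite \<F> \<and> \<F> \<subseteq> \<U> \<and> \<Union> \<F> = topspace weak_topology"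
    by (intro exI[of _ C]) simp
qed

section \<open>Masses of closed sets and the Borel sets of the weak topology\<close>

text \<open>Lipschitz functions that decrease to the indicator of a closed set. For empty
  \<open>F\<close> the value is constantly 1, as \<open>infdist\<close> to the empty set is 0; this
  is why nonemptiness is assumed below.\<close>

definition closed_approx :: "real set \<Rightarrow> nat \<Rightarrow> real \<Rightarrow> real" where
  "closed_approx F n x = max 0 (1 - real n * infdist x F)"

lemma continuous_on_closed_approx: "continuous_on A (closed_approx F n)"
  unfolding closed_approx_def by (intro continuous_intros)

lemma closed_approx_bounds: "0 \<le> closed_approx F n x" "closed_approx F n x \<le> 1"
  by (auto simp: closed_approx_def infdist_nonneg)

lemma closed_approx_tendsto:
  assumes "closed F" "F \<noteq> {}"
  shows "(\<lambda>n. closed_approx F n x) \<longlonglongrightarrow> indicator F x"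
proof (cases "x \<in> F")
  case True
  then show ?thesis by (simp add: closed_approx_def)
next
  case False
  then have d: "0 < infdist x F" using assms by (metis in_closed_iff_infdist_zero infdist_nonneg less_eq_real_def)
  have "eventually (\<lambda>n. closed_approx F n x = 0) sequentially"
    using eventually_ge_at_top[of "nat \<lceil>1 / infdist x F\<rceil>"]
  proof eventually_elim
    case (elim n)
    then have "1 / infdist x F \<le> real n" by linarith
    then show ?case using d by (simp add: closed_approx_def field_simps)
  qed
  then show ?thesis using False by (simp add: tendsto_eventually)
qed

lemma integral_closed_approx_tendsto:
  assumes "finite_measure \<mu>" "sets \<mu> = sets unit_borel" "closed F" "F \<subseteq> {0..1}" "F \<noteq> {}"
  shows "(\<lambda>n. integral\<^sup>L \<mu> (closed_approx F n)) \<longlonglongrightarrow> measure \<mu> F"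
proof -
  interpret finite_measure \<mu> by fact
  have m: "f \<in> borel_measurable \<mu>" if "f \<in> borel_measurable unit_borel" for f :: "real \<Rightarrow> real"
    using that by (simp only: measurable_cong_sets[OF assms(2) refl])
  have F: "F \<in> sets \<mu>"
    using assms by (auto simp: sets_unit_borel sets_restrict_space intro!: image_eqI[of _ _ F])
  have "(\<lambda>n. integral\<^sup>L \<mu> (closed_approx F n)) \<longlonglongrightarrow> integral\<^sup>L \<mu> (indicator F)"
  proof (rule integral_dominated_convergence[where w="\<lambda>_. 1"])
    show "(indicat_real F) \<in> borel_measurable \<mu>" using F by simp
    show "closed_approx F n \<in> borel_measurable \<mu>" for n
      by (intro m continuous_unit_measurable continuous_on_closed_approx)
  qed (use closed_approx_bounds closed_approx_tendsto assms in auto)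
  moreover have "integral\<^sup>L \<mu> (indicator F) = measure \<mu> F"
    using F sets.sets_into_space by (simp add: Int_absorb2)
  ultimately show ?thesis by metis
qed

lemma sets_unit_borel_closed: "sets unit_borel = sigma_sets {0..1} {F. closed F \<and> F \<subseteq> {0..1}}"
proof -
  have "sets unit_borel = (\<inter>) {0..1} ` sigma_sets UNIV (Collect closed)"
    by (simp add: sets_unit_borel sets_restrict_space borel_eq_closed)
  also have "\<dots> = sigma_sets {0..1} ((\<inter>) {0..1} ` Collect closed)"
    by (rule sigma_sets_Int) (auto intro: sigma_sets.Basic)
  also have "((\<inter>) {0..1} ` Collect closed) = {F. closed F \<and> F \<subseteq> {0..1::real}}"
    by (auto intro: image_eqI[where x=F for F])
  finally show ?thesis .
qed

lemma closed_in_unit_borel: "closed F \<Longrightarrow> F \<subseteq> {0..1} \<Longrightarrow> F \<in> sets unit_borel"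
  unfolding sets_unit_borel_closed by (rule sigma_sets.Basic) simp

lemma space_borel_of [simp]: "space (borel_of X) = topspace X"
  by (simp add: borel_of_def space_measure_of_conv)

lemma sets_borel_of: "sets (borel_of X) = sigma_sets (topspace X) {U. openin X U}"
  unfolding borel_of_def by (rule sets_measure_of) (auto dest: openin_subset)

lemma borel_of_openin: "openin X U \<Longrightarrow> U \<in> sets (borel_of X)"
  unfolding sets_borel_of by (rule sigma_sets.Basic) simp

lemma continuous_map_measurable:
  fixes f :: "'a \<Rightarrow> 'b::topological_space"
  assumes "continuous_map X euclidean f" shows "f \<in> borel_measurable (borel_of X)"
proof (rule borel_measurableI)
  fix S :: "'b set" assume "open S"
  then have "openin X {x \<in> topspace X. f x \<in> S}"
    using assms unfolding continuous_map_def by auto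
  moreover have "{x \<in> topspace X. f x \<in> S} = f -` S \<inter> space (borel_of X)" by auto
  ultimately show "f -` S \<inter> space (borel_of X) \<in> sets (borel_of X)" by (metis borel_of_openin)
qed

text \<open>Connects the Borel sets of the weak topology with \<open>prob_algebra\<close>, for which
  measurability of kernels is stated. One inclusion holds because the topology comes from countably
  many measurable moments, the other because masses of closed sets are limits of continuous
  functionals.\<close>

lemma sets_borel_of_weak: "sets (borel_of weak_topology) = sets (prob_algebra unit_borel)"
proof
  have mm: "moments \<in> prob_algebra unit_borel \<rightarrow>\<^sub>M borel"
  proof (rule measurable_coordinatewise_then_product)
    fix k
    have "(\<lambda>\<mu>. \<integral>x. x ^ k \<partial>\<mu>) \<in> borel_measurable (subprob_algebra unit_borel)"
      using measurable_unit_borel by measurable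
    then show "(\<lambda>\<mu>. moments \<mu> k) \<in> prob_algebra unit_borel \<rightarrow>\<^sub>M borel"
      unfolding moments_def prob_algebra_def by (rule measurable_restrict_space1)
  qed
  have "U \<in> sets (prob_algebra unit_borel)" if "openin weak_topology U" for U
  proof -
    from openin_weak_iff_moments[THEN iffD1, OF that]
    obtain V where "open V" "U = {\<mu> \<in> M1. moments \<mu> \<in> V}" by (elim exE conjE)
    moreover have "moments -` V \<inter> M1 \<in> sets (prob_algebra unit_borel)"
      by (rule measurable_sets[OF mm borel_open[OF \<open>open V\<close>]])
    moreover have "moments -` V \<inter> M1 = {\<mu> \<in> M1. moments \<mu> \<in> V}" by (intro set_eqI) (simp add: conj_commute)
    ultimately show ?thesis by (simp only:)
  qed
  then show "sets (borel_of weak_topology) \<subseteq> sets (prob_algebra unit_borel)"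
    unfolding sets_borel_of topspace_weak by (intro sets.sigma_sets_subset) auto
next
  \<comment> \<open>The inclusion of the two families is measurability of the identity, which can be
    tested on an intersection-stable generator.\<close>
  have "(\<lambda>\<mu>. \<mu>) \<in> borel_of weak_topology \<rightarrow>\<^sub>M prob_algebra unit_borel"
  proof (rule measurable_prob_algebra_generated[OF sets_unit_borel_closed])
    fix F :: "real set" assume "F \<in> {F. closed F \<and> F \<subseteq> {0..1}}"
    then have F: "closed F" "F \<subseteq> {0..1}" by auto
    show "(\<lambda>\<mu>. emeasure \<mu> F) \<in> borel_measurable (borel_of weak_topology)"
    proof (cases "F = {}")
      case False
      have "(\<lambda>\<mu>. measure \<mu> F) \<in> borel_measurable (borel_of weak_topology)"
      proof (rule borel_measurable_LIMSEQ_real)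
        fix \<mu> assume "\<mu> \<in> space (borel_of weak_topology)"
        then have "\<mu> \<in> M1" by simp
        from M1_D[OF this] F False
        show "(\<lambda>n. integral\<^sup>L \<mu> (closed_approx F n)) \<longlonglongrightarrow> measure \<mu> F"
          by (intro integral_closed_approx_tendsto prob_space.finite_measure)
      qed (intro continuous_map_measurable continuous_map_integral continuous_on_closed_approx)
      then have "(\<lambda>\<mu>. ennreal (measure \<mu> F)) \<in> borel_measurable (borel_of weak_topology)"
        by measurable
      then show ?thesis
      proof (rule measurable_cong[THEN iffD1, rotated])
        fix \<mu> assume "\<mu> \<in> space (borel_of weak_topology)"
        then interpret prob_space \<mu> using M1_D by simp
        show "ennreal (measure \<mu> F) = emeasure \<mu> F" by (simp add: emeasure_eq_measure)
      qed
    qed simp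
  qed (auto simp: Int_stable_def M1_D)
  then show "sets (prob_algebra unit_borel) \<subseteq> sets (borel_of weak_topology)"
    by (intro subsetI) (auto dest: measurable_sets sets.sets_into_space simp: Int_absorb2 vimage_def)
qed

section \<open>The variational formula for the relative entropy\<close>

text \<open>The Donsker-Varadhan functional; its supremum over \<open>f\<close> is
  \<open>rel_entropy \<nu> \<mu>\<close>. For probability measures it does not change when a
  constant is added to \<open>f\<close>.\<close>

definition gibbs :: "real measure \<Rightarrow> real measure \<Rightarrow> (real \<Rightarrow> real) \<Rightarrow> real" where
  "gibbs \<nu> \<mu> f = integral\<^sup>L \<nu> f - ln (\<integral>x. exp (f x) \<partial>\<mu>)"

text \<open>A real-valued version \<open>D\<close> of the Radon-Nikodym derivative replaces the
  extended one. Characterising when the entropy is at most a real \<open>C\<close> treats the value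
  \<infinity> without a case distinction.\<close>

lemma rel_entropy_le_iff_density:
  assumes M: "\<nu> \<in> M1" "\<mu> \<in> M1" and ac: "absolutely_continuous \<mu> \<nu>"
  obtains D where "D \<in> borel_measurable unit_borel" "\<nu> = density \<mu> (\<lambda>x. ennreal (D x))"
    "AE x in \<nu>. 0 < D x" "\<And>x. 0 \<le> D x"
    "\<And>C. rel_entropy \<nu> \<mu> \<le> ereal C \<longleftrightarrow>
      integrable \<nu> (\<lambda>x. ln (D x)) \<and> (\<integral>x. ln (D x) \<partial>\<nu>) \<le> C"
proof -
  interpret mu: prob_space \<mu> using M1_D[OF M(2)] by simp
  interpret nu: prob_space \<nu> using M1_D[OF M(1)] by simp
  have sets: "sets \<nu> = sets \<mu>" "sets \<mu> = sets unit_borel" using M1_D M by auto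
  obtain D where D: "D \<in> borel_measurable \<mu>" "AE x in \<mu>. RN_deriv \<mu> \<nu> x = ennreal (D x)"
      "AE x in \<nu>. 0 < D x" "\<And>x. 0 \<le> D x"
    using mu.real_RN_deriv[OF nu.finite_measure_axioms ac sets(1)] by metis
  have D': "D \<in> borel_measurable unit_borel"
    using D(1) by (simp only: measurable_cong_sets[OF sets(2) refl])
  have D'': "D \<in> borel_measurable \<nu>"
    using D(1) by (simp only: measurable_cong_sets[OF sets(1) refl])
  have "density \<mu> (RN_deriv \<mu> \<nu>) = density \<mu> (\<lambda>x. ennreal (D x))"
    using D by (intro density_cong) auto
  then have dens: "\<nu> = density \<mu> (\<lambda>x. ennreal (D x))"
    using mu.density_RN_deriv[OF ac sets(1)] by simp
  have "AE x in \<nu>. RN_deriv \<mu> \<nu> x = ennreal (D x)"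
    by (rule absolutely_continuous_AE[OF sets(1) ac D(2)])
  then have ae: "AE x in \<nu>. entropy_density (exp 1) \<mu> \<nu> x = ln (D x)"
    by eventually_elim (simp add: entropy_density_def D(4) log_def)
  have em: "entropy_density (exp 1) \<mu> \<nu> \<in> borel_measurable \<nu>"
    using measurable_entropy_density[of "exp 1" \<mu> \<nu>] unfolding measurable_cong_sets[OF sets(1) refl] .
  have lm: "(\<lambda>x. ln (D x)) \<in> borel_measurable \<nu>" using D'' by measurable
  have "integrable \<nu> (entropy_density (exp 1) \<mu> \<nu>) \<longleftrightarrow> integrable \<nu> (\<lambda>x. ln (D x))"
    by (rule integrable_cong_AE[OF em lm ae])
  moreover have "KL_divergence (exp 1) \<mu> \<nu> = (\<integral>x. ln (D x) \<partial>\<nu>)"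
    unfolding KL_divergence_def by (rule integral_cong_AE[OF em lm ae])
  ultimately have "rel_entropy \<nu> \<mu> \<le> ereal C \<longleftrightarrow>
      integrable \<nu> (\<lambda>x. ln (D x)) \<and> (\<integral>x. ln (D x) \<partial>\<nu>) \<le> C" for C
    using ac by (auto simp: rel_entropy_def)
  from that[OF D' dens D(3,4) this] show thesis .
qed

text \<open>Jensen's inequality, in the form of \<open>ln y \<le> y - 1\<close> integrated against
  \<nu>.\<close>

lemma gibbs_le_rel_entropy:
  assumes M: "\<nu> \<in> M1" "\<mu> \<in> M1" and f: "continuous_on {0..1} f" and le: "rel_entropy \<nu> \<mu> \<le> ereal C"
  shows "gibbs \<nu> \<mu> f \<le> C"
proof -
  have ac: "absolutely_continuous \<mu> \<nu>"
    using le by (auto simp: rel_entropy_def split: if_splits)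
  interpret mu: prob_space \<mu> using M1_D[OF M(2)] by simp
  interpret nu: prob_space \<nu> using M1_D[OF M(1)] by simp
  obtain D where Dm: "D \<in> borel_measurable unit_borel" and dens: "\<nu> = density \<mu> (\<lambda>x. ennreal (D x))"
    and Dpos: "AE x in \<nu>. 0 < D x" and D0: "\<And>x. 0 \<le> D x"
    and KL: "\<And>C. rel_entropy \<nu> \<mu> \<le> ereal C \<longleftrightarrow>
      integrable \<nu> (\<lambda>x. ln (D x)) \<and> (\<integral>x. ln (D x) \<partial>\<nu>) \<le> C"
    using rel_entropy_le_iff_density[OF M ac] by blast
  have i: "integrable \<nu> (\<lambda>x. ln (D x))" and l: "(\<integral>x. ln (D x) \<partial>\<nu>) \<le> C"
    using KL le by auto
  have ef: "continuous_on {0..1} (\<lambda>x. exp (f x))" using f by (intro continuous_intros)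
  define Z where "Z = (\<integral>x. exp (f x) \<partial>\<mu>)"
  have Z: "0 < Z" unfolding Z_def by (rule M1_integral_pos[OF M(2) ef]) simp
  have Dmu: "D \<in> borel_measurable \<mu>" by (rule M1_measurable[OF M(2) Dm])
  have fmu: "(\<lambda>x. exp (f x)) \<in> borel_measurable \<mu>"
    by (intro M1_measurable[OF M(2)] continuous_unit_measurable ef)
  \<comment> \<open>The density of the normalised measure \<open>exp f / Z\<close> relative to
    \<nu>. Where \<open>D\<close> vanishes the quotient is 0 by convention and mass may be lost, so
    its \<nu>-integral is only shown to be at most 1.\<close>
  let ?h = "\<lambda>x. exp (f x) / (Z * D x)"
  have hm: "?h \<in> borel_measurable \<mu>" using Dmu fmu by measurable
  have ih': "integrable \<mu> (\<lambda>x. D x * ?h x)"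
  proof (rule Bochner_Integration.integrable_bound)
    show "integrable \<mu> (\<lambda>x. exp (f x) / Z)" using M1_integrable_continuous[OF M(2) ef] by simp
    show "(\<lambda>x. D x * ?h x) \<in> borel_measurable \<mu>" using hm Dmu by measurable
    show "AE x in \<mu>. norm (D x * ?h x) \<le> norm (exp (f x) / Z)"
      using Z D0 by (intro AE_I2) (auto simp: field_simps)
  qed
  have ih: "integrable \<nu> ?h"
    unfolding dens by (subst integrable_density[OF hm Dmu]) (use ih' D0 in auto)
  have "(\<integral>x. ?h x \<partial>\<nu>) = (\<integral>x. D x * ?h x \<partial>\<mu>)"
    unfolding dens using D0 by (subst integral_density[OF hm Dmu]) auto
  also have "\<dots> \<le> (\<integral>x. exp (f x) / Z \<partial>\<mu>)"
    using Z D0 M1_integrable_continuous[OF M(2) ef]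
    by (intro integral_mono[OF ih']) (auto simp: field_simps)
  also have "\<dots> = 1" using Z by (simp add: Z_def)
  finally have h1: "(\<integral>x. ?h x \<partial>\<nu>) \<le> 1" .
  have fi: "integrable \<nu> f" by (rule M1_integrable_continuous[OF M(1) f])
  have "(\<integral>x. f x - ln Z \<partial>\<nu>) \<le> (\<integral>x. ln (D x) + ?h x - 1 \<partial>\<nu>)"
  proof (rule integral_mono_AE)
    show "AE x in \<nu>. f x - ln Z \<le> ln (D x) + ?h x - 1"
      using Dpos
    proof eventually_elim
      case (elim x)
      have "ln (?h x) \<le> ?h x - 1" using elim Z by (intro ln_le_minus_one) simp
      then show ?case using elim Z by (simp add: ln_div ln_mult)
    qed
  qed (use i ih fi in auto)
  moreover have "(\<integral>x. f x - ln Z \<partial>\<nu>) = gibbs \<nu> \<mu> f"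
    using fi by (simp add: gibbs_def Z_def nu.prob_space)
  moreover have "(\<integral>x. ln (D x) + ?h x - 1 \<partial>\<nu>) = (\<integral>x. ln (D x) \<partial>\<nu>) + (\<integral>x. ?h x \<partial>\<nu>) - 1"
    using i ih by (simp add: nu.prob_space)
  ultimately show ?thesis using h1 l by linarith
qed

text \<open>A single approximating function has to serve both measures, since the variational inequality
  involves both.\<close>

definition L1_approximable :: "real measure \<Rightarrow> real measure \<Rightarrow> (real \<Rightarrow> real) \<Rightarrow> bool" where
  "L1_approximable \<mu> \<nu> f \<longleftrightarrow> f \<in> borel_measurable unit_borel \<and> (\<exists>B. \<forall>x\<in>{0..1}. \<bar>f x\<bar> \<le> B) \<and>
     (\<forall>e>0. \<exists>\<phi>. continuous_on {0..1} \<phi> \<and> (\<integral>x. \<bar>\<phi> x - f x\<bar> \<partial>\<mu>) < e \<and> (\<integral>x. \<bar>\<phi> x - f x\<bar> \<partial>\<nu>) < e)"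

text \<open>Inner regularity of measures on the line, transported along the inclusion of the
  interval.\<close>

lemma M1_inner_regular:
  assumes M: "\<mu> \<in> M1" and A: "A \<in> sets unit_borel" and e: "0 < e"
  obtains K where "closed K" "K \<subseteq> A" "measure \<mu> A < measure \<mu> K + e"
proof -
  interpret prob_space \<mu> using M1_D[OF M] by simp
  let ?M = "distr \<mu> borel (\<lambda>x. x)"
  have meas: "(\<lambda>x. x) \<in> borel_measurable \<mu>" by (rule M1_measurable[OF M measurable_unit_borel])
  interpret M: prob_space ?M by (rule prob_space_distr[OF meas])
  have A': "A \<in> sets borel" "A \<subseteq> {0..1}"
    using A by (auto simp: sets_unit_borel sets_restrict_space)
  have eq: "emeasure ?M S = emeasure \<mu> S" if "S \<in> sets borel" "S \<subseteq> {0..1}" for S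
    using that M1_D(3)[OF M] by (subst emeasure_distr[OF meas]) (auto intro!: arg_cong[where f="emeasure \<mu>"])
  show thesis
  proof (cases "measure \<mu> A = 0")
    case True
    then show ?thesis using e by (intro that[of "{}"]) auto
  next
    case False
    \<comment> \<open>Capping by half the mass keeps \<open>measure \<mu> A - e'\<close>
      nonnegative, so that \<open>ennreal\<close> does not cut it off.\<close>
    define e' where "e' = min e (measure \<mu> A / 2)"
    have "0 < measure \<mu> A" using False by (simp add: zero_less_measure_iff)
    then have e': "0 < e'" "e' \<le> e" "0 \<le> measure \<mu> A - e'"
      using e by (simp_all add: e'_def min_def)
    have "ennreal (measure \<mu> A - e') < ennreal (measure \<mu> A)"
      using False e' by (intro ennreal_lessI) (auto simp: zero_less_measure_iff)
    also have "\<dots> = (SUP K\<in>{K. K \<subseteq> A \<and> compact K}. emeasure ?M K)"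
      using inner_regular[of ?M A] A' eq[OF A'] by (simp add: emeasure_eq_measure)
    finally obtain K where K: "K \<subseteq> A" "compact K" "ennreal (measure \<mu> A - e') < emeasure ?M K"
      by (auto simp: less_SUP_iff)
    have "emeasure ?M K = measure \<mu> K"
      using K A' by (subst eq) (auto simp: emeasure_eq_measure compact_imp_closed)
    with K(3) have "ennreal (measure \<mu> A - e') < ennreal (measure \<mu> K)" by simp
    then have "measure \<mu> A - e' < measure \<mu> K" using e'(3) by (simp add: ennreal_less_iff)
    then show ?thesis using K e'(2) by (intro that[of K]) (auto simp: compact_imp_closed)
  qed
qed

lemma L1_approximable_indicator:
  assumes M: "\<mu> \<in> M1" "\<nu> \<in> M1" and A: "A \<in> sets unit_borel"
  shows "L1_approximable \<mu> \<nu> (indicator A)"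
  unfolding L1_approximable_def
proof (intro conjI allI impI)
  show "(indicat_real A) \<in> borel_measurable unit_borel" using A by simp
  show "\<exists>B. \<forall>x\<in>{0..1}. \<bar>indicat_real A x\<bar> \<le> B" by (intro exI[of _ 1]) simp
next
  fix e :: real assume e: "0 < e"
  obtain K1 where K1: "closed K1" "K1 \<subseteq> A" "measure \<mu> A < measure \<mu> K1 + e/2"
    using M1_inner_regular[OF M(1) A] e by (metis half_gt_zero)
  obtain K2 where K2: "closed K2" "K2 \<subseteq> A" "measure \<nu> A < measure \<nu> K2 + e/2"
    using M1_inner_regular[OF M(2) A] e by (metis half_gt_zero)
  have A01: "A \<subseteq> {0..1}" using sets.sets_into_space[OF A] by simp
  \<comment> \<open>The union approximates \<open>A\<close> from inside for both measures at once,
    which yields a single function for both.\<close>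
  let ?K = "K1 \<union> K2"
  have K: "closed ?K" "?K \<subseteq> A" "?K \<subseteq> {0..1}" using K1 K2 A01 by auto
  show "\<exists>\<phi>. continuous_on {0..1} \<phi> \<and> (\<integral>x. \<bar>\<phi> x - indicator A x\<bar> \<partial>\<mu>) < e \<and> (\<integral>x. \<bar>\<phi> x - indicator A x\<bar> \<partial>\<nu>) < e"
  proof (cases "?K = {}")
    \<comment> \<open>Here \<open>A\<close> has mass below \<open>e / 2\<close> under both measures,
      and the zero function does; \<open>closed_approx {}\<close> would be the constant 1.\<close>
    case True
    have "(\<integral>x. \<bar>0 - indicator A x\<bar> \<partial>\<rho>) < e" if "\<rho> \<in> M1" "measure \<rho> A < e/2" for \<rho>
      using that e A01 M1_D(3)[OF that(1)] by (simp add: Int_absorb2)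
    with True K1 K2 M show ?thesis by (intro exI[of _ "\<lambda>_. 0"]) auto
  next
    case False
    have "\<exists>N. \<forall>n\<ge>N. (\<integral>x. \<bar>closed_approx ?K n x - indicator A x\<bar> \<partial>\<rho>) < e"
      if R: "\<rho> \<in> M1" "closed L" "L \<subseteq> ?K" "measure \<rho> A < measure \<rho> L + e/2" for \<rho> L
    proof -
      interpret prob_space \<rho> using M1_D[OF R(1)] by simp
      have sets: "A \<in> sets \<rho>" "?K \<in> sets \<rho>" "L \<in> sets \<rho>"
        using A K closed_in_unit_borel[OF K(1,3)] closed_in_unit_borel[OF R(2) subset_trans[OF R(3) K(3)]]
          M1_D(2)[OF R(1)] by auto
      have lt: "measure \<rho> A < measure \<rho> ?K + e/2"
        using R(4) finite_measure_mono[OF R(3) sets(2)] by linarith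
      have diff: "measure \<rho> (A - ?K) = measure \<rho> A - measure \<rho> ?K"
        by (rule finite_measure_Diff[OF sets(1,2) K(2)])
      have m: "closed_approx ?K n \<in> borel_measurable \<rho>" for n
        by (intro M1_measurable[OF R(1)] continuous_unit_measurable continuous_on_closed_approx)
      have "(\<lambda>n. \<integral>x. \<bar>closed_approx ?K n x - indicator A x\<bar> \<partial>\<rho>) \<longlonglongrightarrow> (\<integral>x. \<bar>indicat_real ?K x - indicator A x\<bar> \<partial>\<rho>)"
      proof (rule integral_dominated_convergence[where w="\<lambda>_. 1"])
        show "AE x in \<rho>. (\<lambda>n. \<bar>closed_approx ?K n x - indicator A x\<bar>) \<longlonglongrightarrow> \<bar>indicator ?K x - indicat_real A x\<bar>"
          by (intro AE_I2 tendsto_intros closed_approx_tendsto K False)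
        show "AE x in \<rho>. norm \<bar>closed_approx ?K n x - indicat_real A x\<bar> \<le> 1" for n
          using closed_approx_bounds[of ?K n]
          by (intro AE_I2) (smt (verit) indicator_eq_0_iff indicator_eq_1_iff real_norm_def)
      qed (use sets m in measurable)
      also have "(\<integral>x. \<bar>indicat_real ?K x - indicator A x\<bar> \<partial>\<rho>) = (\<integral>x. indicat_real (A - ?K) x \<partial>\<rho>)"
        using K by (intro Bochner_Integration.integral_cong) (auto simp: indicator_def)
      also have "\<dots> = measure \<rho> (A - ?K)"
        using M1_D(3)[OF R(1)] subset_trans[OF Diff_subset A01, of ?K] by (simp add: Int_absorb2)
      finally show ?thesis
        using order_tendstoD(2)[of _ _ sequentially e] lt diff e by (auto simp: eventually_sequentially)
    qed
    from this[OF M(1) K1(1) _ K1(3)] this[OF M(2) K2(1) _ K2(3)] obtain N1 N2 where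
      "\<forall>n\<ge>N1. (\<integral>x. \<bar>closed_approx ?K n x - indicator A x\<bar> \<partial>\<mu>) < e"
      "\<forall>n\<ge>N2. (\<integral>x. \<bar>closed_approx ?K n x - indicator A x\<bar> \<partial>\<nu>) < e" by blast
    then show ?thesis
      by (intro exI[of _ "closed_approx ?K (max N1 N2)"] conjI continuous_on_closed_approx) auto
  qed
qed

lemma L1_approximable_integrable:
  assumes "\<rho> \<in> M1" "L1_approximable \<mu> \<nu> f" shows "integrable \<rho> f"
  using assms unfolding L1_approximable_def by (auto intro: M1_integrable_bounded)

lemma L1_approximable_measurable:
  "L1_approximable \<mu> \<nu> f \<Longrightarrow> f \<in> borel_measurable unit_borel"
  unfolding L1_approximable_def by (rule conjunct1)

lemma L1_approximable_add:
  assumes M: "\<mu> \<in> M1" "\<nu> \<in> M1" and f: "L1_approximable \<mu> \<nu> f" and g: "L1_approximable \<mu> \<nu> g"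
  shows "L1_approximable \<mu> \<nu> (\<lambda>x. f x + g x)"
  unfolding L1_approximable_def
proof (intro conjI allI impI)
  show "(\<lambda>x. f x + g x) \<in> borel_measurable unit_borel"
    by (intro borel_measurable_add L1_approximable_measurable[OF f] L1_approximable_measurable[OF g])
  obtain B C where "\<And>x. x \<in> {0..1} \<Longrightarrow> \<bar>f x\<bar> \<le> B" "\<And>x. x \<in> {0..1} \<Longrightarrow> \<bar>g x\<bar> \<le> C"
    using f g unfolding L1_approximable_def by blast
  then show "\<exists>B. \<forall>x\<in>{0..1}. \<bar>f x + g x\<bar> \<le> B"
    by (intro exI[of _ "B + C"] ballI) (smt (verit))
next
  fix e :: real assume "0 < e"
  then have e: "0 < e / 2" by simp
  obtain \<phi> where \<phi>: "continuous_on {0..1} \<phi>" "(\<integral>x. \<bar>\<phi> x - f x\<bar> \<partial>\<mu>) < e/2" "(\<integral>x. \<bar>\<phi> x - f x\<bar> \<partial>\<nu>) < e/2"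
    using f e unfolding L1_approximable_def by blast
  obtain \<psi> where \<psi>: "continuous_on {0..1} \<psi>" "(\<integral>x. \<bar>\<psi> x - g x\<bar> \<partial>\<mu>) < e/2" "(\<integral>x. \<bar>\<psi> x - g x\<bar> \<partial>\<nu>) < e/2"
    using g e unfolding L1_approximable_def by blast
  have "(\<integral>x. \<bar>\<phi> x + \<psi> x - (f x + g x)\<bar> \<partial>\<rho>) < e"
    if R: "\<rho> \<in> M1" "(\<integral>x. \<bar>\<phi> x - f x\<bar> \<partial>\<rho>) < e/2" "(\<integral>x. \<bar>\<psi> x - g x\<bar> \<partial>\<rho>) < e/2" for \<rho>
  proof -
    have i: "integrable \<rho> f" "integrable \<rho> g" "integrable \<rho> \<phi>" "integrable \<rho> \<psi>"
      using f g \<phi> \<psi> R by (auto intro: L1_approximable_integrable M1_integrable_continuous)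
    have "(\<integral>x. \<bar>\<phi> x + \<psi> x - (f x + g x)\<bar> \<partial>\<rho>) \<le> (\<integral>x. \<bar>\<phi> x - f x\<bar> + \<bar>\<psi> x - g x\<bar> \<partial>\<rho>)"
      using i by (intro integral_mono) auto
    also have "\<dots> = (\<integral>x. \<bar>\<phi> x - f x\<bar> \<partial>\<rho>) + (\<integral>x. \<bar>\<psi> x - g x\<bar> \<partial>\<rho>)"
      using i by simp
    finally show ?thesis using R by linarith
  qed
  then show "\<exists>\<phi>. continuous_on {0..1} \<phi> \<and> (\<integral>x. \<bar>\<phi> x - (f x + g x)\<bar> \<partial>\<mu>) < e \<and> (\<integral>x. \<bar>\<phi> x - (f x + g x)\<bar> \<partial>\<nu>) < e"
    by (intro exI[of _ "\<lambda>x. \<phi> x + \<psi> x"] conjI continuous_on_add \<phi>(1) \<psi>(1)) (use \<phi> \<psi> M in simp_all)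
qed

lemma L1_approximable_cmult:
  assumes f: "L1_approximable \<mu> \<nu> f"
  shows "L1_approximable \<mu> \<nu> (\<lambda>x. c * f x)"
  unfolding L1_approximable_def
proof (intro conjI allI impI)
  show "(\<lambda>x. c * f x) \<in> borel_measurable unit_borel"
    by (intro borel_measurable_times borel_measurable_const L1_approximable_measurable[OF f])
  obtain B where "\<And>x. x \<in> {0..1} \<Longrightarrow> \<bar>f x\<bar> \<le> B"
    using f unfolding L1_approximable_def by blast
  then show "\<exists>B. \<forall>x\<in>{0..1}. \<bar>c * f x\<bar> \<le> B"
    by (intro exI[of _ "\<bar>c\<bar> * B"]) (auto simp: abs_mult mult_left_mono)
next
  fix e :: real assume e: "0 < e"
  then have "0 < e / (\<bar>c\<bar> + 1)" by simp
  then obtain \<phi> where \<phi>: "continuous_on {0..1} \<phi>" "(\<integral>x. \<bar>\<phi> x - f x\<bar> \<partial>\<mu>) < e / (\<bar>c\<bar> + 1)"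
      "(\<integral>x. \<bar>\<phi> x - f x\<bar> \<partial>\<nu>) < e / (\<bar>c\<bar> + 1)"
    using f unfolding L1_approximable_def by blast
  have "(\<integral>x. \<bar>c * \<phi> x - c * f x\<bar> \<partial>\<rho>) < e" if "(\<integral>x. \<bar>\<phi> x - f x\<bar> \<partial>\<rho>) < e / (\<bar>c\<bar> + 1)" for \<rho>
  proof -
    have "(\<integral>x. \<bar>c * \<phi> x - c * f x\<bar> \<partial>\<rho>) = \<bar>c\<bar> * (\<integral>x. \<bar>\<phi> x - f x\<bar> \<partial>\<rho>)"
      by (simp flip: right_diff_distrib add: abs_mult)
    also have "\<dots> \<le> (\<bar>c\<bar> + 1) * (\<integral>x. \<bar>\<phi> x - f x\<bar> \<partial>\<rho>)"
      by (intro mult_right_mono integral_nonneg_AE) auto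
    also have "\<dots> < (\<bar>c\<bar> + 1) * (e / (\<bar>c\<bar> + 1))"
      using that by (intro mult_strict_left_mono) auto
    also have "\<dots> = e" by (simp add: add_nonneg_eq_0_iff)
    finally show ?thesis .
  qed
  with \<phi> show "\<exists>\<phi>. continuous_on {0..1} \<phi> \<and> (\<integral>x. \<bar>\<phi> x - c * f x\<bar> \<partial>\<mu>) < e \<and> (\<integral>x. \<bar>\<phi> x - c * f x\<bar> \<partial>\<nu>) < e"
    by (intro exI[of _ "\<lambda>x. c * \<phi> x"]) (auto intro: continuous_intros)
qed

lemma L1_approximable_sum:
  assumes M: "\<mu> \<in> M1" "\<nu> \<in> M1" and "finite I" "\<And>i. i \<in> I \<Longrightarrow> L1_approximable \<mu> \<nu> (f i)"
  shows "L1_approximable \<mu> \<nu> (\<lambda>x. \<Sum>i\<in>I. f i x)"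
  using assms(3,4)
proof (induction I rule: finite_induct)
  case empty
  show ?case
    unfolding L1_approximable_def by (auto intro!: exI[of _ 0] exI[of _ "\<lambda>_. 0"])
next
  case (insert i I)
  then show ?case by (simp add: L1_approximable_add[OF M])
qed

text \<open>Rounding \<open>f\<close> down to multiples of \<open>1 / n\<close> gives a finite
  combination of indicators that is within \<open>1 / n\<close> of \<open>f\<close> everywhere,
  hence close to it under any probability measure.\<close>

lemma L1_approximable_bounded:
  assumes M: "\<mu> \<in> M1" "\<nu> \<in> M1" and f: "f \<in> borel_measurable unit_borel"
    and B: "\<And>x. x \<in> {0..1} \<Longrightarrow> \<bar>f x\<bar> \<le> B"
  shows "L1_approximable \<mu> \<nu> f"
  unfolding L1_approximable_def
proof (intro conjI allI impI)
  show "\<exists>B. \<forall>x\<in>{0..1}. \<bar>f x\<bar> \<le> B" using B by blast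
next
  fix e :: real assume e: "0 < e"
  define n where "n = nat \<lceil>2 / e\<rceil> + 1"
  have n: "0 < n" "1 / real n < e / 2 + e / 2" "1 / real n \<le> e / 2"
  proof -
    show "0 < n" by (simp add: n_def)
    have "2 / e \<le> real n" unfolding n_def by linarith
    then show "1 / real n \<le> e / 2" using e \<open>0 < n\<close> by (simp add: field_simps)
    then show "1 / real n < e / 2 + e / 2" using e by linarith
  qed
  \<comment> \<open>Large enough for all values of the floor, so that every point of the interval
    lies in exactly one of the sets \<open>A k\<close> in the sum.\<close>
  define N where "N = \<lceil>B * real n\<rceil> + 1"
  define A where "A k = {x \<in> space unit_borel. \<lfloor>f x * real n\<rfloor> = k}" for k :: int
  have A: "A k \<in> sets unit_borel" for k unfolding A_def using f by measurable
  let ?s = "\<lambda>x. \<Sum>k\<in>{-N..N}. (of_int k / real n) * indicat_real (A k) x"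
  have s: "L1_approximable \<mu> \<nu> ?s"
    by (intro L1_approximable_sum M L1_approximable_cmult L1_approximable_indicator A) auto
  have close: "\<bar>?s x - f x\<bar> \<le> 1 / real n" if x: "x \<in> {0..1}" for x
  proof -
    let ?k = "\<lfloor>f x * real n\<rfloor>"
    have "\<bar>f x * real n\<bar> \<le> B * real n" using B[OF x] n(1) by (simp add: abs_mult)
    then have k: "?k \<in> {-N..N}" unfolding N_def by (simp add: abs_le_iff) linarith
    have "?s x = (\<Sum>k\<in>{-N..N}. if k = ?k then of_int k / real n else 0)"
      using x by (intro sum.cong) (auto simp: A_def indicator_def)
    also have "\<dots> = of_int ?k / real n" using k by (subst sum.delta) auto
    finally have "?s x - f x = (of_int ?k - f x * real n) / real n" using n(1) by (simp add: field_simps)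
    moreover have "\<bar>of_int ?k - f x * real n\<bar> \<le> 1" by linarith
    ultimately show ?thesis using n(1) by (simp add: divide_right_mono)
  qed
  obtain \<phi> where \<phi>: "continuous_on {0..1} \<phi>" "(\<integral>x. \<bar>\<phi> x - ?s x\<bar> \<partial>\<mu>) < e/2" "(\<integral>x. \<bar>\<phi> x - ?s x\<bar> \<partial>\<nu>) < e/2"
    using s half_gt_zero[OF e] unfolding L1_approximable_def by blast
  have "(\<integral>x. \<bar>\<phi> x - f x\<bar> \<partial>\<rho>) < e" if R: "\<rho> \<in> M1" "(\<integral>x. \<bar>\<phi> x - ?s x\<bar> \<partial>\<rho>) < e/2" for \<rho>
  proof -
    interpret prob_space \<rho> using M1_D[OF R(1)] by simp
    have i: "integrable \<rho> f" "integrable \<rho> ?s" "integrable \<rho> \<phi>"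
      by (rule M1_integrable_bounded[OF R(1) f B] L1_approximable_integrable[OF R(1) s]
        M1_integrable_continuous[OF R(1) \<phi>(1)]; assumption)+
    have "(\<integral>x. \<bar>\<phi> x - f x\<bar> \<partial>\<rho>) \<le> (\<integral>x. \<bar>\<phi> x - ?s x\<bar> + 1 / real n \<partial>\<rho>)"
    proof (rule integral_mono)
      show "\<bar>\<phi> x - f x\<bar> \<le> \<bar>\<phi> x - ?s x\<bar> + 1 / real n" if "x \<in> space \<rho>" for x
      proof -
        have "x \<in> {0..1}" using that M1_D(3)[OF R(1)] by simp
        from close[OF this] show ?thesis by linarith
      qed
      show "integrable \<rho> (\<lambda>x. \<bar>\<phi> x - f x\<bar>)" using i(1,3) by simp
      show "integrable \<rho> (\<lambda>x. \<bar>\<phi> x - ?s x\<bar> + 1 / real n)"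
        by (intro Bochner_Integration.integrable_add integrable_abs Bochner_Integration.integrable_diff i integrable_const)
    qed
    also have "\<dots> = (\<integral>x. \<bar>\<phi> x - ?s x\<bar> \<partial>\<rho>) + (\<integral>x. 1 / real n \<partial>\<rho>)"
      by (intro Bochner_Integration.integral_add integrable_abs Bochner_Integration.integrable_diff i integrable_const)
    finally show ?thesis using R(2) n(3) by (simp add: prob_space)
  qed
  from this[OF M(1) \<phi>(2)] this[OF M(2) \<phi>(3)]
  show "\<exists>\<phi>. continuous_on {0..1} \<phi> \<and> (\<integral>x. \<bar>\<phi> x - f x\<bar> \<partial>\<mu>) < e \<and> (\<integral>x. \<bar>\<phi> x - f x\<bar> \<partial>\<nu>) < e"
    by (intro exI[of _ \<phi>] conjI \<phi>(1))
qed fact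

text \<open>The indicators and truncated logarithms tested in \<open>rel_entropy_leI\<close> are not
  continuous. Approximation in the mean under both measures admits them as test functions.\<close>

lemma gibbs_bounded_le:
  assumes M: "\<nu> \<in> M1" "\<mu> \<in> M1"
    and le: "\<And>f. continuous_on {0..1} f \<Longrightarrow> gibbs \<nu> \<mu> f \<le> C"
    and f: "f \<in> borel_measurable unit_borel" and B: "\<And>x. x \<in> {0..1} \<Longrightarrow> \<bar>f x\<bar> \<le> B"
  shows "gibbs \<nu> \<mu> f \<le> C"
proof -
  interpret mu: prob_space \<mu> using M1_D[OF M(2)] by simp
  define Z where "Z = (\<integral>x. exp (f x) \<partial>\<mu>)"
  have efm: "(\<lambda>x. exp (f x)) \<in> borel_measurable unit_borel" using f by measurable
  have B0: "0 \<le> B" using B[of 0] by simp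
  have intf: "integrable \<nu> f" "integrable \<mu> f" by (rule M1_integrable_bounded[OF _ f B]; use M in simp)+
  have efb: "\<bar>exp (f x)\<bar> \<le> exp B" if "x \<in> {0..1}" for x
    using B[OF that] by simp
  have inte: "integrable \<mu> (\<lambda>x. exp (f x))" by (rule M1_integrable_bounded[OF M(2) efm efb])
  have "exp (-B) \<le> Z"
    unfolding Z_def using B M1_D(3)[OF M(2)]
    by (intro mu.integral_ge_const inte AE_I2) (force simp: abs_le_iff)
  then have Z: "0 < Z" by (smt (verit) exp_gt_zero)
  have step: "integral\<^sup>L \<nu> f \<le> C + e + ln (Z + exp B * e)" if e: "0 < e" for e
  proof -
    obtain \<psi> where \<psi>: "continuous_on {0..1} \<psi>" "(\<integral>x. \<bar>\<psi> x - f x\<bar> \<partial>\<mu>) < e" "(\<integral>x. \<bar>\<psi> x - f x\<bar> \<partial>\<nu>) < e"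
      using L1_approximable_bounded[OF M(2,1) f B] e unfolding L1_approximable_def by blast
    \<comment> \<open>Truncation at the bound \<open>B\<close> of \<open>f\<close> does not increase
      the distance to \<open>f\<close>, and it makes \<open>exp B\<close> a Lipschitz constant for
      the exponential on the values that occur.\<close>
    define \<phi> where "\<phi> x = max (-B) (min B (\<psi> x))" for x
    have \<phi>: "continuous_on {0..1} \<phi>" unfolding \<phi>_def by (intro continuous_intros \<psi>)
    have \<phi>B: "\<phi> x \<le> B" for x using B0 by (simp add: \<phi>_def)
    have cl: "\<bar>\<phi> x - f x\<bar> \<le> \<bar>\<psi> x - f x\<bar>" if "x \<in> {0..1}" for x
      using B[OF that] by (auto simp: \<phi>_def max_def min_def)
    have err: "(\<integral>x. \<bar>\<phi> x - f x\<bar> \<partial>\<rho>) \<le> (\<integral>x. \<bar>\<psi> x - f x\<bar> \<partial>\<rho>)" if R: "\<rho> \<in> M1" "integrable \<rho> f" for \<rho>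
      using R M1_integrable_continuous[OF R(1) \<phi>] M1_integrable_continuous[OF R(1) \<psi>(1)] cl M1_D(3)[OF R(1)]
      by (intro integral_mono) auto
    have i\<phi>: "integrable \<nu> \<phi>" by (rule M1_integrable_continuous[OF M(1) \<phi>])
    have e\<phi>: "continuous_on {0..1} (\<lambda>x. exp (\<phi> x))" by (intro continuous_intros \<phi>)
    have "integral\<^sup>L \<nu> f - integral\<^sup>L \<nu> \<phi> = (\<integral>x. f x - \<phi> x \<partial>\<nu>)"
      using intf i\<phi> by simp
    also have "\<dots> \<le> (\<integral>x. \<bar>\<phi> x - f x\<bar> \<partial>\<nu>)"
      using intf i\<phi> by (intro integral_mono) auto
    finally have 1: "integral\<^sup>L \<nu> f \<le> integral\<^sup>L \<nu> \<phi> + e"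
      using err[OF M(1) intf(1)] \<psi>(3) by linarith
    have "(\<integral>x. exp (\<phi> x) \<partial>\<mu>) - Z = (\<integral>x. exp (\<phi> x) - exp (f x) \<partial>\<mu>)"
      unfolding Z_def using inte M1_integrable_continuous[OF M(2) e\<phi>] by simp
    also have "\<dots> \<le> (\<integral>x. exp B * \<bar>\<phi> x - f x\<bar> \<partial>\<mu>)"
    proof (rule integral_mono)
      show "exp (\<phi> x) - exp (f x) \<le> exp B * \<bar>\<phi> x - f x\<bar>" for x
      proof -
        have "1 + (f x - \<phi> x) \<le> exp (f x - \<phi> x)" by (rule exp_ge_add_one_self)
        then have "exp (\<phi> x) * (1 + (f x - \<phi> x)) \<le> exp (\<phi> x) * exp (f x - \<phi> x)"
          by (intro mult_left_mono) auto
        also have "\<dots> = exp (f x)" by (simp flip: exp_add)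
        finally have "exp (\<phi> x) - exp (f x) \<le> exp (\<phi> x) * (\<phi> x - f x)" by (simp add: algebra_simps)
        also have "\<dots> \<le> exp (\<phi> x) * \<bar>\<phi> x - f x\<bar>" by (intro mult_left_mono) auto
        also have "\<dots> \<le> exp B * \<bar>\<phi> x - f x\<bar>" using \<phi>B by (intro mult_right_mono) auto
        finally show ?thesis .
      qed
    qed (use inte intf M1_integrable_continuous[OF M(2) e\<phi>] M1_integrable_continuous[OF M(2) \<phi>] in auto)
    also have "\<dots> = exp B * (\<integral>x. \<bar>\<phi> x - f x\<bar> \<partial>\<mu>)" by simp
    also have "\<dots> \<le> exp B * e" using err[OF M(2) intf(2)] \<psi>(2) by (intro mult_left_mono) auto
    finally have "(\<integral>x. exp (\<phi> x) \<partial>\<mu>) \<le> Z + exp B * e" by simp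
    then have "ln (\<integral>x. exp (\<phi> x) \<partial>\<mu>) \<le> ln (Z + exp B * e)"
      using M1_integral_pos[OF M(2) e\<phi>] by simp
    with le[OF \<phi>] 1 show ?thesis unfolding gibbs_def by linarith
  qed
  have "((\<lambda>e. C + e + ln (Z + exp B * e)) \<longlongrightarrow> C + 0 + ln (Z + exp B * 0)) (at_right 0)"
    using Z by (intro tendsto_intros) auto
  then have "integral\<^sup>L \<nu> f \<le> C + 0 + ln (Z + exp B * 0)"
    by (rule tendsto_lowerbound) (auto simp: eventually_at_right_less intro!: step eventually_at_rightI[of 0 1])
  then show ?thesis by (simp add: gibbs_def Z_def)
qed

text \<open>Large multiples of indicators of null sets force absolute continuity. The truncated
  logarithm of the density is then a nearly optimal test function, and the truncation is removed by
  Fatou's lemma and dominated convergence.\<close>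

lemma rel_entropy_leI:
  assumes M: "\<nu> \<in> M1" "\<mu> \<in> M1"
    and le: "\<And>f. continuous_on {0..1} f \<Longrightarrow> gibbs \<nu> \<mu> f \<le> C"
  shows "rel_entropy \<nu> \<mu> \<le> ereal C"
proof -
  interpret mu: prob_space \<mu> using M1_D[OF M(2)] by simp
  interpret nu: prob_space \<nu> using M1_D[OF M(1)] by simp
  have bounded_le: "gibbs \<nu> \<mu> f \<le> C"
    if "f \<in> borel_measurable unit_borel" "\<And>x. x \<in> {0..1} \<Longrightarrow> \<bar>f x\<bar> \<le> B" for f B
    by (rule gibbs_bounded_le[OF M le that])
  have ac: "absolutely_continuous \<mu> \<nu>"
    unfolding absolutely_continuous_def
  proof
    fix A assume "A \<in> null_sets \<mu>"
    then have A: "A \<in> sets unit_borel" "emeasure \<mu> A = 0" using M1_D(2)[OF M(2)] by auto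
    have A01: "A \<subseteq> {0..1}" using sets.sets_into_space[OF A(1)] by simp
    have A': "A \<in> sets \<mu>" "A \<in> sets \<nu>" using A M1_D(2) M by auto
    have "real n * measure \<nu> A \<le> C" for n
    proof -
      \<comment> \<open>The logarithmic term does not see a \<mu>-null set, so \<open>gibbs\<close>
        is \<open>n\<close> times the \<nu>-mass of \<open>A\<close>; a bound uniform in
        \<open>n\<close> makes that mass 0.\<close>
      let ?f = "\<lambda>x. real n * indicator A x"
      have "AE x in \<mu>. x \<notin> A"
        using A A' by (intro AE_not_in) (simp add: null_sets_def)
      then have "AE x in \<mu>. exp (?f x) = 1" by eventually_elim simp
      moreover have "(\<lambda>x. exp (?f x)) \<in> borel_measurable \<mu>" using A'(1) by measurable
      ultimately have e: "(\<integral>x. exp (?f x) \<partial>\<mu>) = (\<integral>x. 1 \<partial>\<mu>)"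
        by (intro integral_cong_AE) auto
      have "gibbs \<nu> \<mu> ?f \<le> C"
        using A(1) by (intro bounded_le[of _ "real n"]) (auto simp: indicator_def)
      moreover have "(\<integral>x. ?f x \<partial>\<nu>) = real n * measure \<nu> A"
        using A01 M1_D(3)[OF M(1)] by (simp add: Int_absorb2)
      ultimately show ?thesis
        unfolding gibbs_def e by (simp only: Bochner_Integration.lebesgue_integral_const mu.prob_space) simp
    qed
    then have "measure \<nu> A = 0"
      using reals_Archimedean3[of "measure \<nu> A"] by (metis measure_nonneg less_eq_real_def not_less)
    then show "A \<in> null_sets \<nu>"
      using A' by (auto simp: null_sets_def nu.emeasure_eq_measure)
  qed
  obtain D where Dm: "D \<in> borel_measurable unit_borel" and dens: "\<nu> = density \<mu> (\<lambda>x. ennreal (D x))"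
    and Dpos: "AE x in \<nu>. 0 < D x" and D0: "\<And>x. 0 \<le> D x"
    and KL: "\<And>C. rel_entropy \<nu> \<mu> \<le> ereal C \<longleftrightarrow>
      integrable \<nu> (\<lambda>x. ln (D x)) \<and> (\<integral>x. ln (D x) \<partial>\<nu>) \<le> C"
    using rel_entropy_le_iff_density[OF M ac] by blast
  have Dmu: "D \<in> borel_measurable \<mu>" by (rule M1_measurable[OF M(2) Dm])
  have Dnu: "D \<in> borel_measurable \<nu>" by (rule M1_measurable[OF M(1) Dm])
  have iD: "integrable \<mu> D" and D1: "(\<integral>x. D x \<partial>\<mu>) = 1"
  proof -
    have "(\<integral>\<^sup>+x. ennreal (D x) \<partial>\<mu>) = emeasure \<nu> (space \<nu>)"
      unfolding dens using Dmu by (subst emeasure_density) (auto intro!: nn_integral_cong)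
    then have e: "(\<integral>\<^sup>+x. ennreal (D x) \<partial>\<mu>) = ennreal 1" using nu.emeasure_space_1 by simp
    show "integrable \<mu> D" using Dmu D0 e by (intro integrableI_nonneg) auto
    show "(\<integral>x. D x \<partial>\<mu>) = 1" using Dmu D0 e by (subst integral_eq_nn_integral) auto
  qed
  \<comment> \<open>Truncating \<open>D\<close> rather than its logarithm also covers
    \<open>D x = 0\<close>. The lower cut adds at most \<open>exp (- n)\<close> to the
    normalisation, which vanishes in the limit.\<close>
  define F where "F n x = ln (max (exp (- real n)) (min (exp (real n)) (D x)))" for n x
  have Fm: "F n \<in> borel_measurable unit_borel" for n unfolding F_def using Dm by measurable
  have Fb: "\<bar>F n x\<bar> \<le> real n" for n x
  proof -
    have "F n x \<le> ln (exp (real n))" unfolding F_def by (intro ln_mono) (auto simp: less_max_iff_disj)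
    moreover have "ln (exp (- real n)) \<le> F n x" unfolding F_def by (intro ln_mono) auto
    ultimately show ?thesis by simp
  qed
  have F_int: "integral\<^sup>L \<nu> (F n) \<le> C + exp (- real n)" for n
  proof -
    have e: "exp (F n x) = max (exp (- real n)) (min (exp (real n)) (D x))" for x
      unfolding F_def by (subst exp_ln) (auto simp: less_max_iff_disj)
    have em: "(\<lambda>x. exp (F n x)) \<in> borel_measurable unit_borel" using Fm by measurable
    have ie: "integrable \<mu> (\<lambda>x. exp (F n x))"
      using Fb[of n] by (intro M1_integrable_bounded[OF M(2) em, of "exp (real n)"]) (simp add: abs_le_iff)
    have "(\<integral>x. exp (F n x) \<partial>\<mu>) \<le> (\<integral>x. D x + exp (- real n) \<partial>\<mu>)"
    proof (rule integral_mono)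
      show "exp (F n x) \<le> D x + exp (- real n)" for x
        unfolding e using D0[of x] exp_gt_zero[of "- real n"] by linarith
    qed (use ie iD in auto)
    also have "\<dots> = 1 + exp (- real n)" using iD by (simp add: D1 mu.prob_space)
    finally have le1: "(\<integral>x. exp (F n x) \<partial>\<mu>) \<le> 1 + exp (- real n)" .
    have "exp (- real n) \<le> (\<integral>x. exp (F n x) \<partial>\<mu>)"
    proof (intro mu.integral_ge_const ie AE_I2)
      show "exp (- real n) \<le> exp (F n x)" for x using Fb[of n x] unfolding exp_le_cancel_iff by linarith
    qed
    then have "0 < (\<integral>x. exp (F n x) \<partial>\<mu>)" by (smt (verit) exp_gt_zero)
    with le1 have "ln (\<integral>x. exp (F n x) \<partial>\<mu>) \<le> exp (- real n)"
      using ln_le_minus_one[of "\<integral>x. exp (F n x) \<partial>\<mu>"] by linarith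
    moreover have "gibbs \<nu> \<mu> (F n) \<le> C" by (rule bounded_le[OF Fm]) (rule Fb)
    ultimately show ?thesis unfolding gibbs_def by linarith
  qed
  have F_abs: "\<bar>F n x\<bar> \<le> \<bar>ln (D x)\<bar>" "- max 0 (- ln (D x)) \<le> F n x" if "0 < D x" for n x
  proof -
    have m: "min (exp p) (exp q) = exp (min p q)" "max (exp p) (exp q) = exp (max p q)" for p q :: real
      by (simp_all add: min_def max_def)
    have "F n x = ln (max (exp (- real n)) (min (exp (real n)) (exp (ln (D x)))))"
      using that by (simp add: F_def)
    then have a: "F n x = max (- real n) (min (real n) (ln (D x)))" unfolding m ln_exp .
    show "\<bar>F n x\<bar> \<le> \<bar>ln (D x)\<bar>" "- max 0 (- ln (D x)) \<le> F n x" unfolding a by auto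
  qed
  have F_lim: "(\<lambda>n. F n x) \<longlonglongrightarrow> ln (D x)" if "0 < D x" for x
  proof (rule tendsto_eventually)
    show "eventually (\<lambda>n. F n x = ln (D x)) sequentially"
      using eventually_ge_at_top[of "nat \<lceil>\<bar>ln (D x)\<bar>\<rceil>"]
    proof eventually_elim
      case (elim n)
      then have "\<bar>ln (D x)\<bar> \<le> real n" by linarith
      then have "exp (- real n) \<le> exp (ln (D x))" "exp (ln (D x)) \<le> exp (real n)"
        by (auto simp: abs_le_iff)
      with that show ?case by (simp add: F_def)
    qed
  qed
  \<comment> \<open>The negative part of the logarithm. It is \<nu>-integrable because
    \<open>D * h \<le> 1\<close>, and adding it makes the integrands nonnegative, as Fatou's lemma
    requires.\<close>
  define h where "h x = max 0 (- ln (D x))" for x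
  have hm: "h \<in> borel_measurable \<mu>" "h \<in> borel_measurable \<nu>" unfolding h_def using Dmu Dnu by measurable
  have ih: "integrable \<nu> h"
    unfolding dens
  proof (subst integrable_density[OF hm(1) Dmu])
    show "integrable \<mu> (\<lambda>x. D x *\<^sub>R h x)"
    proof (rule mu.integrable_const_bound[of _ 1])
      show "AE x in \<mu>. norm (D x *\<^sub>R h x) \<le> 1"
      proof (rule AE_I2)
        fix x
        show "norm (D x *\<^sub>R h x) \<le> 1"
        proof (cases "D x = 0")
          case False
          then have p: "0 < D x" using D0[of x] by simp
          have "ln (1 / D x) \<le> 1 / D x - 1" using p by (intro ln_le_minus_one) simp
          then have "- ln (D x) \<le> 1 / D x" using p by (simp add: ln_div)
          then have "h x \<le> 1 / D x" using p by (simp add: h_def)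
          then have "D x * h x \<le> D x * (1 / D x)" using p by (intro mult_left_mono) auto
          moreover have "0 \<le> h x" by (simp add: h_def)
          ultimately show ?thesis using p by (simp add: abs_mult)
        qed simp
      qed
      show "(\<lambda>x. D x *\<^sub>R h x) \<in> borel_measurable \<mu>" using Dmu hm by measurable
    qed
  qed (use D0 in auto)
  have Fi: "integrable \<nu> (F n)" for n by (rule M1_integrable_bounded[OF M(1) Fm Fb])
  have iln: "integrable \<nu> (\<lambda>x. ln (D x) + h x)"
  proof (rule integrableI_nonneg)
    show "(\<lambda>x. ln (D x) + h x) \<in> borel_measurable \<nu>" using Dnu hm by measurable
    show "AE x in \<nu>. 0 \<le> ln (D x) + h x" by (auto simp: h_def)
    have "(\<integral>\<^sup>+x. ennreal (ln (D x) + h x) \<partial>\<nu>) = (\<integral>\<^sup>+x. liminf (\<lambda>n. ennreal (F n x + h x)) \<partial>\<nu>)"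
    proof (rule nn_integral_cong_AE)
      show "AE x in \<nu>. ennreal (ln (D x) + h x) = liminf (\<lambda>n. ennreal (F n x + h x))"
        using Dpos
      proof eventually_elim
        case (elim x)
        have "(\<lambda>n. ennreal (F n x + h x)) \<longlonglongrightarrow> ennreal (ln (D x) + h x)"
          by (intro tendsto_ennrealI tendsto_intros F_lim elim)
        from lim_imp_Liminf[OF _ this] show ?case by simp
      qed
    qed
    also have "\<dots> \<le> liminf (\<lambda>n. \<integral>\<^sup>+x. ennreal (F n x + h x) \<partial>\<nu>)"
      using M1_measurable[OF M(1) Fm] hm by (intro nn_integral_liminf) auto
    also have "\<dots> \<le> liminf (\<lambda>n::nat. ennreal (C + 1 + integral\<^sup>L \<nu> h))"
    proof (intro Liminf_mono always_eventually allI)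
      fix n
      have "(\<integral>\<^sup>+x. ennreal (F n x + h x) \<partial>\<nu>) = ennreal (\<integral>x. F n x + h x \<partial>\<nu>)"
      proof (rule nn_integral_eq_integral)
        show "AE x in \<nu>. 0 \<le> F n x + h x"
          using Dpos
        proof eventually_elim
          case (elim x)
          from F_abs(2)[OF this, of n] show ?case by (simp add: h_def)
        qed
      qed (use Fi ih in auto)
      also have "(\<integral>x. F n x + h x \<partial>\<nu>) = integral\<^sup>L \<nu> (F n) + integral\<^sup>L \<nu> h"
        using Fi ih by simp
      also have "\<dots> \<le> C + 1 + integral\<^sup>L \<nu> h"
        using F_int[of n] exp_le_one_iff[of "- real n"] by linarith
      finally show "(\<integral>\<^sup>+x. ennreal (F n x + h x) \<partial>\<nu>) \<le> ennreal (C + 1 + integral\<^sup>L \<nu> h)"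
        by (simp add: ennreal_leI)
    qed
    also have "\<dots> < \<infinity>" by (simp add: Liminf_const)
    finally show "(\<integral>\<^sup>+x. ennreal (ln (D x) + h x) \<partial>\<nu>) < \<infinity>" .
  qed
  have "integrable \<nu> (\<lambda>x. (ln (D x) + h x) - h x)" by (intro Bochner_Integration.integrable_diff iln ih)
  then have i: "integrable \<nu> (\<lambda>x. ln (D x))" by simp
  have "(\<lambda>n. integral\<^sup>L \<nu> (F n)) \<longlonglongrightarrow> (\<integral>x. ln (D x) \<partial>\<nu>)"
  proof (rule integral_dominated_convergence[where w="\<lambda>x. \<bar>ln (D x)\<bar>"])
    show "AE x in \<nu>. (\<lambda>n. F n x) \<longlonglongrightarrow> ln (D x)" using Dpos by eventually_elim (rule F_lim)
    show "AE x in \<nu>. norm (F n x) \<le> \<bar>ln (D x)\<bar>" for n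
      using Dpos by eventually_elim (simp add: F_abs(1))
  qed (use i Dnu M1_measurable[OF M(1) Fm] in auto)
  moreover have "(\<lambda>n. C + exp (- real n)) \<longlonglongrightarrow> C + 0"
    by (intro tendsto_intros filterlim_compose[OF exp_at_bot] filterlim_compose[OF filterlim_uminus_at_bot_at_top] filterlim_real_sequentially)
  ultimately have "(\<integral>x. ln (D x) \<partial>\<nu>) \<le> C"
    using F_int by (metis (no_types, lifting) LIMSEQ_le add.right_neutral)
  with i show ?thesis using KL by blast
qed

section \<open>The Dirichlet process\<close>

text \<open>The integrand is the derivative of \<open>?F\<close>, which tends to
  \<open>- y powr (- a) / x\<close> at 0 and to 0 at 1. For \<open>a < 1\<close> the integrand is
  unbounded near 1, hence the fundamental theorem for nonnegative functions on an open
  interval.\<close>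

lemma beta_kernel_integral:
  fixes x y a :: real
  assumes a: "0 < a" and x: "0 < x" and y: "0 < y"
  shows "set_integrable lborel {0<..<1} (\<lambda>u. a * (1 - u) powr (a - 1) * (u * x + (1 - u) * y) powr (- a - 1))"
    and "(LBINT u:{0<..<1}. a * (1 - u) powr (a - 1) * (u * x + (1 - u) * y) powr (- a - 1)) = (1 / x) * y powr (- a)"
proof -
  let ?f = "\<lambda>u. a * (1 - u) powr (a - 1) * (u * x + (1 - u) * y) powr (- a - 1)"
  let ?L = "\<lambda>u. u * x + (1 - u) * y"
  let ?F = "\<lambda>u. - ((1 - u) powr a * ?L u powr (- a)) / x"
  have Lpos: "0 < ?L u" if "0 < u" "u < 1" for u using that x y by (simp add: add_pos_pos)
  have der: "DERIV ?F u :> ?f u" if u: "0 < ereal u" "ereal u < 1" for u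
  proof -
    from u have u: "0 < u" "u < 1" by auto
    let ?w = "?L u"
    have w: "0 < ?w" using Lpos u by auto
    have p: "(1 - u) powr a = (1 - u) powr (a - 1) * (1 - u)" "?w powr (- a) = ?w powr (- a - 1) * ?w"
      using u w powr_add[of "1 - u" "a - 1" 1] powr_add[of ?w "- a - 1" 1] by auto
    have d1: "DERIV (\<lambda>u. (1 - u) powr a) u :> a * (1 - u) powr (a - of_nat 1) * (- 1)"
      using u by (intro DERIV_fun_powr) (auto intro!: derivative_eq_intros)
    have d2: "DERIV (\<lambda>u. ?L u powr (- a)) u :> - a * ?w powr (- a - of_nat 1) * (x - y)"
      using w by (intro DERIV_fun_powr) (auto intro!: derivative_eq_intros)
    have "DERIV ?F u :> - ((a * (1 - u) powr (a - 1) * (- 1)) * ?w powr (- a) +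
        (1 - u) powr a * ((- a) * ?w powr (- a - 1) * (x - y))) / x"
      by (rule DERIV_cong[OF DERIV_cdivide[OF DERIV_minus[OF DERIV_mult[OF d1 d2]]]]) (simp add: algebra_simps)
    also have "- ((a * (1 - u) powr (a - 1) * (- 1)) * ?w powr (- a) +
        (1 - u) powr a * ((- a) * ?w powr (- a - 1) * (x - y))) / x =
        a * (1 - u) powr (a - 1) * ?w powr (- a - 1) * ((?w + (1 - u) * (x - y)) / x)"
      unfolding p by (simp add: algebra_simps)
    \<comment> \<open>The affine function \<open>?L\<close> has slope \<open>x - y\<close>, so
      continuing it from \<open>u\<close> to 1 gives its value \<open>x\<close> there.\<close>
    also have "(?w + (1 - u) * (x - y)) / x = 1" using x by (simp add: algebra_simps)
    finally show ?thesis by simp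
  qed
  have cont: "isCont ?f u" if "0 < ereal u" "ereal u < 1" for u
    using that Lpos[of u] by (intro continuous_intros) auto
  have nonneg: "AE u in lborel. 0 < ereal u \<longrightarrow> ereal u < 1 \<longrightarrow> 0 \<le> ?f u"
    using a by (intro AE_I2) auto
  have l0: "(?F \<longlongrightarrow> - ((1 - 0) powr a * (0 * x + (1 - 0) * y) powr (- a)) / x) (at_right 0)"
    using x y by (intro tendsto_intros) auto
  have l1: "(?F \<longlongrightarrow> - (0 * (1 * x + (1 - 1) * y) powr (- a)) / x) (at_left 1)"
  proof (intro tendsto_intros)
    show "((\<lambda>u. (1 - u) powr a) \<longlongrightarrow> 0) (at_left (1::real))"
    proof (rule tendsto_zero_powrI[where b=a])
      show "((\<lambda>u. 1 - u) \<longlongrightarrow> 0) (at_left (1::real))"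
        by (rule tendsto_eq_intros | simp)+
      show "eventually (\<lambda>u. 0 \<le> 1 - u) (at_left (1::real))"
        by (auto simp: eventually_at_filter)
    qed (use a in auto)
  qed (use x in auto)
  have A: "((?F \<circ> real_of_ereal) \<longlongrightarrow> - (y powr (- a)) / x) (at_right 0)"
    using l0 by (simp add: zero_ereal_def ereal_tendsto_simps del: zero_ereal_def[symmetric])
  have B: "((?F \<circ> real_of_ereal) \<longlongrightarrow> 0) (at_left 1)"
    using l1 by (simp add: one_ereal_def ereal_tendsto_simps)
  have ei: "einterval 0 1 = {0<..<1::real}" by (auto simp: einterval_def)
  note FTC = interval_integral_FTC_nonneg[OF _ der cont nonneg A B, simplified]
  show "set_integrable lborel {0<..<1} ?f" using FTC(1) by (simp add: ei)
  have "(LBINT u=0..1. ?f u) = y powr (- a) / x" using FTC(2) by simp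
  then show "(LBINT u:{0<..<1}. ?f u) = (1 / x) * y powr (- a)"
    by (simp add: interval_lebesgue_integral_def ei)
qed

lemma sets_beta [simp, measurable_cong]: "sets (beta_distribution p q) = sets borel"
  by (simp add: beta_distribution_def)

lemma nn_integral_beta_1:
  assumes a: "0 < a" and f: "f \<in> borel_measurable borel"
  shows "(\<integral>\<^sup>+u. f u \<partial>beta_distribution 1 a) = (\<integral>\<^sup>+u. ennreal (indicator {0<..<1} u * (a * (1 - u) powr (a - 1))) * f u \<partial>lborel)"
proof -
  have "Beta 1 a = 1 / a"
    using a Gamma_plus1[of a] by (simp add: Beta_def add.commute Gamma_eq_zero_iff nonpos_Ints_def)
  then show ?thesis
    unfolding beta_distribution_def using f a
    by (subst nn_integral_density) (auto intro!: nn_integral_cong simp: indicator_def mult_ac)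
qed

lemma nn_integral_beta_kernel:
  assumes a: "0 < a" and x: "0 < x" and y: "0 < y"
  shows "(\<integral>\<^sup>+u. ennreal ((u * x + (1 - u) * y) powr (- a - 1)) \<partial>beta_distribution 1 a) = ennreal (1 / x * y powr (- a))"
proof -
  let ?f = "\<lambda>u. a * (1 - u) powr (a - 1) * (u * x + (1 - u) * y) powr (- a - 1)"
  have "(\<integral>\<^sup>+u. ennreal ((u * x + (1 - u) * y) powr (- a - 1)) \<partial>beta_distribution 1 a) =
      (\<integral>\<^sup>+u. ennreal (indicator {0<..<1} u *\<^sub>R ?f u) \<partial>lborel)"
    using a by (subst nn_integral_beta_1)
      (auto intro!: nn_integral_cong simp: indicator_def ennreal_mult[symmetric])
  also have "\<dots> = ennreal (LBINT u:{0<..<1}. ?f u)"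
    using beta_kernel_integral(1)[OF assms] a unfolding set_integrable_def set_lebesgue_integral_def
    by (intro nn_integral_eq_integral) (auto simp: indicator_def)
  finally show ?thesis by (simp only: beta_kernel_integral(2)[OF assms])
qed

lemma prob_space_beta_1:
  assumes "0 < a" shows "prob_space (beta_distribution 1 a)"
  \<comment> \<open>For \<open>x = y = 1\<close> the kernel is constantly 1, and the formula is the
    normalisation of the density.\<close>
  using nn_integral_beta_kernel[OF assms, of 1 1] by (intro prob_spaceI) simp

lemma AE_beta_1:
  assumes "0 < a" shows "AE u in beta_distribution 1 a. 0 < u \<and> u < 1"
  unfolding beta_distribution_def
  by (subst AE_density) (auto simp: indicator_def)

section \<open>Independent sequences and stick breaking\<close>

text \<open>An i.i.d. sequence splits into its first entry and an independent sequence of the same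
  law. This is the source of the fixed point equation.\<close>

lemma nn_integral_PiM_case_nat:
  assumes M: "prob_space M" and f: "f \<in> borel_measurable (PiM UNIV (\<lambda>_::nat. M))"
  shows "(\<integral>\<^sup>+\<omega>. f \<omega> \<partial>PiM UNIV (\<lambda>_::nat. M)) = (\<integral>\<^sup>+x. (\<integral>\<^sup>+\<omega>. f (case_nat x \<omega>) \<partial>PiM UNIV (\<lambda>_::nat. M)) \<partial>M)"
proof -
  interpret M: prob_space M by fact
  interpret sequence_space M ..
  have m: "(\<lambda>(s, \<omega>). case_nat s \<omega>) \<in> M \<Otimes>\<^sub>M S \<rightarrow>\<^sub>M S" by measurable
  have "(\<integral>\<^sup>+\<omega>. f \<omega> \<partial>S) = (\<integral>\<^sup>+z. f (case_nat (fst z) (snd z)) \<partial>(M \<Otimes>\<^sub>M S))"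
    using f m by (subst PiM_iter[symmetric]) (simp add: nn_integral_distr split_beta')
  also have "\<dots> = (\<integral>\<^sup>+x. (\<integral>\<^sup>+\<omega>. f (case_nat x \<omega>) \<partial>S) \<partial>M)"
    using measurable_compose[OF m f] by (subst P.nn_integral_fst[symmetric]) (auto simp: split_beta')
  finally show ?thesis .
qed

text \<open>The product is the length of the remaining stick, so its convergence to 0 says that the
  weights sum to 1.\<close>

definition good_sticks :: "(nat \<Rightarrow> real) \<Rightarrow> bool" where
  "good_sticks U \<longleftrightarrow> (\<forall>k. 0 < U k \<and> U k < 1) \<and> (\<lambda>n. \<Prod>k<n. 1 - U k) \<longlonglongrightarrow> 0"

lemma good_sticks_nonneg: "good_sticks U \<Longrightarrow> 0 \<le> stick_breaking U n"
  unfolding good_sticks_def stick_breaking_def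
  by (intro mult_nonneg_nonneg prod_nonneg) (auto simp: less_imp_le)

lemma sum_stick_breaking: "(\<Sum>i<n. stick_breaking U i) = 1 - (\<Prod>k<n. 1 - U k)"
  by (induction n) (auto simp: stick_breaking_def algebra_simps)

lemma good_sticks_sums: "good_sticks U \<Longrightarrow> stick_breaking U sums 1"
  unfolding good_sticks_def sums_def sum_stick_breaking
  using tendsto_diff[of "\<lambda>_. 1" 1 sequentially "\<lambda>n. \<Prod>k<n. 1 - U k" 0] by auto

lemma stick_breaking_case_nat:
  "stick_breaking (case_nat u U) 0 = u"
  "stick_breaking (case_nat u U) (Suc n) = (1 - u) * stick_breaking U n"
  by (auto simp: stick_breaking_def prod.lessThan_Suc_shift simp del: prod.lessThan_Suc)

lemma good_sticks_case_nat:
  assumes "good_sticks U" "0 < u" "u < 1" shows "good_sticks (case_nat u U)"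
proof -
  have "(\<lambda>n. (1 - u) * (\<Prod>k<n. 1 - U k)) \<longlonglongrightarrow> (1 - u) * 0"
    using assms(1) unfolding good_sticks_def by (intro tendsto_intros) auto
  then have "(\<lambda>n. \<Prod>k<Suc n. 1 - case_nat u U k) \<longlonglongrightarrow> 0"
    by (simp add: prod.lessThan_Suc_shift del: prod.lessThan_Suc)
  then have "(\<lambda>n. \<Prod>k<n. 1 - case_nat u U k) \<longlonglongrightarrow> 0"
    by (subst filterlim_sequentially_Suc[symmetric])
  then show ?thesis using assms by (auto simp: good_sticks_def split: nat.split)
qed

text \<open>The expected remaining length after \<open>n\<close> breaks is \<open>q ^ n\<close> with
  \<open>q < 1\<close>. These expectations are summable, so almost surely the lengths are summable
  and tend to 0.\<close>

lemma AE_good_sticks: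
  assumes a: "0 < a"
  shows "AE U in PiM UNIV (\<lambda>_::nat. beta_distribution 1 a). good_sticks U"
proof -
  let ?B = "beta_distribution 1 a"
  let ?S = "PiM UNIV (\<lambda>_::nat. ?B)"
  interpret B: prob_space ?B by (rule prob_space_beta_1[OF a])
  interpret sequence_space ?B ..
  have 01: "AE U in ?S. \<forall>k. 0 < U k \<and> U k < 1"
    unfolding AE_all_countable
    by (intro allI AE_PiM_component[where M="\<lambda>_. ?B"] AE_beta_1 a) (auto intro: B.prob_space_axioms)
  \<comment> \<open>Clamping changes nothing on the almost sure range and makes the products
    nonnegative and bounded everywhere.\<close>
  let ?c = "\<lambda>u. max 0 (min 1 (1 - u)) :: real"
  let ?p = "\<lambda>n U. \<Prod>k<n. ?c (U k)"
  define q where "q = (\<integral>u. ?c u \<partial>?B)"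
  have cm: "?c \<in> borel_measurable ?B" by measurable
  have ic: "integrable ?B ?c" using cm by (intro B.integrable_const_bound[of _ 1]) auto
  have "q < (\<integral>u. 1 \<partial>?B)"
    unfolding q_def
  proof (rule B.integral_less_AE_space)
    show "AE u in ?B. ?c u < 1" using AE_beta_1[OF a] by eventually_elim auto
  qed (use ic B.emeasure_space_1 in auto)
  then have q1: "q < 1" by (simp add: B.prob_space)
  have q0: "0 \<le> q" unfolding q_def by (intro integral_nonneg_AE) auto
  have nq: "(\<integral>\<^sup>+u. ennreal (?c u) \<partial>?B) = ennreal q"
    unfolding q_def using ic by (intro nn_integral_eq_integral) auto
  have pm: "?p n \<in> borel_measurable ?S" for n by measurable
  have "(\<integral>\<^sup>+U. ennreal (?p n U) \<partial>?S) = ennreal (q ^ n)" for n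
  proof (induction n)
    case 0
    show ?case using P.emeasure_space_1 by simp
  next
    case (Suc n)
    have "(\<integral>\<^sup>+U. ennreal (?p (Suc n) U) \<partial>?S) = (\<integral>\<^sup>+u. \<integral>\<^sup>+U. ennreal (?p (Suc n) (case_nat u U)) \<partial>?S \<partial>?B)"
      using pm by (intro nn_integral_PiM_case_nat B.prob_space_axioms) measurable
    also have "\<dots> = (\<integral>\<^sup>+u. \<integral>\<^sup>+U. ennreal (?c u) * ennreal (?p n U) \<partial>?S \<partial>?B)"
      by (intro nn_integral_cong, subst ennreal_mult[symmetric])
         (auto simp: prod.lessThan_Suc_shift simp del: prod.lessThan_Suc intro: prod_nonneg)
    also have "\<dots> = (\<integral>\<^sup>+u. ennreal (?c u) * ennreal (q ^ n) \<partial>?B)"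
      using pm[of n] by (simp add: nn_integral_cmult Suc.IH)
    also have "\<dots> = ennreal q * ennreal (q ^ n)"
    proof -
      have "(\<lambda>u. ennreal (?c u)) \<in> borel_measurable ?B" using cm by measurable
      from nn_integral_multc[OF this, of "ennreal (q ^ n)"] show ?thesis by (simp only: nq)
    qed
    finally show ?case using q0 by (simp add: ennreal_mult')
  qed
  then have "(\<integral>\<^sup>+U. (\<Sum>n. ennreal (?p n U)) \<partial>?S) = (\<Sum>n. ennreal (q ^ n))"
    using pm by (subst nn_integral_suminf) auto
  also have "\<dots> = ennreal (\<Sum>n. q ^ n)"
    using q0 q1 by (intro suminf_ennreal2) auto
  finally have "(\<integral>\<^sup>+U. (\<Sum>n. ennreal (?p n U)) \<partial>?S) \<noteq> \<infinity>" by simp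
  then have "AE U in ?S. (\<Sum>n. ennreal (?p n U)) \<noteq> \<infinity>"
    using pm by (intro nn_integral_PInf_AE) auto
  with 01 show ?thesis
  proof eventually_elim
    case (elim U)
    have "summable (\<lambda>n. ?p n U)"
      using elim(2) by (intro summable_suminf_not_top) (auto intro: prod_nonneg)
    from summable_LIMSEQ_zero[OF this] have "(\<lambda>n. ?p n U) \<longlonglongrightarrow> 0" .
    moreover have "?c (U k) = 1 - U k" for k using elim(1)[rule_format, of k] by auto
    ultimately show ?case using elim(1) by (simp add: good_sticks_def)
  qed
qed

section \<open>Random atomic measures and their measurability\<close>

text \<open>As the image of the weights under the enumeration of the atoms, the set function is a
  measure, and its integrals become series.\<close>

lemma atomic_measure_eq_distr:
  assumes V: "\<And>i. 0 \<le> V i" "V sums 1" and \<xi>: "\<And>i. \<xi> i \<in> {0..1}"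
  shows "atomic_measure V \<xi> = distr (density (count_space UNIV) (\<lambda>i. ennreal (V i))) unit_borel \<xi>"
proof -
  let ?N = "density (count_space UNIV) (\<lambda>i. ennreal (V i))"
  have "(\<Sum>i. ennreal (V i) * indicator A (\<xi> i)) = emeasure ?N (\<xi> -` A \<inter> space ?N)" for A
    by (subst emeasure_density)
       (auto simp: nn_integral_count_space_nat indicator_def intro!: suminf_cong)
  with V show ?thesis
    by (simp add: atomic_measure_def distr_def)
qed

lemma atomic_measure_in_M1:
  assumes \<xi>: "\<And>i. \<xi> i \<in> {0..1}"
  shows "atomic_measure V \<xi> \<in> M1"
proof (cases "(\<forall>i. 0 \<le> V i) \<and> V sums 1")
  case True
  then have "(\<Sum>i. ennreal (V i)) = ennreal 1"
    by (intro sums_unique[symmetric]) (subst sums_ennreal; simp)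
  then have "prob_space (density (count_space UNIV) (\<lambda>i. ennreal (V i)))"
    by (intro prob_spaceI) (simp add: emeasure_density nn_integral_count_space_nat)
  then have "prob_space (atomic_measure V \<xi>)"
    using True \<xi> by (subst atomic_measure_eq_distr) (auto intro!: prob_space.prob_space_distr)
  moreover have "sets (atomic_measure V \<xi>) = sets unit_borel"
    using True \<xi> by (subst atomic_measure_eq_distr) auto
  ultimately show ?thesis by (simp add: space_prob_algebra)
next
  case False
  then have "atomic_measure V \<xi> = return unit_borel (\<xi> 0)" by (auto simp: atomic_measure_def)
  then show ?thesis using \<xi>[of 0] by (auto simp: space_prob_algebra intro!: prob_space_return)
qed

lemma emeasure_atomic_measure:
  assumes V: "\<And>i. 0 \<le> V i" "V sums 1" and \<xi>: "\<And>i. \<xi> i \<in> {0..1}" and A: "A \<in> sets unit_borel"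
  shows "emeasure (atomic_measure V \<xi>) A = (\<Sum>i. ennreal (V i) * indicator A (\<xi> i))"
proof -
  have "emeasure (atomic_measure V \<xi>) A = emeasure (density (count_space UNIV) (\<lambda>i. ennreal (V i))) (\<xi> -` A)"
    using \<xi> A by (simp add: atomic_measure_eq_distr[OF V \<xi>] emeasure_distr)
  also have "\<dots> = (\<Sum>i. ennreal (V i) * indicator A (\<xi> i))"
    by (subst emeasure_density)
       (auto simp: nn_integral_count_space_nat indicator_def intro!: suminf_cong)
  finally show ?thesis .
qed

lemma integral_atomic_measure:
  fixes f :: "real \<Rightarrow> real"
  assumes V: "\<And>i. 0 \<le> V i" "V sums 1" and \<xi>: "\<And>i. \<xi> i \<in> {0..1}" and f: "continuous_on {0..1} f"
  shows "(\<lambda>i. V i * f (\<xi> i)) sums (integral\<^sup>L (atomic_measure V \<xi>) f)"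
proof -
  have fm: "f \<in> borel_measurable unit_borel" by (rule continuous_unit_measurable[OF f])
  have xm: "\<xi> \<in> density (count_space UNIV) (\<lambda>i. ennreal (V i)) \<rightarrow>\<^sub>M unit_borel" using \<xi> by auto
  have i: "integrable (atomic_measure V \<xi>) f"
    by (rule M1_integrable_continuous[OF atomic_measure_in_M1[OF \<xi>] f])
  have ci: "integrable (count_space UNIV) (\<lambda>i. V i * f (\<xi> i))"
    using i V(1) unfolding atomic_measure_eq_distr[OF V \<xi>] integrable_distr_eq[OF xm fm]
    by (subst (asm) integrable_density) auto
  have "integral\<^sup>L (atomic_measure V \<xi>) f = (\<integral>i. V i * f (\<xi> i) \<partial>count_space UNIV)"
    unfolding atomic_measure_eq_distr[OF V \<xi>] integral_distr[OF xm fm]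
    using V(1) by (subst integral_density) auto
  with sums_integral_count_space_nat[OF ci] show ?thesis by simp
qed

abbreviation atoms_space :: "(nat \<Rightarrow> real) measure" where
  "atoms_space \<equiv> PiM UNIV (\<lambda>_::nat. unit_borel)"

abbreviation sticks_space :: "(nat \<Rightarrow> real) measure" where
  "sticks_space \<equiv> PiM UNIV (\<lambda>_::nat. borel :: real measure)"

lemma atoms_spaceD: "\<xi> \<in> space atoms_space \<Longrightarrow> \<xi> i \<in> {0..1}"
  by (auto simp: space_PiM PiE_iff)

lemma measurable_atomic_measure:
  "(\<lambda>(\<xi>, U). atomic_measure (stick_breaking U) \<xi>) \<in> atoms_space \<Otimes>\<^sub>M sticks_space \<rightarrow>\<^sub>M prob_algebra unit_borel"
proof (rule measurable_prob_algebra_generated)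
  show "sets unit_borel = sigma_sets (space unit_borel) (sets unit_borel)"
    by (rule sets.sigma_sets_eq[symmetric])
  show "Int_stable (sets unit_borel)" by (rule sets.Int_stable)
  show "sets unit_borel \<subseteq> Pow (space unit_borel)" by (rule sets.space_closed)
  fix z assume "z \<in> space (atoms_space \<Otimes>\<^sub>M sticks_space)"
  then have "(case z of (\<xi>, U) \<Rightarrow> atomic_measure (stick_breaking U) \<xi>) \<in> M1"
    by (auto simp: space_pair_measure intro!: atomic_measure_in_M1 dest: atoms_spaceD)
  from M1_D(1,2)[OF this]
  show "prob_space (case z of (\<xi>, U) \<Rightarrow> atomic_measure (stick_breaking U) \<xi>)"
    "sets (case z of (\<xi>, U) \<Rightarrow> atomic_measure (stick_breaking U) \<xi>) = sets unit_borel" by auto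
next
  fix A assume A: "A \<in> sets unit_borel"
  let ?P = "atoms_space \<Otimes>\<^sub>M sticks_space"
  let ?V = "\<lambda>z i. stick_breaking (snd z) i"
  have Vm: "(\<lambda>z. ?V z i) \<in> borel_measurable ?P" for i
    unfolding stick_breaking_def by measurable
  have im: "(\<lambda>z. indicator A (fst z i) :: ennreal) \<in> borel_measurable ?P" for i
    using A by measurable
  \<comment> \<open>For nonnegative weights, \<open>sums 1\<close> is equivalent to an equation
    between \<open>ennreal\<close> series, which is a measurable condition on
    \<open>z\<close>.\<close>
  have "emeasure (case z of (\<xi>, U) \<Rightarrow> atomic_measure (stick_breaking U) \<xi>) A =
    (if (\<forall>i. 0 \<le> ?V z i) \<and> (\<Sum>i. ennreal (?V z i)) = 1
     then (\<Sum>i. ennreal (?V z i) * indicator A (fst z i)) else indicator A (fst z 0))"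
    if z: "z \<in> space ?P" for z
  proof -
    have \<xi>: "fst z i \<in> {0..1}" for i
      using z by (auto simp: space_pair_measure dest: atoms_spaceD)
    have iff: "(\<Sum>i. ennreal (?V z i)) = 1 \<longleftrightarrow> ?V z sums 1" if "\<forall>i. 0 \<le> ?V z i"
    proof -
      have "?V z sums 1 \<longleftrightarrow> (\<lambda>i. ennreal (?V z i)) sums ennreal 1"
        using that by (intro sums_ennreal[symmetric]) auto
      also have "\<dots> \<longleftrightarrow> (\<Sum>i. ennreal (?V z i)) = 1"
        by (auto simp: sums_iff)
      finally show ?thesis by simp
    qed
    show ?thesis
    proof (cases "(\<forall>i. 0 \<le> ?V z i) \<and> ?V z sums 1")
      case True
      then have c: "(\<forall>i. 0 \<le> ?V z i) \<and> (\<Sum>i. ennreal (?V z i)) = 1" using iff by blast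
      have "emeasure (atomic_measure (?V z) (fst z)) A = (\<Sum>i. ennreal (?V z i) * indicator A (fst z i))"
        by (rule emeasure_atomic_measure[OF _ _ \<xi> A]) (use True in blast)+
      then show ?thesis unfolding if_P[OF c] by (simp only: split_beta')
    next
      case False
      then have "atomic_measure (?V z) (fst z) = return unit_borel (fst z 0)"
        by (auto simp: atomic_measure_def)
      moreover have c: "\<not> ((\<forall>i. 0 \<le> ?V z i) \<and> (\<Sum>i. ennreal (?V z i)) = 1)" using False iff by blast
      ultimately show ?thesis unfolding if_not_P[OF c] using A by (simp only: split_beta' emeasure_return)
    qed
  qed
  moreover have "(\<lambda>z. if (\<forall>i. 0 \<le> ?V z i) \<and> (\<Sum>i. ennreal (?V z i)) = 1
     then (\<Sum>i. ennreal (?V z i) * indicator A (fst z i)) else (indicator A (fst z 0) :: ennreal)) \<in> borel_measurable ?P"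
  proof -
    define W where "W i z = stick_breaking (snd z) i" for i and z :: "(nat \<Rightarrow> real) \<times> (nat \<Rightarrow> real)"
    define I where "I i z = (indicator A (fst z i) :: ennreal)" for i :: nat and z :: "(nat \<Rightarrow> real) \<times> (nat \<Rightarrow> real)"
    have W: "W i \<in> borel_measurable ?P" and I: "I i \<in> borel_measurable ?P" for i
      using Vm im by (simp_all add: W_def[abs_def] I_def[abs_def])
    have "{z \<in> space ?P. (\<forall>i. 0 \<le> W i z) \<and> (\<Sum>i. ennreal (W i z)) = 1} \<in> sets ?P"
      using W by measurable
    moreover have "(\<lambda>z. \<Sum>i. ennreal (W i z) * I i z) \<in> borel_measurable ?P" using W I by measurable
    ultimately have "(\<lambda>z. if (\<forall>i. 0 \<le> W i z) \<and> (\<Sum>i. ennreal (W i z)) = 1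
        then (\<Sum>i. ennreal (W i z) * I i z) else I 0 z) \<in> borel_measurable ?P"
      using I by (intro measurable_If) auto
    then show ?thesis by (simp only: W_def I_def)
  qed
  ultimately show "(\<lambda>z. emeasure (case z of (\<xi>, U) \<Rightarrow> atomic_measure (stick_breaking U) \<xi>) A) \<in> borel_measurable ?P"
    by (subst measurable_cong) auto
qed

text \<open>On a cylinder the product measure is a finite product of values of \<nu>, hence
  measurable in \<nu>. Together with \<open>measurable_atomic_measure\<close> this makes the
  Dirichlet process a kernel, as the second level of the hierarchy requires.\<close>

lemma measurable_PiM_kernel:
  "(\<lambda>\<nu>. PiM UNIV (\<lambda>_::nat. \<nu>)) \<in> prob_algebra unit_borel \<rightarrow>\<^sub>M prob_algebra atoms_space"
proof (rule measurable_prob_algebra_generated[OF sets_PiM Int_stable_prod_algebra prod_algebra_sets_into_space])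
  fix \<nu> assume \<nu>: "\<nu> \<in> M1"
  show "prob_space (PiM UNIV (\<lambda>_::nat. \<nu>))"
    using M1_D[OF \<nu>] by (intro prob_space_PiM) auto
  show "sets (PiM UNIV (\<lambda>_::nat. \<nu>)) = sets atoms_space"
    using M1_D[OF \<nu>] by (intro sets_PiM_cong) auto
next
  fix A assume "A \<in> prod_algebra (UNIV :: nat set) (\<lambda>_. unit_borel)"
  then obtain J E where A: "A = prod_emb UNIV (\<lambda>_. unit_borel) J (\<Pi>\<^sub>E j\<in>J. E j)" "finite J"
      "\<And>i. i \<in> J \<Longrightarrow> E i \<in> sets unit_borel"
    by (rule prod_algebraE) auto
  have "emeasure (PiM UNIV (\<lambda>_::nat. \<nu>)) A = (\<Prod>j\<in>J. emeasure \<nu> (E j))" if \<nu>: "\<nu> \<in> M1" for \<nu>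
  proof -
    have "A = prod_emb UNIV (\<lambda>_. \<nu>) J (\<Pi>\<^sub>E j\<in>J. E j)"
      using M1_D(3)[OF \<nu>] by (simp add: A(1) prod_emb_def)
    then show ?thesis
      using A(2,3) M1_D[OF \<nu>] by (simp add: emeasure_PiM_emb)
  qed
  moreover have "(\<lambda>\<nu>. \<Prod>j\<in>J. emeasure \<nu> (E j)) \<in> borel_measurable (prob_algebra unit_borel)"
    using A(3) by (intro borel_measurable_prod_ennreal)
      (auto simp: prob_algebra_def intro!: measurable_restrict_space1 measurable_emeasure_subprob_algebra)
  ultimately show "(\<lambda>\<nu>. emeasure (PiM UNIV (\<lambda>_::nat. \<nu>)) A) \<in> borel_measurable (prob_algebra unit_borel)"
    by (subst measurable_cong) auto
qed

abbreviation stick_law :: "real \<Rightarrow> (nat \<Rightarrow> real) measure" where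
  "stick_law \<alpha> \<equiv> PiM UNIV (\<lambda>_::nat. beta_distribution 1 \<alpha>)"

lemma sets_stick_law [measurable_cong]: "sets (stick_law \<alpha>) = sets sticks_space"
  by (intro sets_PiM_cong) auto

lemma prob_space_stick_law: "0 < \<alpha> \<Longrightarrow> prob_space (stick_law \<alpha>)"
  by (intro prob_space_PiM prob_space_beta_1)

abbreviation weak_borel :: "real measure measure" where
  "weak_borel \<equiv> borel_of weak_topology"

lemma measurable_atomic_measure_weak:
  "(\<lambda>(\<xi>, U). atomic_measure (stick_breaking U) \<xi>) \<in> atoms_space \<Otimes>\<^sub>M sticks_space \<rightarrow>\<^sub>M weak_borel"
  using measurable_atomic_measure by (simp only: measurable_cong_sets[OF refl sets_borel_of_weak])

lemma measurable_dirichlet_process: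
  assumes "0 < \<beta>"
  shows "dirichlet_process \<beta> \<in> weak_borel \<rightarrow>\<^sub>M prob_algebra weak_borel"
proof -
  let ?T = "\<lambda>(\<xi>, U). atomic_measure (stick_breaking U) \<xi>"
  have "(\<lambda>_. stick_law \<beta>) \<in> prob_algebra unit_borel \<rightarrow>\<^sub>M prob_algebra sticks_space"
    using prob_space_stick_law[OF assms] sets_stick_law by (intro measurable_const) (auto simp: space_prob_algebra)
  note g = measurable_pair_prob[OF measurable_PiM_kernel this]
  have "(\<lambda>p. ?T (snd p)) \<in> prob_algebra unit_borel \<Otimes>\<^sub>M (atoms_space \<Otimes>\<^sub>M sticks_space) \<rightarrow>\<^sub>M weak_borel"
    by (rule measurable_compose[OF measurable_snd measurable_atomic_measure_weak])
  then have "(\<lambda>(\<nu>, z). ?T z) \<in> prob_algebra unit_borel \<Otimes>\<^sub>M (atoms_space \<Otimes>\<^sub>M sticks_space) \<rightarrow>\<^sub>M weak_borel"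
    by (simp only: split_beta')
  from measurable_distr_prob_space2[where f="\<lambda>_. ?T", OF g this]
  have "(\<lambda>\<nu>. distr (PiM UNIV (\<lambda>_::nat. \<nu>) \<Otimes>\<^sub>M stick_law \<beta>) weak_borel ?T)
      \<in> prob_algebra unit_borel \<rightarrow>\<^sub>M prob_algebra weak_borel" .
  then show ?thesis
    unfolding dirichlet_process_def[abs_def] by (simp only: measurable_cong_sets[OF sets_borel_of_weak refl])
qed

lemma dirichlet_process_measurable_pair:
  assumes \<nu>: "\<nu> \<in> M1"
  shows "(\<lambda>(\<xi>, U). atomic_measure (stick_breaking U) \<xi>) \<in> PiM UNIV (\<lambda>_::nat. \<nu>) \<Otimes>\<^sub>M stick_law \<alpha> \<rightarrow>\<^sub>M weak_borel"
proof -
  have "sets (PiM UNIV (\<lambda>_::nat. \<nu>)) = sets atoms_space"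
    using M1_D[OF \<nu>] by (intro sets_PiM_cong) auto
  then have eq: "sets (PiM UNIV (\<lambda>_::nat. \<nu>) \<Otimes>\<^sub>M stick_law \<alpha>) = sets (atoms_space \<Otimes>\<^sub>M sticks_space)"
    by (intro sets_pair_measure_cong sets_stick_law)
  show ?thesis unfolding measurable_cong_sets[OF eq refl] by (rule measurable_atomic_measure_weak)
qed

section \<open>The Markov-Krein identity\<close>

text \<open>Dominated convergence of the difference quotients: the arguments of \<open>h\<close>
  stay in a compact interval away from 0, on which \<open>h\<close> is Lipschitz.\<close>

lemma has_derivative_under_integral:
  fixes h h' :: "real \<Rightarrow> real"
  assumes M: "prob_space M" and X: "X \<in> borel_measurable M"
    and bd: "\<And>x. x \<in> space M \<Longrightarrow> m \<le> X x" "\<And>x. x \<in> space M \<Longrightarrow> X x \<le> K" and m: "0 < m"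
    and h: "h \<in> borel_measurable borel" and h': "h' \<in> borel_measurable borel"
    and der: "\<And>s. 0 < s \<Longrightarrow> (h has_real_derivative h' s) (at s)"
    and cont: "continuous_on {0<..} h'" and t: "0 \<le> t"
  shows "((\<lambda>t. \<integral>x. h (t + X x) \<partial>M) has_real_derivative (\<integral>x. h' (t + X x) \<partial>M)) (at t)"
proof -
  interpret prob_space M by fact
  \<comment> \<open>Reaches below \<open>t\<close> by half of the lower bound of \<open>X\<close>,
    so that \<open>t\<close> is interior even for \<open>t = 0\<close>, while \<open>y + X x\<close>
    stays at least \<open>m / 2\<close>.\<close>
  define S where "S = {t - m / 2 .. t + 1}"
  define I where "I = {m / 2 .. t + 1 + K}"
  have I: "y + X x \<in> I" if "y \<in> S" "x \<in> space M" for x y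
    using bd[OF that(2)] that(1) m t by (auto simp: S_def I_def)
  have Ipos: "I \<subseteq> {0<..}" using m by (auto simp: I_def)
  have tS: "t \<in> S" using m by (simp add: S_def)
  have "continuous_on {0<..} h"
    by (rule DERIV_continuous_on[where D=h'], rule has_field_derivative_at_within[OF der]) simp
  then have "compact (h ` I)" using Ipos by (intro compact_continuous_image continuous_on_subset[of _ h I]) (auto simp: I_def)
  from compact_imp_bounded[OF this, unfolded bounded_iff]
  obtain B where "\<forall>y\<in>h ` I. norm y \<le> B" ..
  then have B: "\<And>y. y \<in> I \<Longrightarrow> \<bar>h y\<bar> \<le> B" by simp
  have "compact (h' ` I)" using Ipos cont by (intro compact_continuous_image continuous_on_subset[of _ h' I]) (auto simp: I_def)
  from compact_imp_bounded[OF this, unfolded bounded_iff]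
  obtain C where "\<forall>y\<in>h' ` I. norm y \<le> C" ..
  then have C: "\<And>y. y \<in> I \<Longrightarrow> \<bar>h' y\<bar> \<le> C" by simp
  have lip: "\<bar>h p - h q\<bar> \<le> C * \<bar>p - q\<bar>" if "p \<in> I" "q \<in> I" for p q
  proof -
    have "norm (h p - h q) \<le> C * norm (p - q)"
    proof (rule field_differentiable_bound[of I h h'])
      show "(h has_field_derivative h' z) (at z within I)" if "z \<in> I" for z
      proof -
        have "0 < z" using Ipos \<open>z \<in> I\<close> by blast
        from has_field_derivative_at_within[OF der[OF this]] show ?thesis .
      qed
      show "convex I" by (simp add: I_def)
      show "norm (h' z) \<le> C" if "z \<in> I" for z using C[OF that] by simp
    qed fact+
    then show ?thesis by simp
  qed
  have ih: "integrable M (\<lambda>x. h (y + X x))" if "y \<in> S" for y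
    using B I[OF that] X h by (intro integrable_const_bound[of _ B]) auto
  have "((\<lambda>y. ((\<integral>x. h (y + X x) \<partial>M) - (\<integral>x. h (t + X x) \<partial>M)) / (y - t)) \<longlongrightarrow> (\<integral>x. h' (t + X x) \<partial>M)) (at t within S)"
    unfolding tendsto_at_iff_sequentially comp_def
  proof (intro allI impI)
    fix y assume y: "\<forall>n. y n \<in> S - {t}" and lim: "y \<longlonglongrightarrow> t"
    have "(\<lambda>n. \<integral>x. (h (y n + X x) - h (t + X x)) / (y n - t) \<partial>M) \<longlonglongrightarrow> (\<integral>x. h' (t + X x) \<partial>M)"
    proof (rule integral_dominated_convergence[where w="\<lambda>_. C"])
      show "(\<lambda>x. h' (t + X x)) \<in> borel_measurable M" using X h' by measurable
      show "(\<lambda>x. (h (y n + X x) - h (t + X x)) / (y n - t)) \<in> borel_measurable M" for n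
        using X h by measurable
      show "AE x in M. (\<lambda>n. (h (y n + X x) - h (t + X x)) / (y n - t)) \<longlonglongrightarrow> h' (t + X x)"
      proof (rule AE_I2)
        fix x assume "x \<in> space M"
        then have "0 < t + X x" using bd(1)[of x] m t by linarith
        from der[OF this] have "((\<lambda>z. (h (t + X x + z) - h (t + X x)) / z) \<longlongrightarrow> h' (t + X x)) (at 0)"
          by (simp add: DERIV_def)
        moreover have "filterlim (\<lambda>n. y n - t) (at 0) sequentially"
          using y lim LIM_zero[of y t sequentially] by (auto simp: filterlim_at intro: always_eventually)
        ultimately have "(\<lambda>n. (h (t + X x + (y n - t)) - h (t + X x)) / (y n - t)) \<longlonglongrightarrow> h' (t + X x)"
          by (rule filterlim_compose)
        then show "(\<lambda>n. (h (y n + X x) - h (t + X x)) / (y n - t)) \<longlonglongrightarrow> h' (t + X x)"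
          by (simp add: add.commute algebra_simps)
      qed
      show "AE x in M. norm ((h (y n + X x) - h (t + X x)) / (y n - t)) \<le> C" for n
      proof (rule AE_I2)
        fix x assume x: "x \<in> space M"
        have "\<bar>h (y n + X x) - h (t + X x)\<bar> \<le> C * \<bar>(y n + X x) - (t + X x)\<bar>"
          using y by (intro lip I x tS) auto
        then show "norm ((h (y n + X x) - h (t + X x)) / (y n - t)) \<le> C"
          using y by (simp add: abs_divide divide_le_eq)
      qed
    qed simp
    moreover have "(\<integral>x. (h (y n + X x) - h (t + X x)) / (y n - t) \<partial>M)
        = ((\<integral>x. h (y n + X x) \<partial>M) - (\<integral>x. h (t + X x) \<partial>M)) / (y n - t)" for n
      using Bochner_Integration.integral_diff[OF ih[of "y n"] ih[OF tS]] y by simp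
    ultimately show "(\<lambda>n. ((\<integral>x. h (y n + X x) \<partial>M) - (\<integral>x. h (t + X x) \<partial>M)) / (y n - t)) \<longlonglongrightarrow> (\<integral>x. h' (t + X x) \<partial>M)"
      by (simp only:)
  qed
  then have "((\<lambda>t. \<integral>x. h (t + X x) \<partial>M) has_real_derivative (\<integral>x. h' (t + X x) \<partial>M)) (at t within S)"
    by (simp add: has_field_derivative_iff)
  moreover have "t \<in> interior S" using m by (simp add: S_def)
  ultimately show ?thesis by (simp only: at_within_interior)
qed

text \<open>The distributional fixed point equation \<open>\<Xi> = U \<delta>\<^bsub>\<xi>\<^esub> + (1 - U) \<Xi>'\<close>.\<close>

lemma dirichlet_process_fixpoint:
  fixes g :: "real \<Rightarrow> real" and F :: "real \<Rightarrow> ennreal"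
  assumes \<nu>: "\<nu> \<in> M1" and \<alpha>: "0 < \<alpha>" and g: "continuous_on {0..1} g" and F: "F \<in> borel_measurable borel"
  shows "(\<integral>\<^sup>+\<mu>. F (integral\<^sup>L \<mu> g) \<partial>dirichlet_process \<alpha> \<nu>) =
    (\<integral>\<^sup>+x. \<integral>\<^sup>+\<mu>. \<integral>\<^sup>+u. F (u * g x + (1 - u) * integral\<^sup>L \<mu> g) \<partial>beta_distribution 1 \<alpha> \<partial>dirichlet_process \<alpha> \<nu> \<partial>\<nu>)"
proof -
  let ?A = "PiM UNIV (\<lambda>_::nat. \<nu>)" and ?S = "stick_law \<alpha>" and ?B = "beta_distribution 1 \<alpha>"
  interpret nu: prob_space \<nu> using M1_D[OF \<nu>] by simp
  interpret B: prob_space ?B by (rule prob_space_beta_1[OF \<alpha>])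
  interpret A: prob_space ?A by (intro prob_space_PiM nu.prob_space_axioms)
  interpret S: prob_space ?S by (rule prob_space_stick_law[OF \<alpha>])
  interpret BS: pair_sigma_finite ?B ?S ..
  define R where "R \<xi> U = integral\<^sup>L (atomic_measure (stick_breaking U) \<xi>) g" for \<xi> U
  have Ym: "(\<lambda>\<mu>. integral\<^sup>L \<mu> g) \<in> borel_measurable weak_borel"
    by (intro continuous_map_measurable continuous_map_integral g)
  note T = dirichlet_process_measurable_pair[OF \<nu>, of \<alpha>]
  have Rm: "(\<lambda>z. R (fst z) (snd z)) \<in> borel_measurable (?A \<Otimes>\<^sub>M ?S)"
    using measurable_compose[OF T Ym] by (simp add: R_def split_beta')
  have DP: "(\<integral>\<^sup>+\<mu>. G (integral\<^sup>L \<mu> g) \<partial>dirichlet_process \<alpha> \<nu>) = (\<integral>\<^sup>+\<xi>. \<integral>\<^sup>+U. G (R \<xi> U) \<partial>?S \<partial>?A)"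
    if G: "G \<in> borel_measurable borel" for G :: "real \<Rightarrow> ennreal"
  proof -
    have "(\<integral>\<^sup>+\<mu>. G (integral\<^sup>L \<mu> g) \<partial>dirichlet_process \<alpha> \<nu>) = (\<integral>\<^sup>+z. G (R (fst z) (snd z)) \<partial>(?A \<Otimes>\<^sub>M ?S))"
      unfolding dirichlet_process_def using measurable_compose[OF Ym G] T
      by (subst nn_integral_distr) (auto simp: R_def split_beta')
    also have "\<dots> = (\<integral>\<^sup>+\<xi>. \<integral>\<^sup>+U. G (R \<xi> U) \<partial>?S \<partial>?A)"
      using measurable_compose[OF Rm G] by (subst S.nn_integral_fst[symmetric]) auto
    finally show ?thesis .
  qed
  have FR: "(\<lambda>z. F (R (fst z) (snd z))) \<in> borel_measurable (?A \<Otimes>\<^sub>M ?S)"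
    by (rule measurable_compose[OF Rm F])
  have atoms: "\<xi> i \<in> {0..1}" if "\<xi> \<in> space ?A" for \<xi> i
    using that M1_D(3)[OF \<nu>] by (auto simp: space_PiM PiE_iff)
  have sec: "(\<lambda>U. R \<xi> U) \<in> borel_measurable ?S" if "\<xi> \<in> space ?A" for \<xi>
    using measurable_compose[OF measurable_Pair1'[OF that] Rm] by simp
  \<comment> \<open>Splits off the first term of the series; the remaining weights are those of
    \<open>U\<close>, scaled by \<open>1 - u\<close>.\<close>
  have R_rec: "R (case_nat x \<xi>) (case_nat u U) = u * g x + (1 - u) * R \<xi> U"
    if x: "x \<in> {0..1}" and \<xi>: "\<xi> \<in> space ?A" and U: "good_sticks U" and u: "0 < u" "u < 1" for x \<xi> u U
  proof -
    have c: "case_nat x \<xi> i \<in> {0..1}" for i using x atoms[OF \<xi>] by (simp split: nat.split)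
    note gU = good_sticks_case_nat[OF U u]
    have "(\<lambda>i. stick_breaking (case_nat u U) i * g (case_nat x \<xi> i)) sums R (case_nat x \<xi>) (case_nat u U)"
      unfolding R_def by (intro integral_atomic_measure good_sticks_nonneg good_sticks_sums gU c g)
    moreover have "(\<lambda>i. stick_breaking U i * g (\<xi> i)) sums R \<xi> U"
      unfolding R_def by (intro integral_atomic_measure good_sticks_nonneg good_sticks_sums U atoms[OF \<xi>] g)
    then have "(\<lambda>i. (1 - u) * (stick_breaking U i * g (\<xi> i))) sums ((1 - u) * R \<xi> U)"
      by (rule sums_mult)
    then have "(\<lambda>i. stick_breaking (case_nat u U) (Suc i) * g (case_nat x \<xi> (Suc i))) sums ((1 - u) * R \<xi> U)"
      by (simp add: stick_breaking_case_nat mult.assoc)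
    then have "(\<lambda>i. stick_breaking (case_nat u U) i * g (case_nat x \<xi> i)) sums ((1 - u) * R \<xi> U + u * g x)"
      by (subst (asm) sums_Suc_iff) (simp add: stick_breaking_case_nat)
    ultimately show ?thesis using sums_unique2 by fastforce
  qed
  have "(\<integral>\<^sup>+\<mu>. F (integral\<^sup>L \<mu> g) \<partial>dirichlet_process \<alpha> \<nu>) = (\<integral>\<^sup>+\<xi>. \<integral>\<^sup>+U. F (R \<xi> U) \<partial>?S \<partial>?A)"
    by (rule DP[OF F])
  \<comment> \<open>The first atom is separated here and the first proportion in the next step. The
    order of integration is then changed to put \<open>u\<close> innermost, where the Beta integral
    acts.\<close>
  also have "\<dots> = (\<integral>\<^sup>+x. \<integral>\<^sup>+\<xi>. \<integral>\<^sup>+U. F (R (case_nat x \<xi>) U) \<partial>?S \<partial>?A \<partial>\<nu>)"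
    using FR by (intro nn_integral_PiM_case_nat nu.prob_space_axioms S.borel_measurable_nn_integral) (simp add: split_beta')
  also have "\<dots> = (\<integral>\<^sup>+x. \<integral>\<^sup>+\<xi>. \<integral>\<^sup>+U. \<integral>\<^sup>+u. F (u * g x + (1 - u) * R \<xi> U) \<partial>?B \<partial>?S \<partial>?A \<partial>\<nu>)"
  proof (rule nn_integral_cong, rule nn_integral_cong)
    fix x \<xi> assume x: "x \<in> space \<nu>" and \<xi>: "\<xi> \<in> space ?A"
    have x01: "x \<in> {0..1}" using x M1_D(3)[OF \<nu>] by simp
    have c: "case_nat x \<xi> \<in> space ?A" using x \<xi> by (auto simp: space_PiM PiE_iff split: nat.split)
    have "(\<integral>\<^sup>+U. F (R (case_nat x \<xi>) U) \<partial>?S) = (\<integral>\<^sup>+u. \<integral>\<^sup>+U. F (R (case_nat x \<xi>) (case_nat u U)) \<partial>?S \<partial>?B)"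
      by (intro nn_integral_PiM_case_nat B.prob_space_axioms measurable_compose[OF sec[OF c] F])
    also have "\<dots> = (\<integral>\<^sup>+u. \<integral>\<^sup>+U. F (u * g x + (1 - u) * R \<xi> U) \<partial>?S \<partial>?B)"
    proof (rule nn_integral_cong_AE)
      show "AE u in ?B. (\<integral>\<^sup>+U. F (R (case_nat x \<xi>) (case_nat u U)) \<partial>?S) = (\<integral>\<^sup>+U. F (u * g x + (1 - u) * R \<xi> U) \<partial>?S)"
        using AE_beta_1[OF \<alpha>]
      proof eventually_elim
        case (elim u)
        show ?case
        proof (rule nn_integral_cong_AE)
          show "AE U in ?S. F (R (case_nat x \<xi>) (case_nat u U)) = F (u * g x + (1 - u) * R \<xi> U)"
            using AE_good_sticks[OF \<alpha>] by eventually_elim (simp add: R_rec[OF x01 \<xi>] elim)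
        qed
      qed
    qed
    also have "\<dots> = (\<integral>\<^sup>+U. \<integral>\<^sup>+u. F (u * g x + (1 - u) * R \<xi> U) \<partial>?B \<partial>?S)"
    proof (rule BS.Fubini'[symmetric])
      have "(\<lambda>z. fst z * g x + (1 - fst z) * R \<xi> (snd z)) \<in> borel_measurable (?B \<Otimes>\<^sub>M ?S)"
        using measurable_compose[OF measurable_snd sec[OF \<xi>]] by measurable
      from measurable_compose[OF this F]
      show "(\<lambda>(u, U). F (u * g x + (1 - u) * R \<xi> U)) \<in> borel_measurable (?B \<Otimes>\<^sub>M ?S)"
        by (simp add: split_beta')
    qed
    finally show "(\<integral>\<^sup>+U. F (R (case_nat x \<xi>) U) \<partial>?S) = (\<integral>\<^sup>+U. \<integral>\<^sup>+u. F (u * g x + (1 - u) * R \<xi> U) \<partial>?B \<partial>?S)" .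
  qed
  also have "\<dots> = (\<integral>\<^sup>+x. \<integral>\<^sup>+\<mu>. \<integral>\<^sup>+u. F (u * g x + (1 - u) * integral\<^sup>L \<mu> g) \<partial>?B \<partial>dirichlet_process \<alpha> \<nu> \<partial>\<nu>)"
  proof (rule nn_integral_cong, rule DP[symmetric, where G="\<lambda>r. \<integral>\<^sup>+u. F (u * g _ + (1 - u) * r) \<partial>?B"])
    fix x
    have "(\<lambda>z. snd z * g x + (1 - snd z) * fst z) \<in> borel_measurable (borel \<Otimes>\<^sub>M ?B)" by measurable
    from measurable_compose[OF this F]
    show "(\<lambda>r. \<integral>\<^sup>+u. F (u * g x + (1 - u) * r) \<partial>?B) \<in> borel_measurable borel"
      by (intro B.borel_measurable_nn_integral) (simp add: split_beta')
  qed
  finally show ?thesis .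
qed

lemma prob_space_dirichlet_process:
  assumes "0 < \<alpha>" "\<nu> \<in> M1"
  shows "prob_space (dirichlet_process \<alpha> \<nu>)" "sets (dirichlet_process \<alpha> \<nu>) = sets weak_borel"
  using measurable_space[OF measurable_dirichlet_process[OF assms(1)], of \<nu>] assms(2)
  by (auto simp: space_prob_algebra)

text \<open>The shift by \<open>t\<close> supplies the variable of the differential equation. It is
  compatible with the fixed point equation because the coefficients \<open>u\<close> and
  \<open>1 - u\<close> add up to 1.\<close>

lemma dirichlet_process_powr:
  fixes g :: "real \<Rightarrow> real"
  assumes \<nu>: "\<nu> \<in> M1" and \<alpha>: "0 < \<alpha>" and g: "continuous_on {0..1} g" and gpos: "\<And>x. x \<in> {0..1} \<Longrightarrow> 0 < g x"
  shows "(\<integral>\<mu>. (integral\<^sup>L \<mu> g) powr (- \<alpha>) \<partial>dirichlet_process \<alpha> \<nu>) = exp (- \<alpha> * (\<integral>x. ln (g x) \<partial>\<nu>))"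
    and "integrable (dirichlet_process \<alpha> \<nu>) (\<lambda>\<mu>. (integral\<^sup>L \<mu> g) powr (- \<alpha>))"
proof -
  let ?D = "dirichlet_process \<alpha> \<nu>"
  define Y where "Y \<mu> = integral\<^sup>L \<mu> g" for \<mu>
  interpret nu: prob_space \<nu> using M1_D[OF \<nu>] by simp
  interpret D: prob_space ?D by (rule prob_space_dirichlet_process[OF \<alpha> \<nu>])
  note sD = prob_space_dirichlet_process(2)[OF \<alpha> \<nu>]
  have spD: "space ?D = M1" using sets_eq_imp_space_eq[OF sD] by simp
  have "Y \<in> borel_measurable weak_borel"
    unfolding Y_def[abs_def] by (intro continuous_map_measurable continuous_map_integral g)
  then have Ym: "Y \<in> borel_measurable ?D" unfolding measurable_cong_sets[OF sD refl] .
  have gm: "g \<in> borel_measurable \<nu>" by (intro M1_measurable[OF \<nu>] continuous_unit_measurable g)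
  obtain z where z: "z \<in> {0..1}" "\<And>x. x \<in> {0..1} \<Longrightarrow> g z \<le> g x"
    using continuous_attains_inf[of "{0..1}" g] g by auto
  obtain w where w: "w \<in> {0..1}" "\<And>x. x \<in> {0..1} \<Longrightarrow> g x \<le> g w"
    using continuous_attains_sup[of "{0..1}" g] g by auto
  define m where "m = g z"
  define K where "K = g w"
  have m: "0 < m" unfolding m_def using gpos z by blast
  have gb: "m \<le> g x" "g x \<le> K" if "x \<in> space \<nu>" for x
    using that M1_D(3)[OF \<nu>] z w by (auto simp: m_def K_def)
  have Yb: "m \<le> Y \<mu>" "Y \<mu> \<le> K" if "\<mu> \<in> space ?D" for \<mu>
  proof -
    have \<mu>: "\<mu> \<in> M1" using that spD by simp
    interpret mu: prob_space \<mu> using M1_D[OF \<mu>] by simp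
    note i = M1_integrable_continuous[OF \<mu> g]
    show "m \<le> Y \<mu>" unfolding Y_def m_def
      by (rule mu.integral_ge_const[OF i]) (use z(2) M1_D(3)[OF \<mu>] in \<open>auto intro!: AE_I2\<close>)
    show "Y \<mu> \<le> K" unfolding Y_def K_def
      by (rule mu.integral_le_const[OF i]) (use w(2) M1_D(3)[OF \<mu>] in \<open>auto intro!: AE_I2\<close>)
  qed
  have mK: "m \<le> K" unfolding m_def using w(2)[OF z(1)] by (simp add: K_def)
  define \<Phi> where "\<Phi> t = (\<integral>\<mu>. (t + Y \<mu>) powr (- \<alpha>) \<partial>?D)" for t
  define \<Lambda> where "\<Lambda> t = (\<integral>x. ln (t + g x) \<partial>\<nu>)" for t
  define A where "A t = (\<integral>x. 1 / (t + g x) \<partial>\<nu>)" for t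
  have powr_bd: "(t + K) powr (- p) \<le> (t + y) powr (- p)" "(t + y) powr (- p) \<le> (t + m) powr (- p)"
    if "m \<le> y" "y \<le> K" "0 \<le> t" "0 < p" for t y p
    using that m mK by (auto intro!: powr_mono2')
  have iY: "integrable ?D (\<lambda>\<mu>. (t + Y \<mu>) powr (- p))" if "0 \<le> t" "0 < p" for t p
  proof (rule D.integrable_const_bound)
    show "AE \<mu> in ?D. norm ((t + Y \<mu>) powr (- p)) \<le> (t + m) powr (- p)"
      using powr_bd(2)[OF Yb that] by (intro AE_I2) simp
    show "(\<lambda>\<mu>. (t + Y \<mu>) powr (- p)) \<in> borel_measurable ?D" using Ym by measurable
  qed
  have ig: "integrable \<nu> (\<lambda>x. 1 / (t + g x))" if "0 \<le> t" for t
  proof (rule nu.integrable_const_bound)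
    show "AE x in \<nu>. norm (1 / (t + g x)) \<le> 1 / (t + m)"
    proof (rule AE_I2)
      fix x assume "x \<in> space \<nu>"
      then have "0 < t + m" "t + m \<le> t + g x" using gb(1) m that by auto
      then show "norm (1 / (t + g x)) \<le> 1 / (t + m)" by (simp add: frac_le)
    qed
    show "(\<lambda>x. 1 / (t + g x)) \<in> borel_measurable \<nu>" using gm by measurable
  qed
  have lnb: "ln (t + m) \<le> ln (t + g x)" "ln (t + g x) \<le> ln (t + K)"
    if "0 \<le> t" "x \<in> space \<nu>" for t x
    using gb[OF that(2)] m \<open>0 \<le> t\<close> by (auto intro!: ln_mono)
  have il: "integrable \<nu> (\<lambda>x. ln (t + g x))" if "0 \<le> t" for t
  proof -
    have "\<bar>ln (t + g x)\<bar> \<le> \<bar>ln (t + m)\<bar> + \<bar>ln (t + K)\<bar>" if "x \<in> space \<nu>" for x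
      using lnb[OF \<open>0 \<le> t\<close> that] by linarith
    then show ?thesis using gm by (intro nu.integrable_const_bound[of _ "\<bar>ln (t + m)\<bar> + \<bar>ln (t + K)\<bar>"]) auto
  qed
  have \<Phi>b: "(t + K) powr (- \<alpha>) \<le> \<Phi> t" "\<Phi> t \<le> (t + m) powr (- \<alpha>)" if "0 \<le> t" for t
    unfolding \<Phi>_def using powr_bd[OF Yb that \<alpha>] that \<alpha>
    by (auto intro!: D.integral_ge_const D.integral_le_const iY)
  have \<Phi>pos: "0 < \<Phi> t" if "0 \<le> t" for t
    using \<Phi>b(1)[OF that] m mK that by (smt (verit) powr_gt_zero)
  \<comment> \<open>The fixed point equation at the exponent \<open>- \<alpha> - 1\<close>: once
    \<open>u\<close> is integrated out, the integrand is a function of \<open>x\<close> times a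
    function of \<open>\<mu>\<close>, and the double integral factorises.\<close>
  have fixpt: "(\<integral>\<mu>. (t + Y \<mu>) powr (- \<alpha> - 1) \<partial>?D) = A t * \<Phi> t" if t: "0 \<le> t" for t
  proof -
    have i: "integrable ?D (\<lambda>\<mu>. (t + Y \<mu>) powr (- \<alpha> - 1))"
      using iY[of t "\<alpha> + 1"] t \<alpha> by simp
    have A0: "0 \<le> A t" unfolding A_def using gb(1) m t by (intro integral_nonneg_AE AE_I2) (auto simp: add_nonneg_nonneg order.trans[of 0 m])
    have "ennreal (\<integral>\<mu>. (t + Y \<mu>) powr (- \<alpha> - 1) \<partial>?D) = (\<integral>\<^sup>+\<mu>. ennreal ((t + Y \<mu>) powr (- \<alpha> - 1)) \<partial>?D)"
      using i by (intro nn_integral_eq_integral[symmetric]) auto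
    also have "\<dots> = (\<integral>\<^sup>+x. \<integral>\<^sup>+\<mu>. \<integral>\<^sup>+u. ennreal ((t + (u * g x + (1 - u) * Y \<mu>)) powr (- \<alpha> - 1)) \<partial>beta_distribution 1 \<alpha> \<partial>?D \<partial>\<nu>)"
      unfolding Y_def by (intro dirichlet_process_fixpoint[OF \<nu> \<alpha> g, of "\<lambda>r. ennreal ((t + r) powr (- \<alpha> - 1))"]) measurable
    also have "\<dots> = (\<integral>\<^sup>+x. \<integral>\<^sup>+\<mu>. ennreal (1 / (t + g x)) * ennreal ((t + Y \<mu>) powr (- \<alpha>)) \<partial>?D \<partial>\<nu>)"
    proof (intro nn_integral_cong)
      fix x \<mu> assume x: "x \<in> space \<nu>" and \<mu>: "\<mu> \<in> space ?D"
      have p: "0 < t + g x" "0 < t + Y \<mu>" using gb[OF x] Yb[OF \<mu>] m t by auto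
      have "(\<integral>\<^sup>+u. ennreal ((t + (u * g x + (1 - u) * Y \<mu>)) powr (- \<alpha> - 1)) \<partial>beta_distribution 1 \<alpha>)
          = (\<integral>\<^sup>+u. ennreal ((u * (t + g x) + (1 - u) * (t + Y \<mu>)) powr (- \<alpha> - 1)) \<partial>beta_distribution 1 \<alpha>)"
        by (intro nn_integral_cong arg_cong[where f="\<lambda>r. ennreal (r powr (- \<alpha> - 1))"]) (simp add: algebra_simps)
      also have "\<dots> = ennreal (1 / (t + g x) * (t + Y \<mu>) powr (- \<alpha>))"
        by (rule nn_integral_beta_kernel[OF \<alpha> p])
      also have "\<dots> = ennreal (1 / (t + g x)) * ennreal ((t + Y \<mu>) powr (- \<alpha>))"
        using p by (intro ennreal_mult) auto
      finally show "(\<integral>\<^sup>+u. ennreal ((t + (u * g x + (1 - u) * Y \<mu>)) powr (- \<alpha> - 1)) \<partial>beta_distribution 1 \<alpha>)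
          = ennreal (1 / (t + g x)) * ennreal ((t + Y \<mu>) powr (- \<alpha>))" .
    qed
    also have "\<dots> = (\<integral>\<^sup>+x. ennreal (1 / (t + g x)) * ennreal (\<Phi> t) \<partial>\<nu>)"
    proof (intro nn_integral_cong)
      fix x
      have "(\<integral>\<^sup>+\<mu>. ennreal ((t + Y \<mu>) powr (- \<alpha>)) \<partial>?D) = ennreal (\<Phi> t)"
        unfolding \<Phi>_def by (intro nn_integral_eq_integral iY t \<alpha>) auto
      moreover have "(\<lambda>\<mu>. ennreal ((t + Y \<mu>) powr (- \<alpha>))) \<in> borel_measurable ?D" using Ym by measurable
      ultimately show "(\<integral>\<^sup>+\<mu>. ennreal (1 / (t + g x)) * ennreal ((t + Y \<mu>) powr (- \<alpha>)) \<partial>?D) = ennreal (1 / (t + g x)) * ennreal (\<Phi> t)"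
        by (simp only: nn_integral_cmult)
    qed
    also have "\<dots> = (\<integral>\<^sup>+x. ennreal (1 / (t + g x)) \<partial>\<nu>) * ennreal (\<Phi> t)"
      using gm by (intro nn_integral_multc) measurable
    also have "(\<integral>\<^sup>+x. ennreal (1 / (t + g x)) \<partial>\<nu>) = ennreal (A t)"
    proof -
      have "AE x in \<nu>. 0 \<le> 1 / (t + g x)"
        using gb(1) m t by (intro AE_I2) (smt (verit) zero_le_divide_1_iff)
      then show ?thesis unfolding A_def by (intro nn_integral_eq_integral ig t)
    qed
    also have "ennreal (A t) * ennreal (\<Phi> t) = ennreal (A t * \<Phi> t)"
      using A0 \<Phi>pos[OF t] by (intro ennreal_mult[symmetric]) auto
    finally show ?thesis
      using A0 \<Phi>pos[OF t] by (subst (asm) ennreal_inj) (auto intro!: integral_nonneg_AE)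
  qed
  have d\<Phi>: "(\<Phi> has_real_derivative (- \<alpha> * (A t * \<Phi> t))) (at t)" if t: "0 \<le> t" for t
  proof -
    have "((\<lambda>t. \<integral>\<mu>. (t + Y \<mu>) powr (- \<alpha>) \<partial>?D) has_real_derivative (\<integral>\<mu>. - \<alpha> * (t + Y \<mu>) powr (- \<alpha> - 1) \<partial>?D)) (at t)"
    proof (rule has_derivative_under_integral[OF D.prob_space_axioms Ym Yb m _ _ _ _ t])
      show "((\<lambda>y. y powr (- \<alpha>)) has_real_derivative - \<alpha> * s powr (- \<alpha> - 1)) (at s)" if "0 < s" for s
        using has_real_derivative_powr[OF that, of "- \<alpha>"] .
      show "continuous_on {0<..} (\<lambda>y. - \<alpha> * y powr (- \<alpha> - 1))"
        by (intro continuous_intros) auto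
    qed measurable
    then show ?thesis unfolding \<Phi>_def[abs_def, symmetric] by (simp add: fixpt[OF t] \<Phi>_def[symmetric])
  qed
  have d\<Lambda>: "(\<Lambda> has_real_derivative A t) (at t)" if t: "0 \<le> t" for t
    unfolding \<Lambda>_def[abs_def] A_def
  proof (rule has_derivative_under_integral[OF nu.prob_space_axioms gm gb m _ _ _ _ t])
    show "(ln has_real_derivative 1 / s) (at s)" if "0 < s" for s :: real
      using DERIV_ln_divide[OF that] .
    show "continuous_on {0<..} (\<lambda>s::real. 1 / s)" by (intro continuous_intros) auto
  qed measurable
  \<comment> \<open>The logarithm of the quotient of \<Phi> by its claimed value; the differential
    equation says that it is constant.\<close>
  define \<Psi> where "\<Psi> t = ln (\<Phi> t) + \<alpha> * \<Lambda> t" for t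
  have d\<Psi>: "(\<Psi> has_real_derivative 0) (at t)" if t: "0 \<le> t" for t
  proof -
    have "(\<Psi> has_real_derivative (1 / \<Phi> t) * (- \<alpha> * (A t * \<Phi> t)) + \<alpha> * A t) (at t)"
      unfolding \<Psi>_def[abs_def]
      by (intro DERIV_add DERIV_cmult d\<Lambda> t DERIV_chain2[OF DERIV_ln_divide[OF \<Phi>pos[OF t]] d\<Phi>[OF t]])
    then show ?thesis using \<Phi>pos[OF t] by simp
  qed
  have const: "\<Psi> t = \<Psi> 0" if "0 < t" for t
  proof (rule DERIV_isconst_end[OF that])
    show "continuous_on {0..t} \<Psi>"
      by (rule DERIV_continuous_on, rule has_field_derivative_at_within[OF d\<Psi>]) simp
  qed (use d\<Psi> in auto)
  \<comment> \<open>Both parts of \<Psi> are enclosed by multiples of \<open>ln (t + m)\<close> and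
    \<open>ln (t + K)\<close>, whose difference tends to 0. This identifies the constant as
    0.\<close>
  have bound: "\<bar>\<Psi> 0\<bar> \<le> \<alpha> * (ln (t + K) - ln (t + m))" if t: "0 < t" for t
  proof -
    have p: "0 < t + m" "0 < t + K" using t m mK by auto
    have "- \<alpha> * ln (t + K) \<le> ln (\<Phi> t)" "ln (\<Phi> t) \<le> - \<alpha> * ln (t + m)"
      using \<Phi>b[of t] \<Phi>pos[of t] p t ln_powr[of "t + K" "- \<alpha>"] ln_powr[of "t + m" "- \<alpha>"]
      by (metis less_imp_le ln_mono powr_gt_zero less_irrefl)+
    moreover have "ln (t + m) \<le> \<Lambda> t" "\<Lambda> t \<le> ln (t + K)"
      unfolding \<Lambda>_def using lnb[OF less_imp_le[OF t]] t
      by (auto intro!: nu.integral_ge_const nu.integral_le_const il AE_I2)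
    then have "\<alpha> * ln (t + m) \<le> \<alpha> * \<Lambda> t" "\<alpha> * \<Lambda> t \<le> \<alpha> * ln (t + K)"
      using \<alpha> by (auto intro!: mult_left_mono)
    ultimately have "\<bar>\<Psi> t\<bar> \<le> \<alpha> * (ln (t + K) - ln (t + m))"
      unfolding \<Psi>_def right_diff_distrib by (intro abs_leI; linarith)
    then show ?thesis using const[OF t] by simp
  qed
  have "((\<lambda>t. \<alpha> * (ln (t + K) - ln (t + m))) \<longlongrightarrow> 0) at_top"
    by real_asymp
  then have "\<bar>\<Psi> 0\<bar> \<le> 0"
    by (rule tendsto_lowerbound) (auto intro!: bound eventually_mono[OF eventually_gt_at_top[of 0]])
  then have "ln (\<Phi> 0) = - \<alpha> * \<Lambda> 0" by (simp add: \<Psi>_def)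
  then have "\<Phi> 0 = exp (- \<alpha> * \<Lambda> 0)" using \<Phi>pos[of 0] by (metis exp_ln order_refl)
  then show "(\<integral>\<mu>. (integral\<^sup>L \<mu> g) powr (- \<alpha>) \<partial>?D) = exp (- \<alpha> * (\<integral>x. ln (g x) \<partial>\<nu>))"
    by (simp add: \<Phi>_def \<Lambda>_def Y_def)
  show "integrable ?D (\<lambda>\<mu>. (integral\<^sup>L \<mu> g) powr (- \<alpha>))" using iY[of 0 \<alpha>] \<alpha> by (simp add: Y_def)
qed

text \<open>The Cifarelli-Regazzini (Markov-Krein) identity.\<close>

lemma dirichlet_process_exp:
  assumes \<nu>: "\<nu> \<in> M1" and \<alpha>: "0 < \<alpha>" and f: "continuous_on {0..1} f"
  shows "(\<integral>\<^sup>+\<mu>. ennreal (exp (- \<alpha> * ln (\<integral>x. exp (f x) \<partial>\<mu>))) \<partial>dirichlet_process \<alpha> \<nu>) = ennreal (exp (- \<alpha> * integral\<^sup>L \<nu> f))"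
proof -
  have e: "continuous_on {0..1} (\<lambda>x. exp (f x))" by (intro continuous_intros f)
  note aux = dirichlet_process_powr[OF \<nu> \<alpha> e]
  have "(\<integral>\<^sup>+\<mu>. ennreal (exp (- \<alpha> * ln (\<integral>x. exp (f x) \<partial>\<mu>))) \<partial>dirichlet_process \<alpha> \<nu>)
      = (\<integral>\<^sup>+\<mu>. ennreal ((\<integral>x. exp (f x) \<partial>\<mu>) powr (- \<alpha>)) \<partial>dirichlet_process \<alpha> \<nu>)"
  proof (intro nn_integral_cong arg_cong[where f=ennreal])
    fix \<mu> assume "\<mu> \<in> space (dirichlet_process \<alpha> \<nu>)"
    then have "\<mu> \<in> M1" using sets_eq_imp_space_eq[OF prob_space_dirichlet_process(2)[OF \<alpha> \<nu>]] by simp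
    from M1_integral_pos[OF this e] show "exp (- \<alpha> * ln (\<integral>x. exp (f x) \<partial>\<mu>)) = (\<integral>x. exp (f x) \<partial>\<mu>) powr (- \<alpha>)"
      by (simp add: powr_def)
  qed
  also have "\<dots> = ennreal (\<integral>\<mu>. (\<integral>x. exp (f x) \<partial>\<mu>) powr (- \<alpha>) \<partial>dirichlet_process \<alpha> \<nu>)"
    by (intro nn_integral_eq_integral aux) auto
  finally show ?thesis by (simp add: aux)
qed

section \<open>Exponential tilts of the hierarchical process\<close>

lemma continuous_map_log_integral_exp:
  assumes f: "continuous_on {0..1} f"
  shows "continuous_map weak_topology euclideanreal (\<lambda>\<mu>. ln (\<integral>x. exp (f x) \<partial>\<mu>))"
  unfolding continuous_map_def
proof (intro conjI allI impI)
  fix U :: "real set" assume "openin euclideanreal U"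
  then have U: "open U" by simp
  have e: "continuous_on {0..1} (\<lambda>x. exp (f x))" by (intro continuous_intros f)
  have "continuous_on {0<..} (ln :: real \<Rightarrow> real)" by (intro continuous_intros) auto
  then have "open (ln -` U \<inter> {0<..})"
    using U by (simp add: continuous_on_open_vimage)
  from openin_weak_generator[OF e this]
  have "openin weak_topology {\<mu> \<in> M1. (\<integral>x. exp (f x) \<partial>\<mu>) \<in> ln -` U \<inter> {0<..}}" .
  moreover have "{\<mu> \<in> M1. (\<integral>x. exp (f x) \<partial>\<mu>) \<in> ln -` U \<inter> {0<..}} = {\<mu> \<in> topspace weak_topology. ln (\<integral>x. exp (f x) \<partial>\<mu>) \<in> U}"
    using M1_integral_pos[OF _ e] by (intro set_eqI) auto
  ultimately show "openin weak_topology {\<mu> \<in> topspace weak_topology. ln (\<integral>x. exp (f x) \<partial>\<mu>) \<in> U}"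
    by (simp only:)
qed auto

abbreviation weak_pair :: "(real measure \<times> real measure) topology" where
  "weak_pair \<equiv> prod_topology weak_topology weak_topology"

definition joint_rate :: "real \<Rightarrow> real \<Rightarrow> real measure \<Rightarrow> (real \<Rightarrow> real) \<Rightarrow> (real \<Rightarrow> real) \<Rightarrow> real measure \<Rightarrow> real measure \<Rightarrow> real" where
  "joint_rate a b \<nu>\<^sub>0 f g \<nu> \<mu> = a * gibbs \<nu>\<^sub>0 \<nu> f + b * gibbs \<nu> \<mu> g"

lemma continuous_map_joint_rate:
  assumes f: "continuous_on {0..1} f" and g: "continuous_on {0..1} g"
  shows "continuous_map weak_pair euclideanreal (\<lambda>p. joint_rate a b \<nu>\<^sub>0 f g (fst p) (snd p))"
proof -
  have "continuous_map weak_pair euclideanreal (\<lambda>p. ln (\<integral>x. exp (f x) \<partial>fst p))"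
    using continuous_map_compose[OF continuous_map_fst continuous_map_log_integral_exp[OF f]] by (simp add: comp_def)
  moreover have "continuous_map weak_pair euclideanreal (\<lambda>p. ln (\<integral>x. exp (g x) \<partial>snd p))"
    using continuous_map_compose[OF continuous_map_snd continuous_map_log_integral_exp[OF g]] by (simp add: comp_def)
  moreover have "continuous_map weak_pair euclideanreal (\<lambda>p. integral\<^sup>L (fst p) g)"
    using continuous_map_compose[OF continuous_map_fst continuous_map_integral[OF g]] by (simp add: comp_def)
  ultimately show ?thesis
    unfolding joint_rate_def gibbs_def
    by (intro continuous_map_add continuous_map_real_mult continuous_map_diff) auto
qed

text \<open>The bound is uniform in the measures, which permits replacing the ratios of the
  parameters to the speed by their limits in \<open>tilt_approx\<close>.\<close>

lemma gibbs_abs_le: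
  assumes M: "\<nu> \<in> M1" "\<mu> \<in> M1" and f: "continuous_on {0..1} f" and B: "\<And>x. x \<in> {0..1} \<Longrightarrow> \<bar>f x\<bar> \<le> B"
  shows "\<bar>gibbs \<nu> \<mu> f\<bar> \<le> 2 * B"
proof -
  interpret mu: prob_space \<mu> using M1_D[OF M(2)] by simp
  have e: "continuous_on {0..1} (\<lambda>x. exp (f x))" by (intro continuous_intros f)
  have "\<bar>integral\<^sup>L \<nu> f - integral\<^sup>L \<nu> (\<lambda>_. 0)\<bar> \<le> B"
    by (intro M1_integral_dist_le M f continuous_on_const) (simp add: B)
  then have 1: "\<bar>integral\<^sup>L \<nu> f\<bar> \<le> B" by simp
  have b: "exp (- B) \<le> exp (f x)" "exp (f x) \<le> exp B" if "x \<in> space \<mu>" for x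
    using B[of x] that M1_D(3)[OF M(2)] by (auto simp: abs_le_iff)
  note i = M1_integrable_continuous[OF M(2) e]
  have "exp (- B) \<le> (\<integral>x. exp (f x) \<partial>\<mu>)" "(\<integral>x. exp (f x) \<partial>\<mu>) \<le> exp B"
    using mu.integral_ge_const[OF i, of "exp (- B)"] mu.integral_le_const[OF i, of "exp B"] b by auto
  then have "- B \<le> ln (\<integral>x. exp (f x) \<partial>\<mu>)" "ln (\<integral>x. exp (f x) \<partial>\<mu>) \<le> B"
    using M1_integral_pos[OF M(2) e] by (auto simp: ln_ge_iff intro: ln_le_cancel_iff[THEN iffD2, of _ "exp B", simplified])
  with 1 show ?thesis unfolding gibbs_def by linarith
qed

lemma dirichlet_process_in_prob_algebra:
  "0 < \<alpha> \<Longrightarrow> \<nu> \<in> M1 \<Longrightarrow> dirichlet_process \<alpha> \<nu> \<in> space (prob_algebra weak_borel)"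
  using measurable_space[OF measurable_dirichlet_process, of \<alpha> \<nu>] by simp

lemma space_dirichlet_process: "0 < \<alpha> \<Longrightarrow> \<nu> \<in> M1 \<Longrightarrow> space (dirichlet_process \<alpha> \<nu>) = M1"
  using sets_eq_imp_space_eq[OF prob_space_dirichlet_process(2)] by simp

lemma borel_measurable_dirichlet_process:
  assumes "0 < \<alpha>" "\<nu> \<in> M1" "h \<in> borel_measurable weak_borel"
  shows "h \<in> borel_measurable (dirichlet_process \<alpha> \<nu>)"
  using assms(3) unfolding measurable_cong_sets[OF prob_space_dirichlet_process(2)[OF assms(1,2)] refl] .

lemma hierarchical_dirichlet_process_emeasure:
  assumes "0 < \<alpha>" "0 < \<beta>" "\<nu> \<in> M1"
  shows "prob_space (hierarchical_dirichlet_process \<alpha> \<beta> \<nu>)"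
    "sets (hierarchical_dirichlet_process \<alpha> \<beta> \<nu>) = sets weak_borel"
    "A \<in> sets weak_borel \<Longrightarrow> emeasure (hierarchical_dirichlet_process \<alpha> \<beta> \<nu>) A =
      (\<integral>\<^sup>+\<rho>. emeasure (dirichlet_process \<beta> \<rho>) A \<partial>dirichlet_process \<alpha> \<nu>)"
proof -
  note A = dirichlet_process_in_prob_algebra[OF assms(1,3)] and B = measurable_dirichlet_process[OF assms(2)]
  have eq: "hierarchical_dirichlet_process \<alpha> \<beta> \<nu> = dirichlet_process \<alpha> \<nu> \<bind> dirichlet_process \<beta>"
    by (simp add: hierarchical_dirichlet_process_def)
  show "prob_space (hierarchical_dirichlet_process \<alpha> \<beta> \<nu>)"
    unfolding eq by (rule prob_space_bind'[OF A B])
  show "sets (hierarchical_dirichlet_process \<alpha> \<beta> \<nu>) = sets weak_borel"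
    unfolding eq by (rule sets_bind'[OF A B])
  show "A \<in> sets weak_borel \<Longrightarrow> emeasure (hierarchical_dirichlet_process \<alpha> \<beta> \<nu>) A =
      (\<integral>\<^sup>+\<rho>. emeasure (dirichlet_process \<beta> \<rho>) A \<partial>dirichlet_process \<alpha> \<nu>)"
    unfolding eq by (rule emeasure_bind_prob_algebra[OF A B])
qed

section \<open>Supports\<close>

lemma closed_supp: "closed (supp \<mu>)"
proof -
  have "supp \<mu> = {0..1} \<inter> - \<Union>{U. open U \<and> \<not> 0 < emeasure \<mu> (U \<inter> {0..1})}"
    unfolding supp_def by auto
  moreover have "open (\<Union>{U. open U \<and> \<not> 0 < emeasure \<mu> (U \<inter> {0..1})})" by (intro open_Union) auto
  ultimately show ?thesis by (simp only:) (intro closed_Int closed_atLeastAtMost closed_Compl)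
qed

lemma supp_subset: "supp \<mu> \<subseteq> {0..1}"
  by (auto simp: supp_def)

lemma open_Int_unit_borel: "open U \<Longrightarrow> U \<inter> {0..1} \<in> sets unit_borel"
  by (auto simp: sets_unit_borel sets_restrict_space intro!: image_eqI[of _ _ U])

text \<open>The complement of the support is a union of null sets taken from a countable
  base.\<close>

lemma emeasure_supp:
  assumes \<mu>: "\<mu> \<in> M1" shows "emeasure \<mu> (supp \<mu>) = 1"
proof -
  interpret prob_space \<mu> using M1_D[OF \<mu>] by simp
  obtain B :: "real set set" where B: "countable B" "topological_basis B"
    using ex_countable_basis by blast
  define N where "N = {U \<in> B. emeasure \<mu> (U \<inter> {0..1}) = 0}"
  have opn: "open U" if "U \<in> N" for U using that B topological_basis_open by (auto simp: N_def)
  have "{0..1} - supp \<mu> = (\<Union>U\<in>N. U \<inter> {0..1})"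
  proof (intro equalityI subsetI)
    fix x assume "x \<in> {0..1} - supp \<mu>"
    then obtain U where U: "open U" "x \<in> U" "emeasure \<mu> (U \<inter> {0..1}) = 0" "x \<in> {0..1}"
      by (auto simp: supp_def)
    obtain V where V: "V \<in> B" "x \<in> V" "V \<subseteq> U" using topological_basisE[OF B(2) U(1,2)] by blast
    have "emeasure \<mu> (V \<inter> {0..1}) \<le> emeasure \<mu> (U \<inter> {0..1})"
      using V open_Int_unit_borel[OF U(1)] M1_D(2)[OF \<mu>] by (intro emeasure_mono) auto
    with U V show "x \<in> (\<Union>U\<in>N. U \<inter> {0..1})" by (auto simp: N_def)
  next
    fix x assume "x \<in> (\<Union>U\<in>N. U \<inter> {0..1})"
    then obtain U where U: "U \<in> N" "x \<in> U" "x \<in> {0..1}" by auto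
    then have "\<not> 0 < emeasure \<mu> (U \<inter> {0..1})" by (auto simp: N_def)
    with U opn[OF U(1)] have "x \<notin> supp \<mu>" unfolding supp_def by blast
    with U show "x \<in> {0..1} - supp \<mu>" by blast
  qed
  moreover have "emeasure \<mu> (\<Union>U\<in>N. U \<inter> {0..1}) = 0"
  proof -
    have "(\<Union>U\<in>N. U \<inter> {0..1}) \<in> null_sets \<mu>"
    proof (rule null_sets_UN')
      show "countable N" using B(1) by (auto simp: N_def intro: countable_subset[of _ B])
      show "U \<inter> {0..1} \<in> null_sets \<mu>" if "U \<in> N" for U
        using that open_Int_unit_borel[OF opn[OF that]] M1_D(2)[OF \<mu>] by (simp add: N_def null_sets_def)
    qed
    then show ?thesis by (simp add: null_sets_def)
  qed
  ultimately have z: "emeasure \<mu> ({0..1} - supp \<mu>) = 0" by simp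
  have s: "supp \<mu> \<in> sets \<mu>" using closed_in_unit_borel[OF closed_supp supp_subset] M1_D(2)[OF \<mu>] by simp
  have "1 - prob (supp \<mu>) = prob (space \<mu> - supp \<mu>)" using prob_compl[OF s] by simp
  also have "\<dots> = 0" using z M1_D(3)[OF \<mu>] by (simp add: emeasure_eq_measure)
  finally show ?thesis by (simp add: emeasure_eq_measure)
qed

text \<open>For closed \<open>K\<close> this is the same as support inside \<open>K\<close>, in a
  form that is weakly closed and easily checked for random atomic measures.\<close>

definition concentrated :: "real set \<Rightarrow> real measure set" where
  "concentrated K = {\<mu> \<in> M1. emeasure \<mu> K = 1}"

lemma supp_subset_iff:
  assumes "\<mu> \<in> M1" "closed K" "K \<subseteq> {0..1}"
  shows "supp \<mu> \<subseteq> K \<longleftrightarrow> emeasure \<mu> K = 1"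
proof
  interpret prob_space \<mu> using M1_D[OF assms(1)] by simp
  have K: "K \<in> sets \<mu>" using closed_in_unit_borel[OF assms(2,3)] M1_D(2)[OF assms(1)] by simp
  show "emeasure \<mu> K = 1" if "supp \<mu> \<subseteq> K"
    by (rule antisym[OF emeasure_le_1]) (use emeasure_mono[OF that K] emeasure_supp[OF assms(1)] in \<open>simp only:\<close>)
  show "supp \<mu> \<subseteq> K" if "emeasure \<mu> K = 1"
  proof
    fix x assume x: "x \<in> supp \<mu>"
    show "x \<in> K"
    proof (rule ccontr)
      assume "x \<notin> K"
      moreover have "\<forall>U. open U \<and> x \<in> U \<longrightarrow> 0 < emeasure \<mu> (U \<inter> {0..1})"
        using x[unfolded supp_def mem_Collect_eq] by (rule conjunct2)
      ultimately have "0 < emeasure \<mu> (- K \<inter> {0..1})" using open_Compl[OF assms(2)] by (meson ComplI)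
      moreover have "- K \<inter> {0..1} = space \<mu> - K" using M1_D(3)[OF assms(1)] by auto
      moreover have "prob (space \<mu> - K) = 0"
        using prob_compl[OF K] that by (simp add: emeasure_eq_measure)
      ultimately show False by (simp add: emeasure_eq_measure)
    qed
  qed
qed

text \<open>Full mass on \<open>K\<close> is detected by the continuous functions
  \<open>closed_approx K n\<close>, which dominate the indicator and decrease to it.\<close>

lemma closedin_concentrated:
  assumes K: "closed K" "K \<subseteq> {0..1}" "K \<noteq> {}"
  shows "closedin weak_topology (concentrated K)"
proof -
  have "concentrated K = (\<Inter>n. {\<mu> \<in> topspace weak_topology. integral\<^sup>L \<mu> (closed_approx K n) \<in> {1..}})"
  proof (intro equalityI subsetI)
    fix \<mu> assume "\<mu> \<in> concentrated K"
    then have \<mu>: "\<mu> \<in> M1" "emeasure \<mu> K = 1" by (auto simp: concentrated_def)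
    interpret prob_space \<mu> using M1_D[OF \<mu>(1)] by simp
    have Ks: "K \<in> sets \<mu>" using closed_in_unit_borel[OF K(1,2)] M1_D(2)[OF \<mu>(1)] by simp
    have "1 \<le> integral\<^sup>L \<mu> (closed_approx K n)" for n
    proof -
      have "1 = integral\<^sup>L \<mu> (indicat_real K)"
        using \<mu>(2) Ks K(2) M1_D(3)[OF \<mu>(1)] by (simp add: Int_absorb2 emeasure_eq_measure)
      also have "\<dots> \<le> integral\<^sup>L \<mu> (closed_approx K n)"
      proof (rule integral_mono)
        show "integrable \<mu> (indicat_real K)" using Ks by (simp add: emeasure_eq_measure)
        show "integrable \<mu> (closed_approx K n)"
          by (rule M1_integrable_continuous[OF \<mu>(1) continuous_on_closed_approx])
        show "indicat_real K x \<le> closed_approx K n x" for x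
          by (auto simp: indicator_def closed_approx_def)
      qed
      finally show ?thesis .
    qed
    then show "\<mu> \<in> (\<Inter>n. {\<mu> \<in> topspace weak_topology. integral\<^sup>L \<mu> (closed_approx K n) \<in> {1..}})"
      using \<mu>(1) by simp
  next
    fix \<mu> assume "\<mu> \<in> (\<Inter>n. {\<mu> \<in> topspace weak_topology. integral\<^sup>L \<mu> (closed_approx K n) \<in> {1..}})"
    then have \<mu>: "\<mu> \<in> M1" "\<And>n. 1 \<le> integral\<^sup>L \<mu> (closed_approx K n)" by auto
    interpret prob_space \<mu> using M1_D[OF \<mu>(1)] by simp
    have "(\<lambda>n. integral\<^sup>L \<mu> (closed_approx K n)) \<longlonglongrightarrow> measure \<mu> K"
      by (intro integral_closed_approx_tendsto K M1_D(2)[OF \<mu>(1)]) unfold_locales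
    then have "1 \<le> measure \<mu> K" by (rule LIMSEQ_le_const) (use \<mu>(2) in auto)
    then have "measure \<mu> K = 1" using prob_le_1[of K] by linarith
    then show "\<mu> \<in> concentrated K" using \<mu>(1) by (simp add: concentrated_def emeasure_eq_measure)
  qed
  moreover have "closedin weak_topology (\<Inter>n. {\<mu> \<in> topspace weak_topology. integral\<^sup>L \<mu> (closed_approx K n) \<in> {1..}})"
    by (intro closedin_INT closedin_continuous_map_preimage[OF continuous_map_integral[OF continuous_on_closed_approx]]) auto
  ultimately show ?thesis by (simp only:)
qed

lemma snd_vimage_Times: "X \<subseteq> B \<Longrightarrow> snd -` X \<inter> (A \<times> B) = A \<times> X"
  by auto

text \<open>Almost surely all atoms lie in \<open>K\<close>. Applied on both levels, this confines
  the process to measures whose support lies in that of \<open>\<nu>\<^sub>0\<close>, as the case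
  distinction in the rate demands.\<close>

lemma AE_dirichlet_process_concentrated:
  assumes \<alpha>: "0 < \<alpha>" and \<nu>: "\<nu> \<in> concentrated K" and K: "K \<in> sets unit_borel"
  shows "AE \<mu> in dirichlet_process \<alpha> \<nu>. \<mu> \<in> concentrated K"
proof -
  have \<nu>M: "\<nu> \<in> M1" and \<nu>K: "emeasure \<nu> K = 1" using \<nu> by (auto simp: concentrated_def)
  let ?A = "PiM UNIV (\<lambda>_::nat. \<nu>)" and ?S = "stick_law \<alpha>"
  interpret nu: prob_space \<nu> using M1_D[OF \<nu>M] by simp
  interpret A: prob_space ?A by (intro prob_space_PiM nu.prob_space_axioms)
  interpret S: prob_space ?S by (rule prob_space_stick_law[OF \<alpha>])
  have Ks: "K \<in> sets \<nu>" using K M1_D(2)[OF \<nu>M] by simp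
  have "AE x in \<nu>. x \<in> K" using Ks \<nu>K by (intro nu.AE_prob_1) (simp add: nu.emeasure_eq_measure)
  then have "AE \<xi> in ?A. \<forall>i. \<xi> i \<in> K"
    unfolding AE_all_countable
    by (intro allI AE_PiM_component[where M="\<lambda>_. \<nu>"] nu.prob_space_axioms) auto
  then have "AE \<xi> in distr (?A \<Otimes>\<^sub>M ?S) ?A fst. \<forall>i. \<xi> i \<in> K" by (simp only: S.distr_pair_fst)
  from AE_distrD[OF measurable_fst this] have 1: "AE z in ?A \<Otimes>\<^sub>M ?S. \<forall>i. fst z i \<in> K" .
  have "distr (?A \<Otimes>\<^sub>M ?S) ?S snd = ?S"
  proof (rule measure_eqI)
    fix X assume "X \<in> sets (distr (?A \<Otimes>\<^sub>M ?S) ?S snd)"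
    then have X: "X \<in> sets ?S" by simp
    have "snd -` X \<inter> space (?A \<Otimes>\<^sub>M ?S) = space ?A \<times> X"
      unfolding space_pair_measure by (rule snd_vimage_Times[OF sets.sets_into_space[OF X]])
    then have "emeasure (distr (?A \<Otimes>\<^sub>M ?S) ?S snd) X = emeasure (?A \<Otimes>\<^sub>M ?S) (space ?A \<times> X)"
      by (simp only: emeasure_distr[OF measurable_snd X])
    also have "\<dots> = emeasure ?S X"
      by (simp only: S.emeasure_pair_measure_Times[OF sets.top X] A.emeasure_space_1 mult_1)
    finally show "emeasure (distr (?A \<Otimes>\<^sub>M ?S) ?S snd) X = emeasure ?S X" .
  qed simp
  then have "AE U in distr (?A \<Otimes>\<^sub>M ?S) ?S snd. good_sticks U" using AE_good_sticks[OF \<alpha>] by (simp only:)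
  from AE_distrD[OF measurable_snd this] have 2: "AE z in ?A \<Otimes>\<^sub>M ?S. good_sticks (snd z)" .
  note T = dirichlet_process_measurable_pair[OF \<nu>M, of \<alpha>]
  have "concentrated K \<in> sets (prob_algebra unit_borel)"
  proof -
    have "(\<lambda>\<mu>. emeasure \<mu> K) \<in> borel_measurable (prob_algebra unit_borel)"
      using K by (auto simp: prob_algebra_def intro!: measurable_restrict_space1 measurable_emeasure_subprob_algebra)
    from measurable_sets[OF this, of "{1}"] have "(\<lambda>\<mu>. emeasure \<mu> K) -` {1} \<inter> M1 \<in> sets (prob_algebra unit_borel)" by simp
    moreover have "(\<lambda>\<mu>. emeasure \<mu> K) -` {1} \<inter> M1 = concentrated K" by (auto simp: concentrated_def)
    ultimately show ?thesis by (simp only:)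
  qed
  then have cm: "{\<mu> \<in> space weak_borel. \<mu> \<in> concentrated K} \<in> sets weak_borel"
    by (simp add: sets_borel_of_weak concentrated_def)
  show ?thesis
    unfolding dirichlet_process_def
  proof (subst AE_distr_iff[OF T cm])
    show "AE z in ?A \<Otimes>\<^sub>M ?S. (case z of (\<xi>, U) \<Rightarrow> atomic_measure (stick_breaking U) \<xi>) \<in> concentrated K"
      using 1 2
    proof eventually_elim
      case (elim z)
      have K01: "K \<subseteq> {0..1}" using sets.sets_into_space[OF K] by simp
      then have \<xi>: "fst z i \<in> {0..1}" for i using elim(1) by blast
      note V = good_sticks_nonneg[OF elim(2)] good_sticks_sums[OF elim(2)]
      have "(\<Sum>i. ennreal (stick_breaking (snd z) i) * indicator K (fst z i)) = (\<Sum>i. ennreal (stick_breaking (snd z) i))"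
        using elim(1) by simp
      also have "\<dots> = ennreal 1"
        using V sums_ennreal[of "stick_breaking (snd z)" 1] by (intro sums_unique[symmetric]) simp
      finally have "emeasure (atomic_measure (stick_breaking (snd z)) (fst z)) K = 1"
        by (simp add: emeasure_atomic_measure[OF V \<xi> K])
      then show ?case using atomic_measure_in_M1[of "fst z"] \<xi> by (simp add: concentrated_def split_beta')
    qed
  qed
qed

section \<open>Tilts with mean one\<close>

lemma measurable_exp_log_integral:
  assumes f: "continuous_on {0..1} f"
  shows "(\<lambda>\<mu>. ennreal (exp (c * ln (\<integral>x. exp (f x) \<partial>\<mu>)))) \<in> borel_measurable weak_borel"
proof -
  have "(\<lambda>\<mu>. ln (\<integral>x. exp (f x) \<partial>\<mu>)) \<in> borel_measurable weak_borel"
    by (intro continuous_map_measurable continuous_map_log_integral_exp f)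
  then show ?thesis by measurable
qed

lemma exp_gibbs_eq:
  "ennreal (exp (\<beta> * gibbs \<nu> \<mu> g)) = ennreal (exp (\<beta> * integral\<^sup>L \<nu> g)) * ennreal (exp (- \<beta> * ln (\<integral>x. exp (g x) \<partial>\<mu>)))"
  by (simp add: gibbs_def right_diff_distrib ennreal_mult'[symmetric] exp_add[symmetric])

lemma measurable_exp_gibbs:
  "continuous_on {0..1} g \<Longrightarrow> (\<lambda>\<mu>. ennreal (exp (\<beta> * gibbs \<nu> \<mu> g))) \<in> borel_measurable weak_borel"
  unfolding exp_gibbs_eq by (intro borel_measurable_times_ennreal borel_measurable_const measurable_exp_log_integral)

text \<open>The Markov-Krein identity with its right-hand side moved under the integral: the tilt is
  a probability density.\<close>

lemma nn_integral_exp_gibbs: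
  assumes "0 < \<beta>" "\<nu> \<in> M1" "continuous_on {0..1} g"
  shows "(\<integral>\<^sup>+\<mu>. ennreal (exp (\<beta> * gibbs \<nu> \<mu> g)) \<partial>dirichlet_process \<beta> \<nu>) = 1"
proof -
  note m = borel_measurable_dirichlet_process[OF assms(1,2) measurable_exp_log_integral[OF assms(3), of "- \<beta>"]]
  show ?thesis
    unfolding exp_gibbs_eq nn_integral_cmult[OF m] dirichlet_process_exp[OF assms(2,1,3)]
    by (simp add: ennreal_mult'[symmetric] exp_add[symmetric])
qed

text \<open>The exponential tilts \<open>exp (\<alpha> gibbs \<nu>\<^sub>0 \<nu> f + \<beta> gibbs \<nu> \<mu> g)\<close> are densities with respect to the joint
  law of the two levels. The two large deviation bounds both come from integrating a pointwise
  inequality between such tilts and an indicator function.\<close>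

lemma iterated_integral_tilts:
  assumes \<alpha>: "0 < \<alpha>" and \<beta>: "0 < \<beta>" and \<nu>\<^sub>0: "\<nu>\<^sub>0 \<in> M1" and A: "A \<in> sets weak_borel"
    and fin: "finite I" and f: "\<And>i. i \<in> I \<Longrightarrow> continuous_on {0..1} (f i)" and g: "\<And>i. i \<in> I \<Longrightarrow> continuous_on {0..1} (g i)"
  shows "(\<integral>\<^sup>+\<nu>. \<integral>\<^sup>+\<mu>. c * indicator A \<mu> + d * (\<Sum>i\<in>I. ennreal (exp (\<alpha> * gibbs \<nu>\<^sub>0 \<nu> (f i) + \<beta> * gibbs \<nu> \<mu> (g i))))
      \<partial>dirichlet_process \<beta> \<nu> \<partial>dirichlet_process \<alpha> \<nu>\<^sub>0)
    = c * emeasure (hierarchical_dirichlet_process \<alpha> \<beta> \<nu>\<^sub>0) A + d * of_nat (card I)"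
proof -
  let ?D0 = "dirichlet_process \<alpha> \<nu>\<^sub>0"
  have inner: "(\<integral>\<^sup>+\<mu>. c * indicator A \<mu> + d * (\<Sum>i\<in>I. ennreal (exp (\<alpha> * gibbs \<nu>\<^sub>0 \<nu> (f i) + \<beta> * gibbs \<nu> \<mu> (g i)))) \<partial>dirichlet_process \<beta> \<nu>)
      = c * emeasure (dirichlet_process \<beta> \<nu>) A + d * (\<Sum>i\<in>I. ennreal (exp (\<alpha> * gibbs \<nu>\<^sub>0 \<nu> (f i))))"
    if \<nu>: "\<nu> \<in> M1" for \<nu>
  proof -
    let ?D = "dirichlet_process \<beta> \<nu>"
    have gm: "(\<lambda>\<mu>. ennreal (exp (\<beta> * gibbs \<nu> \<mu> (g i)))) \<in> borel_measurable ?D" if "i \<in> I" for i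
      by (rule borel_measurable_dirichlet_process[OF \<beta> \<nu> measurable_exp_gibbs[OF g[OF that]]])
    have As: "A \<in> sets ?D" using A prob_space_dirichlet_process(2)[OF \<beta> \<nu>] by simp
    have split: "ennreal (exp (\<alpha> * gibbs \<nu>\<^sub>0 \<nu> (f i) + \<beta> * gibbs \<nu> \<mu> (g i))) =
        ennreal (exp (\<alpha> * gibbs \<nu>\<^sub>0 \<nu> (f i))) * ennreal (exp (\<beta> * gibbs \<nu> \<mu> (g i)))" for i \<mu>
      by (simp add: exp_add ennreal_mult')
    have m1: "(\<lambda>\<mu>. ennreal (exp (\<alpha> * gibbs \<nu>\<^sub>0 \<nu> (f i))) * ennreal (exp (\<beta> * gibbs \<nu> \<mu> (g i)))) \<in> borel_measurable ?D"
      if "i \<in> I" for i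
      by (intro borel_measurable_times_ennreal borel_measurable_const gm that)
    have q1: "(\<lambda>\<mu>. c * indicator A \<mu>) \<in> borel_measurable ?D"
      by (intro borel_measurable_times_ennreal borel_measurable_const borel_measurable_indicator As)
    have q3: "(\<lambda>\<mu>. \<Sum>i\<in>I. ennreal (exp (\<alpha> * gibbs \<nu>\<^sub>0 \<nu> (f i))) * ennreal (exp (\<beta> * gibbs \<nu> \<mu> (g i)))) \<in> borel_measurable ?D"
      by (intro borel_measurable_sum m1)
    have q2: "(\<lambda>\<mu>. d * (\<Sum>i\<in>I. ennreal (exp (\<alpha> * gibbs \<nu>\<^sub>0 \<nu> (f i))) * ennreal (exp (\<beta> * gibbs \<nu> \<mu> (g i))))) \<in> borel_measurable ?D"
      by (intro borel_measurable_times_ennreal borel_measurable_const q3)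
    have "(\<integral>\<^sup>+\<mu>. c * indicator A \<mu> + d * (\<Sum>i\<in>I. ennreal (exp (\<alpha> * gibbs \<nu>\<^sub>0 \<nu> (f i) + \<beta> * gibbs \<nu> \<mu> (g i)))) \<partial>?D)
      = (\<integral>\<^sup>+\<mu>. c * indicator A \<mu> \<partial>?D) + d * (\<Sum>i\<in>I. (\<integral>\<^sup>+\<mu>. ennreal (exp (\<alpha> * gibbs \<nu>\<^sub>0 \<nu> (f i))) * ennreal (exp (\<beta> * gibbs \<nu> \<mu> (g i))) \<partial>?D))"
      unfolding split nn_integral_add[OF q1 q2] nn_integral_cmult[OF q3]
      by (subst nn_integral_sum) (auto intro!: m1)
    \<comment> \<open>The second-level tilt integrates to 1 for every fixed \<nu>, which leaves the
      first-level tilt for the outer integral.\<close>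
    also have "(\<Sum>i\<in>I. (\<integral>\<^sup>+\<mu>. ennreal (exp (\<alpha> * gibbs \<nu>\<^sub>0 \<nu> (f i))) * ennreal (exp (\<beta> * gibbs \<nu> \<mu> (g i))) \<partial>?D)) =
        (\<Sum>i\<in>I. ennreal (exp (\<alpha> * gibbs \<nu>\<^sub>0 \<nu> (f i))))"
      by (intro sum.cong refl) (simp add: nn_integral_cmult[OF gm] nn_integral_exp_gibbs[OF \<beta> \<nu> g])
    also have "(\<integral>\<^sup>+\<mu>. c * indicator A \<mu> \<partial>?D) = c * emeasure ?D A"
      using As by (simp add: nn_integral_cmult)
    finally show ?thesis .
  qed
  have fm: "(\<lambda>\<nu>. ennreal (exp (\<alpha> * gibbs \<nu>\<^sub>0 \<nu> (f i)))) \<in> borel_measurable ?D0" if "i \<in> I" for i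
    by (rule borel_measurable_dirichlet_process[OF \<alpha> \<nu>\<^sub>0 measurable_exp_gibbs[OF f[OF that]]])
  have em: "(\<lambda>\<nu>. emeasure (dirichlet_process \<beta> \<nu>) A) \<in> borel_measurable ?D0"
    using measurable_compose[OF measurable_prob_algebraD[OF measurable_dirichlet_process[OF \<beta>]] measurable_emeasure_subprob_algebra[OF A]]
    by (intro borel_measurable_dirichlet_process \<alpha> \<nu>\<^sub>0) (simp add: comp_def)
  have "(\<integral>\<^sup>+\<nu>. \<integral>\<^sup>+\<mu>. c * indicator A \<mu> + d * (\<Sum>i\<in>I. ennreal (exp (\<alpha> * gibbs \<nu>\<^sub>0 \<nu> (f i) + \<beta> * gibbs \<nu> \<mu> (g i))))
      \<partial>dirichlet_process \<beta> \<nu> \<partial>?D0)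
     = (\<integral>\<^sup>+\<nu>. c * emeasure (dirichlet_process \<beta> \<nu>) A + d * (\<Sum>i\<in>I. ennreal (exp (\<alpha> * gibbs \<nu>\<^sub>0 \<nu> (f i)))) \<partial>?D0)"
    by (rule nn_integral_cong) (simp only: inner space_dirichlet_process[OF \<alpha> \<nu>\<^sub>0])
  also have "\<dots> = c * (\<integral>\<^sup>+\<nu>. emeasure (dirichlet_process \<beta> \<nu>) A \<partial>?D0) +
      d * (\<Sum>i\<in>I. \<integral>\<^sup>+\<nu>. ennreal (exp (\<alpha> * gibbs \<nu>\<^sub>0 \<nu> (f i))) \<partial>?D0)"
  proof -
    have q1: "(\<lambda>\<nu>. c * emeasure (dirichlet_process \<beta> \<nu>) A) \<in> borel_measurable ?D0"
      by (intro borel_measurable_times_ennreal borel_measurable_const em)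
    have q3: "(\<lambda>\<nu>. \<Sum>i\<in>I. ennreal (exp (\<alpha> * gibbs \<nu>\<^sub>0 \<nu> (f i)))) \<in> borel_measurable ?D0"
      by (intro borel_measurable_sum fm)
    have q2: "(\<lambda>\<nu>. d * (\<Sum>i\<in>I. ennreal (exp (\<alpha> * gibbs \<nu>\<^sub>0 \<nu> (f i))))) \<in> borel_measurable ?D0"
      by (intro borel_measurable_times_ennreal borel_measurable_const q3)
    show ?thesis
      unfolding nn_integral_add[OF q1 q2] nn_integral_cmult[OF q3] nn_integral_cmult[OF em]
      by (subst nn_integral_sum, erule fm) (rule refl)
  qed
  also have "(\<Sum>i\<in>I. \<integral>\<^sup>+\<nu>. ennreal (exp (\<alpha> * gibbs \<nu>\<^sub>0 \<nu> (f i))) \<partial>?D0) = of_nat (card I)"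
    using nn_integral_exp_gibbs[OF \<alpha> \<nu>\<^sub>0 f] by simp
  finally show ?thesis by (simp only: hierarchical_dirichlet_process_emeasure(3)[OF \<alpha> \<beta> \<nu>\<^sub>0 A])
qed

section \<open>Smoothing\<close>

lemma integral_eq_if_moments_eq:
  fixes f :: "real \<Rightarrow> real"
  assumes "\<mu> \<in> M1" "\<nu> \<in> M1" "moments \<mu> = moments \<nu>" "continuous_on {0..1} f"
  shows "integral\<^sup>L \<mu> f = integral\<^sup>L \<nu> f"
proof -
  have "(\<lambda>n::nat. integral\<^sup>L \<mu> f) \<longlonglongrightarrow> integral\<^sup>L \<nu> f"
    using assms by (intro integral_tendsto_if_moments) auto
  then show ?thesis by (simp add: LIMSEQ_const_iff)
qed

lemma exp_quadratic_bound:
  fixes u :: real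
  assumes "\<bar>u\<bar> \<le> 1" shows "exp u \<le> 1 + u + u\<^sup>2"
proof (cases "0 \<le> u")
  case True
  then show ?thesis using exp_bound[of u] assms by simp
next
  case False
  then have u: "0 < 1 - u" "u ^ 3 \<le> 0"
    using mult_nonneg_nonpos[of "u * u" u] by (simp_all add: power3_eq_cube)
  have "1 - u \<le> exp (- u)" using exp_ge_add_one_self[of "- u"] by simp
  then have "exp u * (1 - u) \<le> exp u * exp (- u)" by (intro mult_left_mono) auto
  also have "\<dots> = 1" by (simp add: exp_minus)
  \<comment> \<open>The product equals \<open>1 - u ^ 3\<close>.\<close>
  also have "1 \<le> (1 + u + u\<^sup>2) * (1 - u)" using u(2) by (simp add: algebra_simps power2_eq_square power3_eq_cube)
  finally show ?thesis using u(1) by simp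
qed

text \<open>At a maximiser \<open>f\<close> of \<open>gibbs \<rho> \<nu>\<close>, the first variation in direction \<open>x\<^sup>k e\<^sup>-\<^sup>f\<close> compares the \<open>k\<close>-th
  moments of \<open>\<nu>\<close> and of the tilted measure \<open>e\<^sup>-\<^sup>f \<rho>\<close>.\<close>

lemma moments_eq_if_gibbs_max:
  assumes M: "\<rho> \<in> M1" "\<nu> \<in> M1" "\<rho>' \<in> M1" and f: "continuous_on {0..1} f"
    and tilt: "\<And>h. continuous_on {0..1} h \<Longrightarrow> integral\<^sup>L \<rho>' h = (\<integral>x. exp (- f x) * h x \<partial>\<rho>)"
    and max: "\<And>f'. continuous_on {0..1} f' \<Longrightarrow> gibbs \<rho> \<nu> f' \<le> gibbs \<rho> \<nu> f"
  shows "moments \<nu> = moments \<rho>'"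
proof -
  interpret nu: prob_space \<nu> using M1_D[OF M(2)] by simp
  define Z where "Z = (\<integral>x. exp (f x) \<partial>\<nu>)"
  have ef: "continuous_on {0..1} (\<lambda>x. exp (f x))" by (intro continuous_intros f)
  have Z: "0 < Z" unfolding Z_def by (rule M1_integral_pos[OF M(2) ef]) simp
  have first_variation: "integral\<^sup>L \<rho> \<phi> = (\<integral>x. \<phi> x * exp (f x) \<partial>\<nu>) / Z" if \<phi>: "continuous_on {0..1} \<phi>" for \<phi>
  proof (rule ccontr)
    define \<Delta> where "\<Delta> = integral\<^sup>L \<rho> \<phi> - (\<integral>x. \<phi> x * exp (f x) \<partial>\<nu>) / Z"
    assume "integral\<^sup>L \<rho> \<phi> \<noteq> (\<integral>x. \<phi> x * exp (f x) \<partial>\<nu>) / Z"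
    then have \<Delta>: "\<Delta> \<noteq> 0" by (simp add: \<Delta>_def)
    obtain B0 where B0: "0 \<le> B0" "\<And>x. x \<in> {0..1} \<Longrightarrow> \<bar>\<phi> x\<bar> \<le> B0"
      using continuous_unit_bounded[OF \<phi>] by blast
    define B where "B = B0 + 1"
    have B: "0 < B" "\<And>x. x \<in> {0..1} \<Longrightarrow> \<bar>\<phi> x\<bar> \<le> B"
    proof -
      show "0 < B" using B0(1) by (simp add: B_def)
      show "\<bar>\<phi> x\<bar> \<le> B" if "x \<in> {0..1}" for x using B0(2)[OF that] by (simp add: B_def)
    qed
    \<comment> \<open>The second bound keeps \<open>\<bar>s * \<phi> x\<bar> \<le> 1\<close>, the
      range of the quadratic estimate. The first makes the quadratic error
      \<open>(s * B)\<^sup>2\<close> at most half of the linear gain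
      \<open>s * \<Delta>\<close>.\<close>
    define t where "t = min (1 / (2 * B\<^sup>2)) (1 / (\<bar>\<Delta>\<bar> * B))"
    have t: "0 < t" "t \<le> 1 / (2 * B\<^sup>2)" "t \<le> 1 / (\<bar>\<Delta>\<bar> * B)" using B \<Delta> by (auto simp: t_def)
    define s where "s = t * \<Delta>"
    have sB: "\<bar>s\<bar> * B \<le> 1" using t(1,3) B \<Delta> by (simp add: s_def abs_mult field_simps)
    have fs: "continuous_on {0..1} (\<lambda>x. f x + s * \<phi> x)" by (intro continuous_intros f \<phi>)
    have efs: "continuous_on {0..1} (\<lambda>x. exp (f x + s * \<phi> x))" by (intro continuous_intros f \<phi>)
    have p\<phi>: "continuous_on {0..1} (\<lambda>x. \<phi> x * exp (f x))" by (intro continuous_intros f \<phi>)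
    note ints = M1_integrable_continuous[OF M(2) ef] M1_integrable_continuous[OF M(2) p\<phi>]
    have "(\<integral>x. exp (f x + s * \<phi> x) \<partial>\<nu>) \<le> (\<integral>x. (1 + (s * B)\<^sup>2) * exp (f x) + s * (\<phi> x * exp (f x)) \<partial>\<nu>)"
    proof (rule integral_mono)
      show "integrable \<nu> (\<lambda>x. exp (f x + s * \<phi> x))" by (rule M1_integrable_continuous[OF M(2) efs])
      show "integrable \<nu> (\<lambda>x. (1 + (s * B)\<^sup>2) * exp (f x) + s * (\<phi> x * exp (f x)))" using ints by simp
      fix x assume "x \<in> space \<nu>"
      then have b: "\<bar>\<phi> x\<bar> \<le> B" using B(2) M1_D(3)[OF M(2)] by simp
      have "\<bar>s * \<phi> x\<bar> \<le> \<bar>s\<bar> * B" unfolding abs_mult by (intro mult_left_mono b) auto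
      also have "\<dots> \<le> 1" by (rule sB)
      finally have "exp (s * \<phi> x) \<le> 1 + s * \<phi> x + (s * \<phi> x)\<^sup>2"
        by (rule exp_quadratic_bound)
      also have "(s * \<phi> x)\<^sup>2 \<le> (s * B)\<^sup>2"
        unfolding power_mult_distrib using b B(1) by (intro mult_left_mono) (auto simp: abs_le_square_iff[symmetric])
      finally have "exp (s * \<phi> x) \<le> 1 + s * \<phi> x + (s * B)\<^sup>2" by simp
      then have "exp (f x) * exp (s * \<phi> x) \<le> exp (f x) * (1 + s * \<phi> x + (s * B)\<^sup>2)"
        by (intro mult_left_mono) auto
      then show "exp (f x + s * \<phi> x) \<le> (1 + (s * B)\<^sup>2) * exp (f x) + s * (\<phi> x * exp (f x))"
        by (simp add: exp_add algebra_simps)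
    qed
    also have "\<dots> = (1 + (s * B)\<^sup>2) * Z + s * (\<integral>x. \<phi> x * exp (f x) \<partial>\<nu>)"
      using ints by (simp add: Z_def)
    also have "\<dots> = Z * (1 + ((s * B)\<^sup>2 + s * ((\<integral>x. \<phi> x * exp (f x) \<partial>\<nu>) / Z)))"
      using Z by (simp add: field_simps)
    finally have le: "(\<integral>x. exp (f x + s * \<phi> x) \<partial>\<nu>) \<le> Z * (1 + ((s * B)\<^sup>2 + s * ((\<integral>x. \<phi> x * exp (f x) \<partial>\<nu>) / Z)))" .
    have Zs: "0 < (\<integral>x. exp (f x + s * \<phi> x) \<partial>\<nu>)" by (rule M1_integral_pos[OF M(2) efs]) simp
    let ?w = "(s * B)\<^sup>2 + s * ((\<integral>x. \<phi> x * exp (f x) \<partial>\<nu>) / Z)"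
    have w: "0 < 1 + ?w" using order.strict_trans2[OF Zs le] Z by (simp add: zero_less_mult_iff)
    have "ln (\<integral>x. exp (f x + s * \<phi> x) \<partial>\<nu>) \<le> ln (Z * (1 + ?w))" using le Zs by (intro ln_mono)
    also have "\<dots> = ln Z + ln (1 + ?w)" using Z w by (simp only: ln_mult_pos)
    also have "ln (1 + ?w) \<le> ?w" using w ln_le_minus_one[of "1 + ?w"] by simp
    finally have l: "ln (\<integral>x. exp (f x + s * \<phi> x) \<partial>\<nu>) \<le> ln Z + ?w" by simp
    have "(\<integral>x. f x + s * \<phi> x \<partial>\<rho>) = integral\<^sup>L \<rho> f + s * integral\<^sup>L \<rho> \<phi>"
      using M1_integrable_continuous[OF M(1) f] M1_integrable_continuous[OF M(1) \<phi>] by simp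
    with max[OF fs] l have "s * integral\<^sup>L \<rho> \<phi> \<le> ?w" unfolding gibbs_def Z_def by linarith
    then have "s * \<Delta> \<le> (s * B)\<^sup>2" by (simp add: \<Delta>_def right_diff_distrib)
    then have "t * \<Delta>\<^sup>2 \<le> t * \<Delta>\<^sup>2 * (t * B\<^sup>2)" by (simp add: s_def power2_eq_square mult_ac)
    then have "1 \<le> t * B\<^sup>2" using t(1) \<Delta> by simp
    also have "t * B\<^sup>2 \<le> 1 / (2 * B\<^sup>2) * B\<^sup>2" using t(2) by (intro mult_right_mono) auto
    also have "\<dots> = 1 / 2" using B(1) by simp
    finally show False by simp
  qed
  have mom: "moments \<rho>' k = moments \<nu> k / Z" for k
  proof -
    have c: "continuous_on {0..1} (\<lambda>x. exp (- f x) * x ^ k)" by (intro continuous_intros f)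
    have "moments \<rho>' k = (\<integral>x. exp (- f x) * x ^ k \<partial>\<rho>)"
      unfolding moments_def by (intro tilt continuous_intros)
    also have "\<dots> = (\<integral>x. (exp (- f x) * x ^ k) * exp (f x) \<partial>\<nu>) / Z"
      by (rule first_variation[OF c])
    also have "(\<integral>x. (exp (- f x) * x ^ k) * exp (f x) \<partial>\<nu>) = moments \<nu> k"
      unfolding moments_def by (intro Bochner_Integration.integral_cong refl) (simp add: exp_minus)
    finally show ?thesis .
  qed
  interpret rho': prob_space \<rho>' using M1_D[OF M(3)] by simp
  \<comment> \<open>Both measures have total mass 1, so the case \<open>k = 0\<close> fixes the
    normalisation.\<close>
  have "Z = 1" using mom[of 0] Z by (simp add: moments_def nu.prob_space rho'.prob_space)
  then show ?thesis using mom by (intro ext) simp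
qed

section \<open>Continuous densities and hat functions\<close>

lemma continuous_density:
  assumes \<nu>: "\<nu> \<in> M1" and p: "continuous_on {0..1} p" and pos: "\<And>x. x \<in> {0..1} \<Longrightarrow> 0 < p x"
    and one: "integral\<^sup>L \<nu> p = 1"
  shows "density \<nu> (\<lambda>x. ennreal (p x)) \<in> M1"
    and "continuous_on {0..1} h \<Longrightarrow> (\<integral>x. h x \<partial>density \<nu> (\<lambda>x. ennreal (p x))) = (\<integral>x. p x * h x \<partial>\<nu>)"
proof -
  have m: "f \<in> borel_measurable \<nu>" if "continuous_on {0..1} f" for f :: "real \<Rightarrow> real"
    by (intro M1_measurable[OF \<nu>] continuous_unit_measurable that)
  have ae: "AE x in \<nu>. 0 \<le> p x" using pos M1_D(3)[OF \<nu>] by (intro AE_I2) (simp add: less_imp_le)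
  have "(\<integral>\<^sup>+x. ennreal (p x) \<partial>\<nu>) = ennreal (integral\<^sup>L \<nu> p)"
    by (intro nn_integral_eq_integral M1_integrable_continuous[OF \<nu> p] ae)
  then have "prob_space (density \<nu> (\<lambda>x. ennreal (p x)))"
    using m[OF p] one by (intro prob_spaceI) (simp add: emeasure_density cong: nn_integral_cong)
  then show "density \<nu> (\<lambda>x. ennreal (p x)) \<in> M1"
    using M1_D(2)[OF \<nu>] by (simp add: space_prob_algebra)
  show "(\<integral>x. h x \<partial>density \<nu> (\<lambda>x. ennreal (p x))) = (\<integral>x. p x * h x \<partial>\<nu>)" if "continuous_on {0..1} h"
    using integral_density[OF m[OF that] m[OF p] ae] by simp
qed

definition clamp01 :: "real \<Rightarrow> real" where
  "clamp01 y = max 0 (min 1 y)"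

text \<open>The hat function with peak at \<open>i / N\<close>, written as a difference of clamped ramps so that
  the sum over all \<open>i\<close> telescopes.\<close>

definition hat :: "nat \<Rightarrow> nat \<Rightarrow> real \<Rightarrow> real" where
  "hat N i x = clamp01 (real N * x - real i + 1) - clamp01 (real N * x - real i)"

lemma continuous_on_hat [continuous_intros]: "continuous_on A (hat N i)"
  unfolding hat_def[abs_def] clamp01_def by (intro continuous_intros)

lemma hat_nonneg: "0 \<le> hat N i x"
  by (auto simp: hat_def clamp01_def)

lemma hat_support: "hat N i x \<noteq> 0 \<Longrightarrow> \<bar>real N * x - real i\<bar> \<le> 1"
  by (auto simp: hat_def clamp01_def split: if_splits)

lemma sum_hat:
  assumes "x \<in> {0..1}" shows "(\<Sum>i\<le>N. hat N i x) = 1"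
proof -
  have "(\<Sum>i<Suc n. hat N i x) = clamp01 (real N * x + 1) - clamp01 (real N * x + 1 - real (Suc n))" for n
    by (induction n) (auto simp: hat_def algebra_simps)
  from this[of N] have "(\<Sum>i\<le>N. hat N i x) = clamp01 (real N * x + 1) - clamp01 (real N * x - real N)"
    by (simp add: lessThan_Suc_atMost)
  moreover have "0 \<le> real N * x" "real N * x \<le> real N" using assms by (auto simp: mult_left_le)
  ultimately show ?thesis by (simp add: clamp01_def)
qed

text \<open>For \<open>N > 0\<close>, the piecewise linear interpolation on the unit interval of the
  values \<open>c i\<close> at the points \<open>i / N\<close>.\<close>

definition hat_sum :: "nat \<Rightarrow> (nat \<Rightarrow> real) \<Rightarrow> real \<Rightarrow> real" where
  "hat_sum N c x = (\<Sum>i\<le>N. c i * hat N i x)"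

lemma continuous_on_hat_sum [continuous_intros]: "continuous_on A (hat_sum N c)"
  unfolding hat_sum_def[abs_def] by (intro continuous_intros)

lemma hat_sum_pos:
  assumes c: "\<And>i. 0 < c i" and x: "x \<in> {0..1}" shows "0 < hat_sum N c x"
proof -
  have "\<exists>i\<le>N. hat N i x \<noteq> 0" using sum_hat[OF x, of N] by (metis atMost_iff sum.neutral zero_neq_one)
  then obtain i where i: "i \<le> N" "0 < c i * hat N i x" using c hat_nonneg[of N _ x] by (auto simp: less_le)
  show ?thesis unfolding hat_sum_def
    by (rule sum_pos2[of _ i]) (use i mult_nonneg_nonneg[OF less_imp_le[OF c] hat_nonneg] in auto)
qed

lemma integral_hat_sum:
  assumes "\<nu> \<in> M1" shows "integral\<^sup>L \<nu> (hat_sum N c) = (\<Sum>i\<le>N. c i * integral\<^sup>L \<nu> (hat N i))"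
proof -
  have "integrable \<nu> (hat N i)" for i by (intro M1_integrable_continuous[OF assms] continuous_on_hat)
  then show ?thesis unfolding hat_sum_def[abs_def] by simp
qed

lemma hat_sum_minus_const: "x \<in> {0..1} \<Longrightarrow> (\<Sum>i\<le>N. (c i - r) * hat N i x) = hat_sum N c x - r"
  by (simp add: hat_sum_def left_diff_distrib sum_subtractf sum_hat flip: sum_distrib_left)

text \<open>Jensen's inequality for the convex weights \<open>hat N i x\<close>: the tangents of the
  exponential at the mean value are summed, and their linear parts average to 0.\<close>

lemma exp_hat_sum_le:
  assumes x: "x \<in> {0..1}" shows "exp (hat_sum N c x) \<le> hat_sum N (\<lambda>i. exp (c i)) x"
proof -
  let ?F = "hat_sum N c x"
  have "exp ?F * (1 + (c i - ?F)) \<le> exp (c i)" for i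
  proof -
    have "exp ?F * (1 + (c i - ?F)) \<le> exp ?F * exp (c i - ?F)" by (intro mult_left_mono exp_ge_add_one_self) auto
    then show ?thesis by (simp add: exp_add[symmetric])
  qed
  then have "(\<Sum>i\<le>N. exp ?F * (1 + (c i - ?F)) * hat N i x) \<le> hat_sum N (\<lambda>i. exp (c i)) x"
    unfolding hat_sum_def by (intro sum_mono mult_right_mono hat_nonneg)
  moreover have "(\<Sum>i\<le>N. exp ?F * (1 + (c i - ?F)) * hat N i x) = exp ?F * ((\<Sum>i\<le>N. hat N i x) + (\<Sum>i\<le>N. (c i - ?F) * hat N i x))"
    by (simp add: sum_distrib_left sum.distrib[symmetric] algebra_simps)
  ultimately show ?thesis by (simp add: sum_hat[OF x] hat_sum_minus_const[OF x])
qed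

lemma hat_sum_ln_le:
  assumes c: "\<And>i. 0 < c i" and x: "x \<in> {0..1}"
  shows "hat_sum N (\<lambda>i. ln (c i)) x \<le> ln (hat_sum N c x)"
proof -
  have "exp (hat_sum N (\<lambda>i. ln (c i)) x) \<le> hat_sum N c x"
    using exp_hat_sum_le[OF x, of N "\<lambda>i. ln (c i)"] c by simp
  then show ?thesis using hat_sum_pos[OF c x] by (simp add: ln_ge_iff)
qed

text \<open>The log-sum inequality, the source of data processing. Each summand is bounded below by
  a tangent, and the correction terms \<open>c i - d i * (?p / ?q)\<close> cancel in the weighted
  sum.\<close>

lemma hat_log_sum:
  assumes c: "\<And>i. 0 < c i" and d: "\<And>i. 0 < d i" and x: "x \<in> {0..1}"
  shows "hat_sum N c x * (ln (hat_sum N c x) - ln (hat_sum N d x)) \<le> hat_sum N (\<lambda>i. c i * ln (c i / d i)) x"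
proof -
  let ?p = "hat_sum N c x" and ?q = "hat_sum N d x"
  have p: "0 < ?p" "0 < ?q" by (rule hat_sum_pos[OF c x], rule hat_sum_pos[OF d x])
  have "c i * (ln ?p - ln ?q) + (c i - d i * (?p / ?q)) \<le> c i * ln (c i / d i)" for i
  proof -
    have "ln ((d i * ?p) / (c i * ?q)) \<le> (d i * ?p) / (c i * ?q) - 1"
      using p c[of i] d[of i] by (intro ln_le_minus_one) simp
    then have "ln (d i) + ln ?p - ln (c i) - ln ?q \<le> (d i * ?p) / (c i * ?q) - 1"
      using p c[of i] d[of i] by (simp add: ln_div ln_mult)
    then have "c i * (ln (d i) + ln ?p - ln (c i) - ln ?q) \<le> c i * ((d i * ?p) / (c i * ?q) - 1)"
      using c[of i] by (intro mult_left_mono) auto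
    moreover have "c i * ((d i * ?p) / (c i * ?q) - 1) = d i * (?p / ?q) - c i" using c[of i] p by (simp add: field_simps)
    moreover have l: "ln (c i / d i) = ln (c i) - ln (d i)" using c[of i] d[of i] by (simp add: ln_div)
    ultimately show ?thesis unfolding l by (simp add: algebra_simps)
  qed
  then have "(\<Sum>i\<le>N. (c i * (ln ?p - ln ?q) + (c i - d i * (?p / ?q))) * hat N i x) \<le> hat_sum N (\<lambda>i. c i * ln (c i / d i)) x"
    unfolding hat_sum_def by (intro sum_mono mult_right_mono hat_nonneg)
  moreover have eq: "(\<Sum>i\<le>N. (c i * L + (c i - d i * R)) * hat N i x) = L * ?p + (?p - R * ?q)" for L R
    by (simp add: hat_sum_def sum_distrib_left sum.distrib sum_subtractf algebra_simps)
  ultimately have "(ln ?p - ln ?q) * ?p + (?p - (?p / ?q) * ?q) \<le> hat_sum N (\<lambda>i. c i * ln (c i / d i)) x"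
    by (simp only: eq)
  then show ?thesis using p by (simp add: mult.commute)
qed

section \<open>Comparison of null cells\<close>

text \<open>Here the support condition stands in for absolute continuity: a nonnegative continuous
  function with \<open>\<nu>\<^sub>0\<close>-integral 0 vanishes on the whole support of
  \<open>\<nu>\<^sub>0\<close>.\<close>

lemma integral_eq_0_if_concentrated_supp:
  assumes M: "\<nu>\<^sub>0 \<in> M1" "\<nu> \<in> concentrated (supp \<nu>\<^sub>0)"
    and h: "continuous_on UNIV h" "\<And>x. 0 \<le> h x" and z: "integral\<^sup>L \<nu>\<^sub>0 h = 0"
  shows "integral\<^sup>L \<nu> (h :: real \<Rightarrow> real) = 0"
proof -
  have h01: "continuous_on {0..1} h" by (rule continuous_on_subset[OF h(1)]) simp
  have \<nu>: "\<nu> \<in> M1" "emeasure \<nu> (supp \<nu>\<^sub>0) = 1" using M(2) by (auto simp: concentrated_def)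
  interpret nu: prob_space \<nu> using M1_D[OF \<nu>(1)] by simp
  have ae: "AE x in \<nu>\<^sub>0. h x = 0"
    using z h integral_nonneg_eq_0_iff_AE[OF M1_integrable_continuous[OF M(1) h01]] by simp
  have zero: "h x = 0" if x: "x \<in> supp \<nu>\<^sub>0" for x
  proof (rule ccontr)
    assume "h x \<noteq> 0"
    then have hx: "0 < h x" using h(2)[of x] by simp
    have op: "open {y. 0 < h y}" by (intro open_Collect_less continuous_on_const h(1))
    have "\<forall>U. open U \<and> x \<in> U \<longrightarrow> 0 < emeasure \<nu>\<^sub>0 (U \<inter> {0..1})"
      using x[unfolded supp_def mem_Collect_eq] by (rule conjunct2)
    from this[rule_format, of "{y. 0 < h y}"] op hx
    have "0 < emeasure \<nu>\<^sub>0 ({y. 0 < h y} \<inter> {0..1})" by simp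
    moreover have A: "{y. 0 < h y} \<inter> {0..1} \<in> sets \<nu>\<^sub>0"
      using open_Int_unit_borel[OF op] M1_D(2)[OF M(1)] by simp
    have "AE x in \<nu>\<^sub>0. x \<notin> {y. 0 < h y} \<inter> {0..1}" using ae by eventually_elim simp
    then have "{y. 0 < h y} \<inter> {0..1} \<in> null_sets \<nu>\<^sub>0" unfolding AE_iff_null_sets[OF A] .
    ultimately show False by (simp add: null_sets_def)
  qed
  have "AE x in \<nu>. x \<in> supp \<nu>\<^sub>0"
    using \<nu>(2) closed_in_unit_borel[OF closed_supp supp_subset] M1_D(2)[OF \<nu>(1)]
    by (intro nu.AE_prob_1) (simp add: nu.emeasure_eq_measure)
  then have "AE x in \<nu>. h x = 0" by eventually_elim (rule zero)
  then have "integral\<^sup>L \<nu> h = integral\<^sup>L \<nu> (\<lambda>_. 0)"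
    by (intro integral_cong_AE M1_measurable[OF \<nu>(1)] continuous_unit_measurable h01) auto
  then show ?thesis by simp
qed

lemma integral_eq_0_if_absolutely_continuous:
  assumes M: "\<rho> \<in> M1" "\<nu> \<in> M1" and ac: "absolutely_continuous \<nu> \<rho>"
    and h: "continuous_on {0..1} h" "\<And>x. 0 \<le> h x" and z: "integral\<^sup>L \<nu> h = 0"
  shows "integral\<^sup>L \<rho> (h :: real \<Rightarrow> real) = 0"
proof -
  have "AE x in \<nu>. h x = 0"
    using z h integral_nonneg_eq_0_iff_AE[OF M1_integrable_continuous[OF M(2) h(1)]] by simp
  then have "AE x in \<rho>. h x = 0"
    using M1_D(2)[OF M(1)] M1_D(2)[OF M(2)] by (intro absolutely_continuous_AE[OF _ ac]) auto
  then have "integral\<^sup>L \<rho> h = integral\<^sup>L \<rho> (\<lambda>_. 0)"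
    by (intro integral_cong_AE M1_measurable[OF M(1)] continuous_unit_measurable h) auto
  then show ?thesis by simp
qed

text \<open>Cell masses of the two measures vanish together, one direction being assumed and the
  other following from the supports, so their ratios are finite and positive.\<close>

lemma hat_ratio:
  assumes M: "\<nu>\<^sub>0 \<in> M1" "\<nu> \<in> concentrated (supp \<nu>\<^sub>0)"
    and z: "\<And>i. integral\<^sup>L \<nu> (hat N i) = 0 \<Longrightarrow> integral\<^sup>L \<nu>\<^sub>0 (hat N i) = 0"
  obtains c where "\<And>i. 0 < c i" "\<And>i. integral\<^sup>L \<nu> (hat N i) = c i * integral\<^sup>L \<nu>\<^sub>0 (hat N i)"
proof
  \<comment> \<open>A cell that is null for \<open>\<nu>\<^sub>0\<close> is null for \<nu> as well,
    so the ratio there is free; the value 1 keeps it positive.\<close>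
  let ?c = "\<lambda>i. if integral\<^sup>L \<nu>\<^sub>0 (hat N i) = 0 then 1 else integral\<^sup>L \<nu> (hat N i) / integral\<^sup>L \<nu>\<^sub>0 (hat N i)"
  have nn: "0 \<le> integral\<^sup>L \<rho> (hat N i)" for \<rho> i by (intro integral_nonneg_AE AE_I2 hat_nonneg)
  show "0 < ?c i" for i
    using nn[of \<nu> i] nn[of \<nu>\<^sub>0 i] z[of i] by (auto intro!: divide_pos_pos simp: less_le)
  show "integral\<^sup>L \<nu> (hat N i) = ?c i * integral\<^sup>L \<nu>\<^sub>0 (hat N i)" for i
    using integral_eq_0_if_concentrated_supp[OF M continuous_on_hat hat_nonneg, of N i] by simp
qed

text \<open>Smoothing by hat functions replaces the three measures by measures with continuous
  densities without increasing the two entropies (data processing).\<close>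

lemma hat_smoothing:
  assumes M: "\<nu>\<^sub>0 \<in> M1" "\<nu> \<in> M1" "\<mu> \<in> M1"
    and c: "\<And>i. 0 < c i" "\<And>i. integral\<^sup>L \<nu> (hat N i) = c i * integral\<^sup>L \<nu>\<^sub>0 (hat N i)"
    and d: "\<And>i. 0 < d i" "\<And>i. integral\<^sup>L \<mu> (hat N i) = d i * integral\<^sup>L \<nu>\<^sub>0 (hat N i)"
    and ab: "0 \<le> a" "0 \<le> b"
    and rate: "\<And>f g. continuous_on {0..1} f \<Longrightarrow> continuous_on {0..1} g \<Longrightarrow> joint_rate a b \<nu>\<^sub>0 f g \<nu> \<mu> \<le> r"
  obtains f g \<nu>' \<mu>' where "continuous_on {0..1} f" "continuous_on {0..1} g" "\<nu>' \<in> M1" "\<mu>' \<in> M1"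
    "\<forall>h. continuous_on {0..1} h \<longrightarrow> integral\<^sup>L \<nu>' h = (\<integral>x. exp (- f x) * h x \<partial>\<nu>\<^sub>0)"
    "\<forall>h. continuous_on {0..1} h \<longrightarrow> integral\<^sup>L \<mu>' h = (\<integral>x. exp (- g x) * h x \<partial>\<nu>')"
    "\<forall>h. continuous_on {0..1} h \<longrightarrow> integral\<^sup>L \<mu>' h = (\<integral>x. hat_sum N d x * h x \<partial>\<nu>\<^sub>0)"
    "joint_rate a b \<nu>\<^sub>0 f g \<nu>' \<mu>' \<le> r"
proof -
  have one: "(\<Sum>i\<le>N. integral\<^sup>L \<rho> (hat N i)) = 1" if "\<rho> \<in> M1" for \<rho>
  proof -
    interpret prob_space \<rho> using M1_D[OF that] by simp
    have "(\<Sum>i\<le>N. integral\<^sup>L \<rho> (hat N i)) = integral\<^sup>L \<rho> (hat_sum N (\<lambda>_. 1))"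
      by (simp add: integral_hat_sum[OF that])
    also have "\<dots> = (\<integral>x. 1 \<partial>\<rho>)"
      using M1_D(3)[OF that] sum_hat[of _ N] by (intro Bochner_Integration.integral_cong) (auto simp: hat_sum_def)
    finally show ?thesis by (simp add: prob_space)
  qed
  let ?p = "hat_sum N c" and ?q = "hat_sum N d"
  have pos: "0 < ?p x" "0 < ?q x" if "x \<in> {0..1}" for x
    by (rule hat_sum_pos[OF c(1) that], rule hat_sum_pos[OF d(1) that])
  have p1: "integral\<^sup>L \<nu>\<^sub>0 ?p = 1" by (simp add: integral_hat_sum[OF M(1)] c(2)[symmetric] one[OF M(2)])
  have q1: "integral\<^sup>L \<nu>\<^sub>0 ?q = 1" by (simp add: integral_hat_sum[OF M(1)] d(2)[symmetric] one[OF M(3)])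
  define \<nu>' where "\<nu>' = density \<nu>\<^sub>0 (\<lambda>x. ennreal (?p x))"
  define \<mu>' where "\<mu>' = density \<nu>\<^sub>0 (\<lambda>x. ennreal (?q x))"
  have M': "\<nu>' \<in> M1" "\<mu>' \<in> M1"
  proof -
    show "\<nu>' \<in> M1"
      unfolding \<nu>'_def by (rule continuous_density(1)[OF M(1) continuous_on_hat_sum pos(1) p1])
    show "\<mu>' \<in> M1"
      unfolding \<mu>'_def by (rule continuous_density(1)[OF M(1) continuous_on_hat_sum pos(2) q1])
  qed
  have int\<nu>': "integral\<^sup>L \<nu>' h = (\<integral>x. ?p x * h x \<partial>\<nu>\<^sub>0)" if "continuous_on {0..1} h" for h
    unfolding \<nu>'_def by (rule continuous_density(2)[OF M(1) continuous_on_hat_sum pos(1) p1 that])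
  have int\<mu>': "integral\<^sup>L \<mu>' h = (\<integral>x. ?q x * h x \<partial>\<nu>\<^sub>0)" if "continuous_on {0..1} h" for h
    unfolding \<mu>'_def by (rule continuous_density(2)[OF M(1) continuous_on_hat_sum pos(2) q1 that])
  \<comment> \<open>Forced by the requirement that \<open>exp (- f)\<close> be the density of
    \<open>\<nu>'\<close> relative to \<open>\<nu>\<^sub>0\<close> and \<open>exp (- g)\<close> that
    of \<open>\<mu>'\<close> relative to \<open>\<nu>'\<close>.\<close>
  define f where "f x = - ln (?p x)" for x
  define g where "g x = ln (?p x) - ln (?q x)" for x
  have f: "continuous_on {0..1} f" and g: "continuous_on {0..1} g"
    unfolding f_def g_def using pos by (auto intro!: continuous_intros simp: less_imp_neq[THEN not_sym])
  have cong: "(\<integral>x. u x \<partial>\<rho>) = (\<integral>x. v x \<partial>\<rho>)" if "\<rho> \<in> M1" "\<And>x. x \<in> {0..1} \<Longrightarrow> u x = v x" for \<rho> and u v :: "real \<Rightarrow> real"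
    using M1_D(3)[OF that(1)] that(2) by (intro Bochner_Integration.integral_cong) auto
  have ef: "exp (- f x) = ?p x" and eg: "exp (- g x) = ?q x / ?p x" and ef': "exp (f x) = 1 / ?p x" and eg': "exp (g x) = ?p x / ?q x"
    if "x \<in> {0..1}" for x
    using pos[OF that] by (simp_all add: f_def g_def exp_diff exp_minus inverse_eq_divide)
  have tilt1: "integral\<^sup>L \<nu>' h = (\<integral>x. exp (- f x) * h x \<partial>\<nu>\<^sub>0)" if "continuous_on {0..1} h" for h
    unfolding int\<nu>'[OF that] by (rule cong[OF M(1)]) (simp add: ef)
  have tilt2: "integral\<^sup>L \<mu>' h = (\<integral>x. exp (- g x) * h x \<partial>\<nu>')" if h: "continuous_on {0..1} h" for h
  proof -
    have "continuous_on {0..1} (\<lambda>x. exp (- g x) * h x)" by (intro continuous_intros g h)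
    from int\<nu>'[OF this] have "(\<integral>x. exp (- g x) * h x \<partial>\<nu>') = (\<integral>x. ?p x * (exp (- g x) * h x) \<partial>\<nu>\<^sub>0)" .
    also have "\<dots> = (\<integral>x. ?q x * h x \<partial>\<nu>\<^sub>0)"
    proof (rule cong[OF M(1)])
      fix x :: real assume x: "x \<in> {0..1}"
      show "?p x * (exp (- g x) * h x) = ?q x * h x" using pos(1)[OF x] by (simp add: eg[OF x])
    qed
    finally show ?thesis by (simp only: int\<mu>'[OF h])
  qed
  \<comment> \<open>Test functions for the original pair that interpolate the logarithms of the cell
    ratios. Their values of \<open>gibbs\<close> dominate those of the smoothed pair and are
    controlled by \<open>rate\<close>.\<close>
  define F where "F = hat_sum N (\<lambda>i. ln (1 / c i))"
  define G where "G = hat_sum N (\<lambda>i. ln (c i / d i))"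
  have FG: "continuous_on {0..1} F" "continuous_on {0..1} G" unfolding F_def G_def by (rule continuous_on_hat_sum)+
  \<comment> \<open>By Jensen's inequality the exponential of the interpolated logarithms is at most
    the interpolation of the \<open>w i\<close> themselves, whose integral is 1.\<close>
  have normalised: "ln (\<integral>x. exp (hat_sum N (\<lambda>i. ln (w i)) x) \<partial>\<rho>) \<le> 0"
    if \<rho>: "\<rho> \<in> M1" and w: "\<And>i. 0 < w i" and s: "(\<Sum>i\<le>N. w i * integral\<^sup>L \<rho> (hat N i)) = 1" for \<rho> w
  proof -
    let ?e = "\<lambda>x. exp (hat_sum N (\<lambda>i. ln (w i)) x)"
    have e: "continuous_on {0..1} ?e" by (intro continuous_intros)
    have "(\<integral>x. ?e x \<partial>\<rho>) \<le> integral\<^sup>L \<rho> (hat_sum N w)"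
    proof (rule integral_mono)
      show "integrable \<rho> ?e" "integrable \<rho> (hat_sum N w)"
        by (intro M1_integrable_continuous[OF \<rho>] e continuous_on_hat_sum)+
      show "?e x \<le> hat_sum N w x" if "x \<in> space \<rho>" for x
        using exp_hat_sum_le[of x N "\<lambda>i. ln (w i)"] that M1_D(3)[OF \<rho>] w by simp
    qed
    also have "\<dots> = 1" by (simp add: integral_hat_sum[OF \<rho>] s)
    finally show ?thesis using M1_integral_pos[OF \<rho> e] by simp
  qed
  have "gibbs \<nu>\<^sub>0 \<nu>' f \<le> gibbs \<nu>\<^sub>0 \<nu> F"
  proof -
    have "(\<integral>x. exp (f x) \<partial>\<nu>') = (\<integral>x. ?p x * exp (f x) \<partial>\<nu>\<^sub>0)" by (intro int\<nu>' continuous_intros f)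
    also have "\<dots> = (\<integral>x. 1 \<partial>\<nu>\<^sub>0)"
    proof (rule cong[OF M(1)])
      show "?p x * exp (f x) = 1" if "x \<in> {0..1}" for x using pos(1)[OF that] by (simp add: ef'[OF that])
    qed
    also have "\<dots> = 1" using prob_space.prob_space[OF M1_D(1)[OF M(1)]] by simp
    finally have z: "ln (\<integral>x. exp (f x) \<partial>\<nu>') = 0" by simp
    have "integral\<^sup>L \<nu>\<^sub>0 f \<le> integral\<^sup>L \<nu>\<^sub>0 F"
    proof (rule integral_mono)
      show "f x \<le> F x" if "x \<in> space \<nu>\<^sub>0" for x
      proof -
        have "F x = - hat_sum N (\<lambda>i. ln (c i)) x"
        proof -
          have "ln (1 / c i) = - ln (c i)" for i using c(1)[of i] by (simp add: ln_div)
          then show ?thesis unfolding F_def hat_sum_def by (simp add: sum_negf)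
        qed
        then show ?thesis
          using hat_sum_ln_le[of c x N] c(1) that M1_D(3)[OF M(1)] by (simp add: f_def)
      qed
    qed (intro M1_integrable_continuous[OF M(1)] f FG)+
    moreover have "ln (\<integral>x. exp (F x) \<partial>\<nu>) \<le> 0"
      unfolding F_def
    proof (rule normalised[OF M(2)])
      show "(\<Sum>i\<le>N. 1 / c i * integral\<^sup>L \<nu> (hat N i)) = 1"
        using c(1) one[OF M(1)] by (simp add: c(2) less_imp_neq[THEN not_sym])
    qed (use c in simp)
    ultimately show ?thesis using z by (simp add: gibbs_def)
  qed
  moreover have "gibbs \<nu>' \<mu>' g \<le> gibbs \<nu> \<mu> G"
  proof -
    have "(\<integral>x. exp (g x) \<partial>\<mu>') = (\<integral>x. ?q x * exp (g x) \<partial>\<nu>\<^sub>0)" by (intro int\<mu>' continuous_intros g)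
    also have "\<dots> = integral\<^sup>L \<nu>\<^sub>0 ?p"
    proof (rule cong[OF M(1)])
      show "?q x * exp (g x) = ?p x" if "x \<in> {0..1}" for x using pos(2)[OF that] by (simp add: eg'[OF that])
    qed
    finally have z: "ln (\<integral>x. exp (g x) \<partial>\<mu>') = 0" by (simp add: p1)
    have "integral\<^sup>L \<nu>' g = (\<integral>x. ?p x * g x \<partial>\<nu>\<^sub>0)" by (rule int\<nu>'[OF g])
    also have "\<dots> \<le> integral\<^sup>L \<nu>\<^sub>0 (hat_sum N (\<lambda>i. c i * ln (c i / d i)))"
    proof (rule integral_mono)
      show "?p x * g x \<le> hat_sum N (\<lambda>i. c i * ln (c i / d i)) x" if "x \<in> space \<nu>\<^sub>0" for x
        using hat_log_sum[of c d x N] c(1) d(1) that M1_D(3)[OF M(1)] by (simp add: g_def)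
    qed (intro M1_integrable_continuous[OF M(1)] continuous_on_mult g continuous_on_hat_sum)+
    also have "\<dots> = integral\<^sup>L \<nu> G"
      unfolding G_def integral_hat_sum[OF M(1)] integral_hat_sum[OF M(2)] by (simp add: c(2) mult_ac)
    finally have "integral\<^sup>L \<nu>' g \<le> integral\<^sup>L \<nu> G" .
    moreover have "ln (\<integral>x. exp (G x) \<partial>\<mu>) \<le> 0"
      unfolding G_def
    proof (rule normalised[OF M(3)])
      have "c i / d i * integral\<^sup>L \<mu> (hat N i) = integral\<^sup>L \<nu> (hat N i)" for i
        using d(1)[of i] by (simp add: c(2) d(2))
      then show "(\<Sum>i\<le>N. c i / d i * integral\<^sup>L \<mu> (hat N i)) = 1" using one[OF M(2)] by simp
    qed (use c d in simp)
    ultimately show ?thesis using z by (simp add: gibbs_def)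
  qed
  ultimately have "joint_rate a b \<nu>\<^sub>0 f g \<nu>' \<mu>' \<le> joint_rate a b \<nu>\<^sub>0 F G \<nu> \<mu>"
    unfolding joint_rate_def using ab by (intro add_mono mult_left_mono)
  also have "\<dots> \<le> r" by (rule rate[OF FG])
  finally have le: "joint_rate a b \<nu>\<^sub>0 f g \<nu>' \<mu>' \<le> r" .
  show thesis by (rule that[OF f g M' _ _ _ le]) (intro allI impI, fact tilt1 tilt2 int\<mu>')+
qed

text \<open>Both measures split into pieces, the \<open>i\<close>-th having the same mass in both
  and lying within \<open>1 / N\<close> of \<open>i / N\<close>. Replacing \<open>x ^ k\<close> by
  its value at \<open>i / N\<close> on the \<open>i\<close>-th piece costs at most
  \<open>k / N\<close> in either measure and leads to the same sum.\<close>

lemma moments_hat_approx: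
  assumes M: "\<nu>\<^sub>0 \<in> M1" "\<mu> \<in> M1" "\<mu>' \<in> M1" and N: "0 < N"
    and d: "\<And>i. 0 < d i" "\<And>i. integral\<^sup>L \<mu> (hat N i) = d i * integral\<^sup>L \<nu>\<^sub>0 (hat N i)"
    and \<mu>': "\<And>h. continuous_on {0..1} h \<Longrightarrow> integral\<^sup>L \<mu>' h = (\<integral>x. hat_sum N d x * h x \<partial>\<nu>\<^sub>0)"
  shows "\<bar>moments \<mu>' k - moments \<mu> k\<bar> \<le> 2 * real k / real N"
proof -
  have close: "\<bar>x ^ k - (real i / real N) ^ k\<bar> * hat N i x \<le> real k / real N * hat N i x"
    if x: "x \<in> {0..1}" and i: "i \<le> N" for x i
  proof (cases "hat N i x = 0")
    case False
    then have "\<bar>real N * x - real i\<bar> \<le> 1" by (rule hat_support)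
    then have "\<bar>real N * x - real i\<bar> / real N \<le> 1 / real N" by (intro divide_right_mono) auto
    then have "\<bar>(real N * x - real i) / real N\<bar> \<le> 1 / real N" by (simp add: abs_divide)
    then have c: "\<bar>x - real i / real N\<bar> \<le> 1 / real N" using N by (simp add: diff_divide_distrib)
    have "norm (x ^ k - (real i / real N) ^ k) \<le> real k * norm (x - real i / real N)"
      using x i N by (intro norm_power_diff) auto
    also have "\<dots> \<le> real k * (1 / real N)" using c by (intro mult_left_mono) auto
    finally show ?thesis by (intro mult_right_mono hat_nonneg) simp
  qed simp
  let ?s = "hat_sum N (\<lambda>i. (real i / real N) ^ k)"
  let ?sd = "hat_sum N (\<lambda>i. (real i / real N) ^ k * d i)"
  have "\<bar>moments \<mu> k - integral\<^sup>L \<mu> ?s\<bar> \<le> real k / real N"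
    unfolding moments_def
  proof (rule M1_integral_dist_le[OF M(2)])
    fix x :: real assume x: "x \<in> {0..1}"
    have "x ^ k - ?s x = (\<Sum>i\<le>N. (x ^ k - (real i / real N) ^ k) * hat N i x)"
      unfolding hat_sum_def using sum_hat[OF x, of N]
      by (simp add: left_diff_distrib sum_subtractf flip: sum_distrib_left)
    also have "\<bar>\<dots>\<bar> \<le> (\<Sum>i\<le>N. \<bar>x ^ k - (real i / real N) ^ k\<bar> * hat N i x)"
      by (rule order.trans[OF sum_abs]) (simp add: abs_mult hat_nonneg)
    also have "\<dots> \<le> (\<Sum>i\<le>N. real k / real N * hat N i x)"
      by (intro sum_mono close x) simp
    also have "\<dots> = real k / real N" unfolding sum_distrib_left[symmetric] sum_hat[OF x] by simp
    finally show "\<bar>x ^ k - ?s x\<bar> \<le> real k / real N" .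
  qed (intro continuous_intros)+
  moreover have "\<bar>moments \<mu>' k - integral\<^sup>L \<nu>\<^sub>0 ?sd\<bar> \<le> real k / real N"
  proof -
    have cx: "continuous_on {0..1} (\<lambda>x::real. x ^ k)" by (intro continuous_intros)
    have "moments \<mu>' k = (\<integral>x. hat_sum N d x * x ^ k \<partial>\<nu>\<^sub>0)"
      unfolding moments_def by (rule \<mu>'[OF cx])
    then have "moments \<mu>' k - integral\<^sup>L \<nu>\<^sub>0 ?sd = (\<integral>x. hat_sum N d x * x ^ k - ?sd x \<partial>\<nu>\<^sub>0)"
      using M1_integrable_continuous[OF M(1), of "\<lambda>x. hat_sum N d x * x ^ k"] M1_integrable_continuous[OF M(1), of ?sd]
      by (simp add: continuous_intros)
    also have "\<bar>\<dots>\<bar> \<le> (\<integral>x. \<bar>hat_sum N d x * x ^ k - ?sd x\<bar> \<partial>\<nu>\<^sub>0)" by (rule integral_abs_bound)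
    also have "\<dots> \<le> (\<integral>x. real k / real N * hat_sum N d x \<partial>\<nu>\<^sub>0)"
    proof (rule integral_mono)
      show "integrable \<nu>\<^sub>0 (\<lambda>x. \<bar>hat_sum N d x * x ^ k - ?sd x\<bar>)" "integrable \<nu>\<^sub>0 (\<lambda>x. real k / real N * hat_sum N d x)"
        by (intro M1_integrable_continuous[OF M(1)] continuous_intros)+
      fix x assume "x \<in> space \<nu>\<^sub>0"
      then have x: "x \<in> {0..1}" using M1_D(3)[OF M(1)] by simp
      have "hat_sum N d x * x ^ k - ?sd x = (\<Sum>i\<le>N. d i * ((x ^ k - (real i / real N) ^ k) * hat N i x))"
        unfolding hat_sum_def by (simp add: sum_distrib_left sum_subtractf algebra_simps)
      also have "\<bar>\<dots>\<bar> \<le> (\<Sum>i\<le>N. d i * (\<bar>x ^ k - (real i / real N) ^ k\<bar> * hat N i x))"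
        using d(1) by (intro order.trans[OF sum_abs]) (simp add: abs_mult hat_nonneg less_imp_le abs_of_pos)
      also have "\<dots> \<le> (\<Sum>i\<le>N. d i * (real k / real N * hat N i x))"
        using d(1) by (intro sum_mono mult_left_mono close x) (auto simp: less_imp_le)
      also have "\<dots> = real k / real N * hat_sum N d x" by (simp add: hat_sum_def sum_distrib_left mult_ac)
      finally show "\<bar>hat_sum N d x * x ^ k - ?sd x\<bar> \<le> real k / real N * hat_sum N d x" .
    qed
    also have "\<dots> = real k / real N * integral\<^sup>L \<nu>\<^sub>0 (hat_sum N d)" by simp
    also have "integral\<^sup>L \<nu>\<^sub>0 (hat_sum N d) = 1"
      using \<mu>'[of "\<lambda>_. 1"] prob_space.prob_space[OF M1_D(1)[OF M(3)]] by simp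
    finally show ?thesis by simp
  qed
  moreover have "integral\<^sup>L \<nu>\<^sub>0 ?sd = integral\<^sup>L \<mu> ?s"
    unfolding integral_hat_sum[OF M(1)] integral_hat_sum[OF M(2)] by (simp add: d(2) mult.assoc)
  moreover have "2 * real k / real N = real k / real N + real k / real N" by simp
  ultimately show ?thesis by linarith
qed

text \<open>On finer and finer grids the moments of the smoothed measure converge to those of \<mu>,
  so it enters \<open>G\<close>. Closeness is asked of the second level alone; the first level
  carries the bound on the rate.\<close>

lemma smooth_tilt_approximation:
  assumes M: "\<nu>\<^sub>0 \<in> M1" "\<nu> \<in> concentrated (supp \<nu>\<^sub>0)" "\<mu> \<in> concentrated (supp \<nu>\<^sub>0)"
    and ac: "absolutely_continuous \<nu> \<nu>\<^sub>0" "absolutely_continuous \<mu> \<nu>" and ab: "0 \<le> a" "0 \<le> b"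
    and rate: "\<And>f g. continuous_on {0..1} f \<Longrightarrow> continuous_on {0..1} g \<Longrightarrow> joint_rate a b \<nu>\<^sub>0 f g \<nu> \<mu> \<le> r"
    and G: "openin weak_topology G" "\<mu> \<in> G"
  obtains f g \<nu>' \<mu>' where "continuous_on {0..1} f" "continuous_on {0..1} g" "\<nu>' \<in> M1" "\<mu>' \<in> G"
    "\<And>h. continuous_on {0..1} h \<Longrightarrow> integral\<^sup>L \<nu>' h = (\<integral>x. exp (- f x) * h x \<partial>\<nu>\<^sub>0)"
    "\<And>h. continuous_on {0..1} h \<Longrightarrow> integral\<^sup>L \<mu>' h = (\<integral>x. exp (- g x) * h x \<partial>\<nu>')"
    "joint_rate a b \<nu>\<^sub>0 f g \<nu>' \<mu>' \<le> r"
proof -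
  have M': "\<nu> \<in> M1" "\<mu> \<in> M1" using M by (auto simp: concentrated_def)
  \<comment> \<open>Null cells pass from \<mu> to \<nu> and from \<nu> to
    \<open>\<nu>\<^sub>0\<close> along the two absolute continuities; composed, they give the
    condition of \<open>hat_ratio\<close> for \<mu>.\<close>
  note z = integral_eq_0_if_absolutely_continuous[OF M(1) M'(1) ac(1) continuous_on_hat hat_nonneg]
    integral_eq_0_if_absolutely_continuous[OF M'(1,2) ac(2) continuous_on_hat hat_nonneg]
  define Q where "Q f g \<nu>' \<mu>' \<longleftrightarrow> continuous_on {0..1} f \<and> continuous_on {0..1} g \<and> \<nu>' \<in> M1 \<and> \<mu>' \<in> M1 \<and>
    (\<forall>h. continuous_on {0..1} h \<longrightarrow> integral\<^sup>L \<nu>' h = (\<integral>x. exp (- f x) * h x \<partial>\<nu>\<^sub>0)) \<and>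
    (\<forall>h. continuous_on {0..1} h \<longrightarrow> integral\<^sup>L \<mu>' h = (\<integral>x. exp (- g x) * h x \<partial>\<nu>')) \<and>
    joint_rate a b \<nu>\<^sub>0 f g \<nu>' \<mu>' \<le> r" for f g \<nu>' \<mu>'
  have "\<forall>n. \<exists>\<mu>'. (\<exists>f g \<nu>'. Q f g \<nu>' \<mu>') \<and> (\<forall>k. \<bar>moments \<mu>' k - moments \<mu> k\<bar> \<le> 2 * real k / real (Suc n))"
  proof
    fix n
    obtain c where c: "\<And>i. 0 < c i" "\<And>i. integral\<^sup>L \<nu> (hat (Suc n) i) = c i * integral\<^sup>L \<nu>\<^sub>0 (hat (Suc n) i)"
      using hat_ratio[OF M(1,2) z(1)] by metis
    obtain d where d: "\<And>i. 0 < d i" "\<And>i. integral\<^sup>L \<mu> (hat (Suc n) i) = d i * integral\<^sup>L \<nu>\<^sub>0 (hat (Suc n) i)"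
      using hat_ratio[OF M(1,3) z(1)[OF z(2)]] by metis
    obtain f g \<nu>' \<mu>' where 1: "continuous_on {0..1} f" "continuous_on {0..1} g" "\<nu>' \<in> M1" "\<mu>' \<in> M1"
      "\<forall>h. continuous_on {0..1} h \<longrightarrow> integral\<^sup>L \<nu>' h = (\<integral>x. exp (- f x) * h x \<partial>\<nu>\<^sub>0)"
      "\<forall>h. continuous_on {0..1} h \<longrightarrow> integral\<^sup>L \<mu>' h = (\<integral>x. exp (- g x) * h x \<partial>\<nu>')"
      "\<forall>h. continuous_on {0..1} h \<longrightarrow> integral\<^sup>L \<mu>' h = (\<integral>x. hat_sum (Suc n) d x * h x \<partial>\<nu>\<^sub>0)"
      "joint_rate a b \<nu>\<^sub>0 f g \<nu>' \<mu>' \<le> r"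
      using hat_smoothing[OF M(1) M' c d ab rate] .
    have "Q f g \<nu>' \<mu>'" unfolding Q_def by (intro conjI 1)
    moreover note moments_hat_approx[OF M(1) M'(2) 1(4) zero_less_Suc d 1(7)[rule_format]]
    ultimately show "\<exists>\<mu>'. (\<exists>f g \<nu>'. Q f g \<nu>' \<mu>') \<and>
      (\<forall>k. \<bar>moments \<mu>' k - moments \<mu> k\<bar> \<le> 2 * real k / real (Suc n))"
      by (intro exI[of _ \<mu>'] conjI exI allI)
  qed
  from choice[OF this] obtain \<mu>' where "\<forall>n. (\<exists>f g \<nu>'. Q f g \<nu>' (\<mu>' n)) \<and>
    (\<forall>k. \<bar>moments (\<mu>' n) k - moments \<mu> k\<bar> \<le> 2 * real k / real (Suc n))" ..
  then have A: "\<And>n. \<exists>f g \<nu>'. Q f g \<nu>' (\<mu>' n)"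
    "\<And>n k. \<bar>moments (\<mu>' n) k - moments \<mu> k\<bar> \<le> 2 * real k / real (Suc n)" by simp_all
  from openin_weak_iff_moments[THEN iffD1, OF G(1)]
  obtain V where V: "open V" "G = {\<mu> \<in> M1. moments \<mu> \<in> V}" by (elim exE conjE)
  have "(\<lambda>n. moments (\<mu>' n) k) \<longlonglongrightarrow> moments \<mu> k" for k
  proof (rule LIM_zero_cancel, rule Lim_null_comparison)
    show "eventually (\<lambda>n. norm (moments (\<mu>' n) k - moments \<mu> k) \<le> 2 * real k / real (Suc n)) sequentially"
      using A(2) by (intro always_eventually) simp
    show "(\<lambda>n. 2 * real k / real (Suc n)) \<longlonglongrightarrow> 0" by real_asymp
  qed
  then have "limitin (product_topology (\<lambda>_. euclideanreal) UNIV) (\<lambda>n. moments (\<mu>' n)) (moments \<mu>) sequentially"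
    by (auto simp: limitin_componentwise)
  then have "(\<lambda>n. moments (\<mu>' n)) \<longlonglongrightarrow> moments \<mu>" by (simp add: euclidean_product_topology)
  from topological_tendstoD[OF this V(1)] G(2) V(2)
  obtain n where "moments (\<mu>' n) \<in> V" by (auto simp: eventually_sequentially)
  moreover obtain f g \<nu>' where "Q f g \<nu>' (\<mu>' n)" using A(1)[of n] by (elim exE)
  note Q = this[unfolded Q_def]
  ultimately have "\<mu>' n \<in> G" using V(2) by simp
  with Q show thesis by (intro that[of f g \<nu>' "\<mu>' n"]) simp_all
qed

section \<open>The large deviation bounds\<close>

lemma rel_entropy_nonneg:
  assumes "\<nu> \<in> M1" "\<mu> \<in> M1" shows "0 \<le> rel_entropy \<nu> \<mu>"
proof (cases "rel_entropy \<nu> \<mu>")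
  case (real r)
  interpret mu: prob_space \<mu> using M1_D[OF assms(2)] by simp
  have "gibbs \<nu> \<mu> (\<lambda>_. 0) \<le> r" by (rule gibbs_le_rel_entropy[OF assms]) (auto simp: real)
  then show ?thesis using real by (simp add: gibbs_def mu.prob_space)
next
  case MInf
  then show ?thesis by (auto simp: rel_entropy_def split: if_splits)
qed simp

lemma rel_entropy_finite_D:
  assumes "rel_entropy \<nu> \<mu> < \<infinity>" shows "absolutely_continuous \<mu> \<nu>"
  using assms by (auto simp: rel_entropy_def split: if_splits)

section \<open>The limiting regime and the rate function\<close>

locale hdp_limit =
  fixes \<nu>\<^sub>0 :: "real measure" and c :: real and \<alpha> \<beta> :: "nat \<Rightarrow> real"
  assumes \<nu>\<^sub>0: "\<nu>\<^sub>0 \<in> M1" and c: "0 < c" and \<alpha>: "\<And>n. 0 < \<alpha> n" and \<beta>: "\<And>n. 0 < \<beta> n"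
    and \<alpha>_top: "filterlim \<alpha> at_top sequentially" and \<beta>_top: "filterlim \<beta> at_top sequentially"
    and ratio: "(\<lambda>n. \<alpha> n / \<beta> n) \<longlonglongrightarrow> c"
begin

abbreviation "a \<equiv> coeff_a c"
abbreviation "b \<equiv> coeff_b c"
abbreviation "S \<equiv> concentrated (supp \<nu>\<^sub>0)"
abbreviation "X \<equiv> joint_rate a b \<nu>\<^sub>0"
abbreviation "J \<equiv> rate_J c \<nu>\<^sub>0"
abbreviation "P n \<equiv> hierarchical_dirichlet_process (\<alpha> n) (\<beta> n) \<nu>\<^sub>0"

definition speed :: "nat \<Rightarrow> real" where "speed n = max (\<alpha> n) (\<beta> n)"

text \<open>The exponent whose exponential has mean exactly 1 for every \<open>n\<close>;
  \<open>X\<close> is its limit after division by the speed.\<close>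

definition tilt :: "nat \<Rightarrow> (real \<Rightarrow> real) \<Rightarrow> (real \<Rightarrow> real) \<Rightarrow> real measure \<Rightarrow> real measure \<Rightarrow> real" where
  "tilt n f g \<nu> \<mu> = \<alpha> n * gibbs \<nu>\<^sub>0 \<nu> f + \<beta> n * gibbs \<nu> \<mu> g"

lemma ab_pos: "0 < a" "0 < b"
  using c by (auto simp: coeff_a_def coeff_b_def)

lemma speed_pos: "0 < speed n"
  using \<alpha>[of n] by (simp add: speed_def less_max_iff_disj)

lemma speed_top: "filterlim speed at_top sequentially"
  by (rule filterlim_at_top_mono[OF \<alpha>_top]) (simp add: speed_def)

lemma ratio_lims: "(\<lambda>n. \<alpha> n / speed n) \<longlonglongrightarrow> a" "(\<lambda>n. \<beta> n / speed n) \<longlonglongrightarrow> b"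
proof -
  have 1: "\<alpha> n / speed n = (\<alpha> n / \<beta> n) / max (\<alpha> n / \<beta> n) 1" "\<beta> n / speed n = 1 / max (\<alpha> n / \<beta> n) 1" for n
    using \<alpha>[of n] \<beta>[of n] by (auto simp: speed_def max_def field_simps)
  \<comment> \<open>This form covers the three cases of the coefficients at once and is continuous
    in \<open>c\<close>.\<close>
  have 2: "a = c / max c 1" "b = 1 / max c 1" using c by (auto simp: coeff_a_def coeff_b_def max_def)
  show "(\<lambda>n. \<alpha> n / speed n) \<longlonglongrightarrow> a" "(\<lambda>n. \<beta> n / speed n) \<longlonglongrightarrow> b"
    unfolding 1 2 by (intro tendsto_intros ratio; simp)+
qed

lemma concentrated_iff: "\<mu> \<in> M1 \<Longrightarrow> \<mu> \<in> S \<longleftrightarrow> supp \<mu> \<subseteq> supp \<nu>\<^sub>0"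
  using supp_subset_iff[OF _ closed_supp supp_subset] by (simp add: concentrated_def)

lemma S_subset: "S \<subseteq> M1"
  by (auto simp: concentrated_def)

lemma \<nu>\<^sub>0_S: "\<nu>\<^sub>0 \<in> S"
  using concentrated_iff[OF \<nu>\<^sub>0] by simp

lemma closedin_S: "closedin weak_topology S"
proof (rule closedin_concentrated[OF closed_supp supp_subset])
  show "supp \<nu>\<^sub>0 \<noteq> {}" using emeasure_supp[OF \<nu>\<^sub>0] by (metis emeasure_empty zero_neq_one)
qed

text \<open>The supremum over \<open>(f, g)\<close> separates. With \<open>f\<close> fixed, varying
  \<open>g\<close> produces \<open>rel_entropy \<nu> \<mu>\<close>, which is thereby finite; varying
  \<open>f\<close> then produces \<open>rel_entropy \<nu>\<^sub>0 \<nu>\<close>.\<close>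

lemma rate_J_leI:
  assumes S: "\<nu> \<in> S" "\<mu> \<in> S"
    and le: "\<And>f g. continuous_on {0..1} f \<Longrightarrow> continuous_on {0..1} g \<Longrightarrow> X f g \<nu> \<mu> \<le> r"
  shows "J \<mu> \<le> ereal r"
proof -
  have M: "\<nu> \<in> M1" "\<mu> \<in> M1" using S S_subset by auto
  have sub: "supp \<nu> \<subseteq> supp \<nu>\<^sub>0" "supp \<mu> \<subseteq> supp \<nu>\<^sub>0" using S concentrated_iff M by auto
  have H2: "rel_entropy \<nu> \<mu> \<le> ereal ((r - a * gibbs \<nu>\<^sub>0 \<nu> f) / b)" if f: "continuous_on {0..1} f" for f
    using le[OF f] ab_pos by (intro rel_entropy_leI M) (simp add: joint_rate_def field_simps)
  obtain h where h: "rel_entropy \<nu> \<mu> = ereal h"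
    using H2[OF continuous_on_const[of _ "0::real"]] rel_entropy_nonneg[OF M] by (cases "rel_entropy \<nu> \<mu>") auto
  have "rel_entropy \<nu>\<^sub>0 \<nu> \<le> ereal ((r - b * h) / a)"
  proof (rule rel_entropy_leI[OF \<nu>\<^sub>0 M(1)])
    fix f :: "real \<Rightarrow> real" assume "continuous_on {0..1} f"
    from H2[OF this] show "gibbs \<nu>\<^sub>0 \<nu> f \<le> (r - b * h) / a"
      using ab_pos by (simp add: h field_simps)
  qed
  then have "ereal a * rel_entropy \<nu>\<^sub>0 \<nu> \<le> ereal a * ereal ((r - b * h) / a)"
    using ab_pos by (intro ereal_mult_left_mono) auto
  then have "ereal a * rel_entropy \<nu>\<^sub>0 \<nu> + ereal b * rel_entropy \<nu> \<mu> \<le> ereal a * ereal ((r - b * h) / a) + ereal b * ereal h"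
    unfolding h by (rule add_right_mono)
  also have "\<dots> = ereal r" using ab_pos by simp
  finally have "ereal a * rel_entropy \<nu>\<^sub>0 \<nu> + ereal b * rel_entropy \<nu> \<mu> \<le> ereal r" .
  moreover have "J \<mu> \<le> ereal a * rel_entropy \<nu>\<^sub>0 \<nu> + ereal b * rel_entropy \<nu> \<mu>"
  proof -
    have "J \<mu> = (INF \<nu>\<in>{\<nu> \<in> M1. supp \<nu> \<subseteq> supp \<nu>\<^sub>0}. ereal a * rel_entropy \<nu>\<^sub>0 \<nu> + ereal b * rel_entropy \<nu> \<mu>)"
      using sub by (simp add: rate_J_def)
    also have "\<dots> \<le> ereal a * rel_entropy \<nu>\<^sub>0 \<nu> + ereal b * rel_entropy \<nu> \<mu>"
      by (rule INF_lower) (use M sub in simp)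
    finally show ?thesis .
  qed
  ultimately show ?thesis by (rule order.trans[rotated])
qed

text \<open>The strict inequality lets \<nu> be taken from the infimum without asking whether it is
  attained.\<close>

lemma rate_J_lessE:
  assumes \<mu>: "\<mu> \<in> M1" and less: "J \<mu> < ereal r"
  obtains \<nu> where "\<mu> \<in> S" "\<nu> \<in> S" "absolutely_continuous \<nu> \<nu>\<^sub>0" "absolutely_continuous \<mu> \<nu>"
    "\<forall>f g. continuous_on {0..1} f \<longrightarrow> continuous_on {0..1} g \<longrightarrow> X f g \<nu> \<mu> \<le> r"
proof -
  have sub: "supp \<mu> \<subseteq> supp \<nu>\<^sub>0" using less by (auto simp: rate_J_def split: if_splits)
  then obtain \<nu> where \<nu>: "\<nu> \<in> M1" "supp \<nu> \<subseteq> supp \<nu>\<^sub>0"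
    and l: "ereal a * rel_entropy \<nu>\<^sub>0 \<nu> + ereal b * rel_entropy \<nu> \<mu> < ereal r"
    using less by (auto simp: rate_J_def INF_less_iff)
  note nn = rel_entropy_nonneg[OF \<nu>\<^sub>0 \<nu>(1)] rel_entropy_nonneg[OF \<nu>(1) \<mu>]
  obtain h1 h2 where h: "rel_entropy \<nu>\<^sub>0 \<nu> = ereal h1" "rel_entropy \<nu> \<mu> = ereal h2"
    using l nn ab_pos by (cases "rel_entropy \<nu>\<^sub>0 \<nu>"; cases "rel_entropy \<nu> \<mu>") auto
  show thesis
  proof (rule that)
    show "\<mu> \<in> S" "\<nu> \<in> S" using concentrated_iff \<mu> \<nu> sub by auto
    show "absolutely_continuous \<nu> \<nu>\<^sub>0" "absolutely_continuous \<mu> \<nu>"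
      by (rule rel_entropy_finite_D; simp add: h)+
    show "\<forall>f g. continuous_on {0..1} f \<longrightarrow> continuous_on {0..1} g \<longrightarrow> X f g \<nu> \<mu> \<le> r"
    proof (intro allI impI)
      fix f g :: "real \<Rightarrow> real" assume f: "continuous_on {0..1} f" and g: "continuous_on {0..1} g"
      have "gibbs \<nu>\<^sub>0 \<nu> f \<le> h1" "gibbs \<nu> \<mu> g \<le> h2"
        by (rule gibbs_le_rel_entropy[OF \<nu>\<^sub>0 \<nu>(1) f], simp add: h, rule gibbs_le_rel_entropy[OF \<nu>(1) \<mu> g], simp add: h)
      then have "X f g \<nu> \<mu> \<le> a * h1 + b * h2"
        unfolding joint_rate_def using ab_pos by (intro add_mono mult_left_mono) auto
      also have "\<dots> \<le> r" using l by (simp add: h)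
      finally show "X f g \<nu> \<mu> \<le> r" .
    qed
  qed
qed

lemma rate_J_nonneg:
  assumes "\<mu> \<in> M1" shows "0 \<le> J \<mu>"
proof (rule ccontr)
  assume "\<not> 0 \<le> J \<mu>"
  then have "J \<mu> < ereal 0" by (simp add: zero_ereal_def)
  then obtain \<nu> where \<nu>: "\<nu> \<in> M1"
    and l: "ereal a * rel_entropy \<nu>\<^sub>0 \<nu> + ereal b * rel_entropy \<nu> \<mu> < ereal 0"
    by (auto simp: rate_J_def INF_less_iff split: if_splits)
  have "0 \<le> ereal a * rel_entropy \<nu>\<^sub>0 \<nu> + ereal b * rel_entropy \<nu> \<mu>"
    using ab_pos \<nu> assms \<nu>\<^sub>0 by (intro add_nonneg_nonneg ereal_0_le_mult rel_entropy_nonneg) auto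
  with l show False by (simp add: zero_ereal_def)
qed

lemma openin_joint_rate:
  assumes "continuous_on {0..1} f" "continuous_on {0..1} g"
  shows "openin weak_pair {p \<in> topspace weak_pair. X f g (fst p) (snd p) > r}"
proof -
  have "openin weak_pair {p \<in> topspace weak_pair. X f g (fst p) (snd p) \<in> {r<..}}"
    by (rule openin_continuous_map_preimage[OF continuous_map_joint_rate[OF assms]]) auto
  then show ?thesis by simp
qed

lemma compact_space_pair: "compact_space weak_pair"
  by (simp add: compact_space_prod_topology compact_space_weak)

text \<open>Projection along a compact factor maps closed sets to closed sets. The intersection over
  the levels \<open>r + 1 / real (Suc k)\<close> bridges the strict inequality of
  \<open>rate_J_lessE\<close>.\<close>

lemma compact_level_set: "compactin weak_topology {\<mu> \<in> topspace weak_topology. J \<mu> \<le> ereal r}"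
proof -
  define L where "L s = {p \<in> S \<times> S. \<forall>f g. continuous_on {0..1} f \<longrightarrow> continuous_on {0..1} g \<longrightarrow> X f g (fst p) (snd p) \<le> s}" for s
  have cl: "closedin weak_pair (L s)" for s
  proof -
    have "L s = (\<Inter>fg\<in>{fg. continuous_on {0..1} (fst fg) \<and> continuous_on {0..1} (snd fg)}.
        {p \<in> topspace weak_pair. X (fst fg) (snd fg) (fst p) (snd p) \<in> {..s}}) \<inter> (S \<times> S)"
    proof (rule set_eqI)
      fix p
      have "p \<in> S \<times> S \<Longrightarrow> p \<in> topspace weak_pair" using S_subset by auto
      then show "p \<in> L s \<longleftrightarrow> p \<in> (\<Inter>fg\<in>{fg. continuous_on {0..1} (fst fg) \<and> continuous_on {0..1} (snd fg)}.
          {p \<in> topspace weak_pair. X (fst fg) (snd fg) (fst p) (snd p) \<in> {..s}}) \<inter> (S \<times> S)"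
        unfolding L_def by (cases "p \<in> S \<times> S") (simp_all only: Int_iff INT_iff mem_Collect_eq atMost_iff split_paired_All fst_conv snd_conv simp_thms, simp, blast)
    qed
    moreover have "closedin weak_pair (\<Inter>fg\<in>{fg. continuous_on {0..1} (fst fg) \<and> continuous_on {0..1} (snd fg)}.
        {p \<in> topspace weak_pair. X (fst fg) (snd fg) (fst p) (snd p) \<in> {..s}})"
    proof (rule closedin_INT)
      show "{fg :: (real \<Rightarrow> real) \<times> (real \<Rightarrow> real). continuous_on {0..1} (fst fg) \<and> continuous_on {0..1} (snd fg)} \<noteq> {}"
        by (auto intro!: exI[of _ "\<lambda>_. 0"] continuous_on_const)
      show "closedin weak_pair {p \<in> topspace weak_pair. X (fst fg) (snd fg) (fst p) (snd p) \<in> {..s}}"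
        if "fg \<in> {fg. continuous_on {0..1} (fst fg) \<and> continuous_on {0..1} (snd fg)}" for fg
        using that by (intro closedin_continuous_map_preimage[OF continuous_map_joint_rate]) auto
    qed
    moreover have "closedin weak_pair (S \<times> S)" by (simp add: closedin_prod_Times_iff closedin_S)
    ultimately show ?thesis by (simp only: closedin_Int)
  qed
  have "{\<mu> \<in> topspace weak_topology. J \<mu> \<le> ereal r} = (\<Inter>k. snd ` L (r + 1 / real (Suc k)))"
  proof (intro equalityI subsetI INT_I)
    fix \<mu> k assume "\<mu> \<in> {\<mu> \<in> topspace weak_topology. J \<mu> \<le> ereal r}"
    then have \<mu>: "\<mu> \<in> M1" "J \<mu> \<le> ereal r" by auto
    have "J \<mu> < ereal (r + 1 / real (Suc k))" by (rule le_less_trans[OF \<mu>(2)]) simp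
    then obtain \<nu> where \<nu>: "\<mu> \<in> S" "\<nu> \<in> S"
      "\<forall>f g. continuous_on {0..1} f \<longrightarrow> continuous_on {0..1} g \<longrightarrow> X f g \<nu> \<mu> \<le> r + 1 / real (Suc k)"
      by (rule rate_J_lessE[OF \<mu>(1)])
    then have "(\<nu>, \<mu>) \<in> L (r + 1 / real (Suc k))"
      unfolding L_def using S_subset by auto
    then show "\<mu> \<in> snd ` L (r + 1 / real (Suc k))" by (rule image_eqI[rotated]) simp
  next
    fix \<mu> assume "\<mu> \<in> (\<Inter>k. snd ` L (r + 1 / real (Suc k)))"
    then have m: "\<mu> \<in> snd ` L (r + 1 / real (Suc k))" for k by blast
    have le: "J \<mu> \<le> ereal (r + 1 / real (Suc k))" and \<mu>: "\<mu> \<in> M1" for k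
    proof -
      obtain \<nu> where p: "(\<nu>, \<mu>) \<in> L (r + 1 / real (Suc k))" using m[of k] by (auto elim!: imageE)
      then have "\<nu> \<in> S" "\<mu> \<in> S" by (auto simp: L_def)
      moreover have "X f g \<nu> \<mu> \<le> r + 1 / real (Suc k)" if "continuous_on {0..1} f" "continuous_on {0..1} g" for f g
        using p that unfolding L_def by simp
      ultimately show "J \<mu> \<le> ereal (r + 1 / real (Suc k))" by (intro rate_J_leI)
      show "\<mu> \<in> M1" using \<open>\<mu> \<in> S\<close> S_subset by blast
    qed
    have "(\<lambda>k. ereal (r + 1 / real (Suc k))) \<longlonglongrightarrow> ereal r"
    proof (rule tendsto_ereal)
      show "(\<lambda>k. r + 1 / real (Suc k)) \<longlonglongrightarrow> r" by real_asymp
    qed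
    then have "J \<mu> \<le> ereal r" by (rule LIMSEQ_le_const) (use le in auto)
    then show "\<mu> \<in> {\<mu> \<in> topspace weak_topology. J \<mu> \<le> ereal r}" using \<mu> by simp
  qed
  moreover have "closedin weak_topology (\<Inter>k. snd ` L (r + 1 / real (Suc k)))"
  proof (rule closedin_INT)
    show "closedin weak_topology (snd ` L (r + 1 / real (Suc k)))" for k
      using closed_map_snd[OF compact_space_weak, of weak_topology] cl unfolding closed_map_def by blast
  qed simp
  ultimately show ?thesis
    using closedin_compact_space[OF compact_space_weak] by simp
qed

section \<open>The upper bound\<close>

lemma tilt_approx:
  assumes f: "continuous_on {0..1} f" and g: "continuous_on {0..1} g" and e: "0 < e"
  shows "eventually (\<lambda>n. \<forall>\<nu>\<in>M1. \<forall>\<mu>\<in>M1. \<bar>tilt n f g \<nu> \<mu> - speed n * X f g \<nu> \<mu>\<bar> \<le> speed n * e) sequentially"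
proof -
  obtain B where B: "0 \<le> B" "\<And>x. x \<in> {0..1} \<Longrightarrow> \<bar>f x\<bar> \<le> B" using continuous_unit_bounded[OF f] by blast
  obtain C where C: "0 \<le> C" "\<And>x. x \<in> {0..1} \<Longrightarrow> \<bar>g x\<bar> \<le> C" using continuous_unit_bounded[OF g] by blast
  have "(\<lambda>n. \<bar>\<alpha> n / speed n - a\<bar> * (2 * B) + \<bar>\<beta> n / speed n - b\<bar> * (2 * C)) \<longlonglongrightarrow> \<bar>a - a\<bar> * (2 * B) + \<bar>b - b\<bar> * (2 * C)"
    by (intro tendsto_intros ratio_lims)
  then have "eventually (\<lambda>n. \<bar>\<alpha> n / speed n - a\<bar> * (2 * B) + \<bar>\<beta> n / speed n - b\<bar> * (2 * C) < e) sequentially"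
    by (rule order_tendstoD(2)) (simp add: e)
  then show ?thesis
  proof eventually_elim
    case (elim n)
    show ?case
    proof (intro ballI)
      fix \<nu> \<mu> assume M: "\<nu> \<in> M1" "\<mu> \<in> M1"
      note s = speed_pos[of n]
      have "tilt n f g \<nu> \<mu> - speed n * X f g \<nu> \<mu> =
          speed n * ((\<alpha> n / speed n - a) * gibbs \<nu>\<^sub>0 \<nu> f + (\<beta> n / speed n - b) * gibbs \<nu> \<mu> g)"
        using s by (simp add: tilt_def joint_rate_def field_simps)
      also have "\<bar>\<dots>\<bar> = speed n * \<bar>(\<alpha> n / speed n - a) * gibbs \<nu>\<^sub>0 \<nu> f + (\<beta> n / speed n - b) * gibbs \<nu> \<mu> g\<bar>"
        using s by (simp add: abs_mult)
      also have "\<dots> \<le> speed n * e"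
      proof (rule mult_left_mono)
        have "\<bar>(\<alpha> n / speed n - a) * gibbs \<nu>\<^sub>0 \<nu> f\<bar> \<le> \<bar>\<alpha> n / speed n - a\<bar> * (2 * B)"
          unfolding abs_mult by (intro mult_left_mono gibbs_abs_le[OF \<nu>\<^sub>0 M(1) f B(2)]) auto
        moreover have "\<bar>(\<beta> n / speed n - b) * gibbs \<nu> \<mu> g\<bar> \<le> \<bar>\<beta> n / speed n - b\<bar> * (2 * C)"
          unfolding abs_mult by (intro mult_left_mono gibbs_abs_le[OF M g C(2)]) auto
        ultimately show "\<bar>(\<alpha> n / speed n - a) * gibbs \<nu>\<^sub>0 \<nu> f + (\<beta> n / speed n - b) * gibbs \<nu> \<mu> g\<bar> \<le> e"
          using elim by linarith
      qed (use s in simp)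
      finally show "\<bar>tilt n f g \<nu> \<mu> - speed n * X f g \<nu> \<mu>\<bar> \<le> speed n * e" .
    qed
  qed
qed

text \<open>Absorbs constants, such as the number of sets in a finite cover, at the exponential
  scale.\<close>

lemma eventually_exp_speed:
  assumes "0 < e" shows "eventually (\<lambda>n. K \<le> exp (speed n * e)) sequentially"
proof -
  have "filterlim (\<lambda>n. exp (speed n * e)) at_top sequentially"
    by (intro filterlim_compose[OF exp_at_top] filterlim_at_top_mult_tendsto_pos[OF tendsto_const assms speed_top])
  then show ?thesis by (simp add: filterlim_at_top)
qed

text \<open>Chernoff's bound for a finite family: on \<open>A\<close> the sum of the tilts is at
  least \<open>exp (- t)\<close>, and its mean is the number of tilts. Both levels lie in
  \<open>S\<close> almost surely, so the tilts have to be bounded below only there.\<close>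

lemma measure_P_le:
  assumes A: "A \<in> sets weak_borel" and fin: "finite I"
    and cont: "\<And>f g. (f, g) \<in> I \<Longrightarrow> continuous_on {0..1} f \<and> continuous_on {0..1} g"
    and le: "\<And>\<nu> \<mu>. \<nu> \<in> S \<Longrightarrow> \<mu> \<in> S \<Longrightarrow> \<mu> \<in> A \<Longrightarrow> \<exists>(f, g)\<in>I. - t \<le> tilt n f g \<nu> \<mu>"
  shows "measure (P n) A \<le> real (card I) * exp t"
proof -
  let ?D0 = "dirichlet_process (\<alpha> n) \<nu>\<^sub>0"
  note \<alpha>n = \<alpha>[of n] and \<beta>n = \<beta>[of n]
  have Ks: "supp \<nu>\<^sub>0 \<in> sets unit_borel" by (rule closed_in_unit_borel[OF closed_supp supp_subset])
  interpret prob_space "P n" by (rule hierarchical_dirichlet_process_emeasure(1)[OF \<alpha>n \<beta>n \<nu>\<^sub>0])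
  let ?W = "\<lambda>\<nu> \<mu>. \<Sum>fg\<in>I. ennreal (exp (\<alpha> n * gibbs \<nu>\<^sub>0 \<nu> (fst fg) + \<beta> n * gibbs \<nu> \<mu> (snd fg)))"
  have "emeasure (P n) A = (\<integral>\<^sup>+\<nu>. emeasure (dirichlet_process (\<beta> n) \<nu>) A \<partial>?D0)"
    by (rule hierarchical_dirichlet_process_emeasure(3)[OF \<alpha>n \<beta>n \<nu>\<^sub>0 A])
  also have "\<dots> \<le> (\<integral>\<^sup>+\<nu>. \<integral>\<^sup>+\<mu>. 0 * indicator A \<mu> + ennreal (exp t) * ?W \<nu> \<mu> \<partial>dirichlet_process (\<beta> n) \<nu> \<partial>?D0)"
  proof (rule nn_integral_mono_AE)
    show "AE \<nu> in ?D0. emeasure (dirichlet_process (\<beta> n) \<nu>) A \<le> (\<integral>\<^sup>+\<mu>. 0 * indicator A \<mu> + ennreal (exp t) * ?W \<nu> \<mu> \<partial>dirichlet_process (\<beta> n) \<nu>)"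
      using AE_dirichlet_process_concentrated[OF \<alpha>n \<nu>\<^sub>0_S Ks]
    proof eventually_elim
      case (elim \<nu>)
      have \<nu>: "\<nu> \<in> M1" using elim S_subset by blast
      have "emeasure (dirichlet_process (\<beta> n) \<nu>) A = (\<integral>\<^sup>+\<mu>. indicator A \<mu> \<partial>dirichlet_process (\<beta> n) \<nu>)"
        using A prob_space_dirichlet_process(2)[OF \<beta>n \<nu>] by simp
      also have "\<dots> \<le> (\<integral>\<^sup>+\<mu>. 0 * indicator A \<mu> + ennreal (exp t) * ?W \<nu> \<mu> \<partial>dirichlet_process (\<beta> n) \<nu>)"
      proof (rule nn_integral_mono_AE)
        show "AE \<mu> in dirichlet_process (\<beta> n) \<nu>. indicator A \<mu> \<le> 0 * indicator A \<mu> + ennreal (exp t) * ?W \<nu> \<mu>"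
          using AE_dirichlet_process_concentrated[OF \<beta>n elim Ks]
        proof eventually_elim
          case (elim \<mu>)
          show ?case
          proof (cases "\<mu> \<in> A")
            case True
            from le[OF \<open>\<nu> \<in> S\<close> elim True] obtain f g where fg: "(f, g) \<in> I" "- t \<le> tilt n f g \<nu> \<mu>" by blast
            have "1 \<le> exp (t + tilt n f g \<nu> \<mu>)" using fg(2) by simp
            then have "1 \<le> ennreal (exp t * exp (tilt n f g \<nu> \<mu>))" by (simp add: exp_add)
            also have "\<dots> = ennreal (exp t) * ennreal (exp (\<alpha> n * gibbs \<nu>\<^sub>0 \<nu> (fst (f, g)) + \<beta> n * gibbs \<nu> \<mu> (snd (f, g))))"
              by (simp add: tilt_def ennreal_mult')
            also have "\<dots> \<le> ennreal (exp t) * ?W \<nu> \<mu>"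
              by (intro mult_left_mono member_le_sum[OF fg(1)] fin) auto
            finally show ?thesis using True by simp
          qed simp
        qed
      qed
      finally show ?case .
    qed
  qed
  also have "\<dots> = 0 * emeasure (P n) A + ennreal (exp t) * of_nat (card I)"
    by (rule iterated_integral_tilts[OF \<alpha>n \<beta>n \<nu>\<^sub>0 A fin]) (use cont in auto)
  also have "\<dots> = ennreal (real (card I) * exp t)"
    by (simp add: ennreal_of_nat_eq_real_of_nat ennreal_mult'[symmetric] mult.commute)
  finally show ?thesis by (simp add: emeasure_eq_measure)
qed

text \<open>Half of \<open>e\<close> pays for replacing the tilts by their limits, the other half
  for the size of the cover.\<close>

lemma upper_bound:
  assumes C: "closedin weak_topology C" and r: "\<And>\<mu>. \<mu> \<in> C \<Longrightarrow> ereal r < J \<mu>" and e: "0 < e"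
  shows "eventually (\<lambda>n. measure (P n) C \<le> exp (- speed n * (r - e))) sequentially"
proof -
  define U where "U fg = {p \<in> topspace weak_pair. X (fst fg) (snd fg) (fst p) (snd p) > r}" for fg
  let ?cont = "{fg :: (real \<Rightarrow> real) \<times> (real \<Rightarrow> real). continuous_on {0..1} (fst fg) \<and> continuous_on {0..1} (snd fg)}"
  have CM: "C \<subseteq> M1" using closedin_subset[OF C] by simp
  have "compactin weak_pair (S \<times> (C \<inter> S))"
    using closedin_S C by (simp add: compactin_Times closedin_compact_space[OF compact_space_weak] closedin_Int)
  moreover have "\<And>V. V \<in> U ` ?cont \<Longrightarrow> openin weak_pair V"
    by (elim imageE CollectE conjE) (simp only: U_def openin_joint_rate)
  \<comment> \<open>By \<open>rate_J_leI\<close>, a pair at which every \<open>X f g\<close> is at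
    most \<open>r\<close> would give \<open>J \<mu> \<le> r\<close>.\<close>
  moreover have "S \<times> (C \<inter> S) \<subseteq> \<Union> (U ` ?cont)"
  proof
    fix p assume "p \<in> S \<times> (C \<inter> S)"
    then obtain \<nu> \<mu> where p: "p = (\<nu>, \<mu>)" "\<nu> \<in> S" "\<mu> \<in> S" "\<mu> \<in> C" by auto
    have "\<exists>f g. continuous_on {0..1} f \<and> continuous_on {0..1} g \<and> r < X f g \<nu> \<mu>"
    proof (rule ccontr)
      assume "\<not> ?thesis"
      then have "X f g \<nu> \<mu> \<le> r" if "continuous_on {0..1} f" "continuous_on {0..1} g" for f g
        using that by (meson not_le)
      from rate_J_leI[OF p(2,3) this] r[OF p(4)] show False by simp
    qed
    then obtain f g where "continuous_on {0..1} f" "continuous_on {0..1} g" "r < X f g \<nu> \<mu>" by (elim exE conjE)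
    moreover have "\<nu> \<in> M1" "\<mu> \<in> M1" using p S_subset by auto
    ultimately show "p \<in> \<Union> (U ` ?cont)"
      by (intro UN_I[of "(f, g)"]) (auto simp: U_def p(1))
  qed
  ultimately obtain \<F> where \<F>: "finite \<F>" "\<F> \<subseteq> U ` ?cont" "S \<times> (C \<inter> S) \<subseteq> \<Union>\<F>"
    using compactinD[of weak_pair "S \<times> (C \<inter> S)" "U ` ?cont"] by blast
  obtain I where I: "I \<subseteq> ?cont" "finite I" "\<F> = U ` I" using finite_subset_image[OF \<F>(1,2)] by blast
  have cover: "\<exists>fg\<in>I. r < X (fst fg) (snd fg) \<nu> \<mu>" if "\<nu> \<in> S" "\<mu> \<in> S" "\<mu> \<in> C" for \<nu> \<mu>
  proof -
    have "(\<nu>, \<mu>) \<in> \<Union> (U ` I)" using \<F>(3) I(3) that by blast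
    then show ?thesis unfolding U_def by auto
  qed
  have "eventually (\<lambda>n. \<forall>fg\<in>I. \<forall>\<nu>\<in>M1. \<forall>\<mu>\<in>M1. \<bar>tilt n (fst fg) (snd fg) \<nu> \<mu> - speed n * X (fst fg) (snd fg) \<nu> \<mu>\<bar> \<le> speed n * (e / 2)) sequentially"
  proof (rule eventually_ball_finite[OF I(2)], rule ballI)
    fix fg assume "fg \<in> I"
    then show "eventually (\<lambda>n. \<forall>\<nu>\<in>M1. \<forall>\<mu>\<in>M1. \<bar>tilt n (fst fg) (snd fg) \<nu> \<mu> - speed n * X (fst fg) (snd fg) \<nu> \<mu>\<bar> \<le> speed n * (e / 2)) sequentially"
      using I(1) e by (intro tilt_approx) auto
  qed
  moreover have "eventually (\<lambda>n. real (card I) \<le> exp (speed n * (e / 2))) sequentially"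
    using e by (intro eventually_exp_speed) simp
  ultimately show ?thesis
  proof eventually_elim
    case (elim n)
    have "measure (P n) C \<le> real (card I) * exp (- speed n * (r - e / 2))"
    proof (rule measure_P_le[OF _ I(2)])
      show "C \<in> sets weak_borel"
      proof -
        have "M1 - C \<in> sets weak_borel" using C by (intro borel_of_openin) (simp add: closedin_def)
        then have "space weak_borel - (M1 - C) \<in> sets weak_borel" by (rule sets.compl_sets)
        moreover have "space weak_borel - (M1 - C) = C" using CM by auto
        ultimately show ?thesis by (simp only:)
      qed
      show "continuous_on {0..1} f \<and> continuous_on {0..1} g" if "(f, g) \<in> I" for f g
        using I(1) that by auto
      fix \<nu> \<mu> assume S: "\<nu> \<in> S" "\<mu> \<in> S" "\<mu> \<in> C"
      have M: "\<nu> \<in> M1" "\<mu> \<in> M1" using S S_subset by auto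
      obtain fg where fg: "fg \<in> I" "r < X (fst fg) (snd fg) \<nu> \<mu>" using cover[OF S] by blast
      have "speed n * r \<le> speed n * X (fst fg) (snd fg) \<nu> \<mu>"
        using fg(2) speed_pos[of n] by (intro mult_left_mono) auto
      moreover have "\<bar>tilt n (fst fg) (snd fg) \<nu> \<mu> - speed n * X (fst fg) (snd fg) \<nu> \<mu>\<bar> \<le> speed n * (e / 2)"
        using elim(1) fg(1) M by (simp only:)
      moreover have "- (- speed n * (r - e / 2)) = speed n * r - speed n * (e / 2)" by (simp add: algebra_simps)
      ultimately have "- (- speed n * (r - e / 2)) \<le> tilt n (fst fg) (snd fg) \<nu> \<mu>" by linarith
      then show "\<exists>(f, g)\<in>I. - (- speed n * (r - e / 2)) \<le> tilt n f g \<nu> \<mu>"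
        using fg(1) by (intro bexI[of _ fg]) (simp_all add: case_prod_beta)
    qed
    also have "\<dots> \<le> exp (speed n * (e / 2)) * exp (- speed n * (r - e / 2))"
      using elim(2) by (intro mult_right_mono) auto
    also have "\<dots> = exp (- speed n * (r - e))" by (simp add: exp_add[symmetric] algebra_simps)
    finally show ?case .
  qed
qed

end

lemma ln_ext_le:
  assumes "0 \<le> p" "p \<le> exp y" "0 < s" shows "ereal (1 / s) * ln_ext p \<le> ereal (y / s)"
proof (cases "p = 0")
  case True
  then show ?thesis using assms(3) by (simp add: ln_ext_def)
next
  case False
  then have "ln p \<le> y" using assms by (metis less_eq_real_def ln_exp ln_mono)
  then show ?thesis using False assms(3) by (simp add: ln_ext_def divide_right_mono)
qed

lemma le_ln_ext:
  assumes "exp y \<le> p" "0 < s" shows "ereal (y / s) \<le> ereal (1 / s) * ln_ext p"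
proof -
  have p: "0 < p" by (rule less_le_trans[OF exp_gt_zero assms(1)])
  then have "y \<le> ln p" using assms(1) by (simp add: ln_ge_iff)
  then show ?thesis using p assms(2) by (simp add: ln_ext_def divide_right_mono)
qed

section \<open>The lower bound\<close>

context hdp_limit
begin

text \<open>The levels are treated in turn: maximality in \<open>f\<close> determines the moments of
  the first level, so \<open>\<nu>'\<close> can replace \<nu> in the second functional, where
  maximality in \<open>g\<close> determines the moments of \<mu>. Membership in the open set
  \<open>G\<close> and all integrals in \<open>X\<close> depend only on these moments.\<close>

lemma tilt_maximiser_in_neighbourhood:
  assumes M: "\<nu>' \<in> M1" "\<mu>' \<in> G" "\<nu> \<in> M1" "\<mu> \<in> M1" and G: "openin weak_topology G"
    and f: "continuous_on {0..1} f" and g: "continuous_on {0..1} g"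
    and t1: "\<And>h. continuous_on {0..1} h \<Longrightarrow> integral\<^sup>L \<nu>' h = (\<integral>x. exp (- f x) * h x \<partial>\<nu>\<^sub>0)"
    and t2: "\<And>h. continuous_on {0..1} h \<Longrightarrow> integral\<^sup>L \<mu>' h = (\<integral>x. exp (- g x) * h x \<partial>\<nu>')"
    and max: "\<And>f' g'. continuous_on {0..1} f' \<Longrightarrow> continuous_on {0..1} g' \<Longrightarrow> X f' g' \<nu> \<mu> \<le> X f g \<nu> \<mu>"
  shows "\<mu> \<in> G" "X f g \<nu> \<mu> = X f g \<nu>' \<mu>'"
proof -
  obtain V where V: "G = {\<mu> \<in> M1. moments \<mu> \<in> V}"
    using openin_weak_iff_moments[THEN iffD1, OF G] by (elim exE conjE)
  have \<mu>': "\<mu>' \<in> M1" using M(2) V by simp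
  have max1: "gibbs \<nu>\<^sub>0 \<nu> f' \<le> gibbs \<nu>\<^sub>0 \<nu> f" if "continuous_on {0..1} f'" for f'
    using max[OF that g] ab_pos by (simp add: joint_rate_def)
  have m\<nu>: "moments \<nu> = moments \<nu>'"
    by (rule moments_eq_if_gibbs_max[OF \<nu>\<^sub>0 M(3,1) f]) (erule t1, erule max1)
  have gibbs_eq: "gibbs \<nu> \<mu> g' = gibbs \<nu>' \<mu> g'" if "continuous_on {0..1} g'" for g'
    by (simp add: gibbs_def integral_eq_if_moments_eq[OF M(3,1) m\<nu> that])
  have max2: "gibbs \<nu>' \<mu> g' \<le> gibbs \<nu>' \<mu> g" if "continuous_on {0..1} g'" for g'
    using max[OF f that] ab_pos gibbs_eq[OF that] gibbs_eq[OF g] by (simp add: joint_rate_def)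
  have m\<mu>: "moments \<mu> = moments \<mu>'"
    by (rule moments_eq_if_gibbs_max[OF M(1,4) \<mu>' g]) (erule t2, erule max2)
  show "\<mu> \<in> G" using V M m\<mu> by simp
  have e: "continuous_on {0..1} (\<lambda>x. exp (f x))" "continuous_on {0..1} (\<lambda>x. exp (g x))"
    by (intro continuous_intros f g)+
  show "X f g \<nu> \<mu> = X f g \<nu>' \<mu>'"
    unfolding joint_rate_def gibbs_def integral_eq_if_moments_eq[OF M(3,1) m\<nu> e(1)]
      integral_eq_if_moments_eq[OF M(3,1) m\<nu> g] integral_eq_if_moments_eq[OF M(4) \<mu>' m\<mu> e(2)] ..
qed

text \<open>Inside \<open>W\<close> the tilt by \<open>(f, g)\<close> is at most a multiple of the
  indicator of \<open>G\<close>; outside, it is exponentially small compared with other tilts.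
  Integrating this bound, where every tilt has mean 1, leaves at least one half for
  \<open>G\<close>.\<close>

lemma lower_bound:
  assumes G: "openin weak_topology G" and \<mu>: "\<mu> \<in> G" and J: "J \<mu> < ereal r" and e: "0 < e"
  shows "eventually (\<lambda>n. exp (- speed n * (r + e)) \<le> measure (P n) G) sequentially"
proof -
  have \<mu>M: "\<mu> \<in> M1" using \<mu> openin_subset[OF G] by auto
  obtain \<nu> where \<nu>: "\<mu> \<in> S" "\<nu> \<in> S" "absolutely_continuous \<nu> \<nu>\<^sub>0" "absolutely_continuous \<mu> \<nu>"
    "\<forall>f g. continuous_on {0..1} f \<longrightarrow> continuous_on {0..1} g \<longrightarrow> X f g \<nu> \<mu> \<le> r"
    by (rule rate_J_lessE[OF \<mu>M J])
  obtain f g \<nu>' \<mu>' where f: "continuous_on {0..1} f" and g: "continuous_on {0..1} g" and M': "\<nu>' \<in> M1" "\<mu>' \<in> G"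
    and t1: "\<And>h. continuous_on {0..1} h \<Longrightarrow> integral\<^sup>L \<nu>' h = (\<integral>x. exp (- f x) * h x \<partial>\<nu>\<^sub>0)"
    and t2: "\<And>h. continuous_on {0..1} h \<Longrightarrow> integral\<^sup>L \<mu>' h = (\<integral>x. exp (- g x) * h x \<partial>\<nu>')"
    and rate: "X f g \<nu>' \<mu>' \<le> r"
    by (rule smooth_tilt_approximation[OF \<nu>\<^sub>0 \<nu>(2,1,3,4) less_imp_le[OF ab_pos(1)] less_imp_le[OF ab_pos(2)]
          \<nu>(5)[rule_format] G \<mu>]) blast+
  define W where "W = {p \<in> topspace weak_pair. snd p \<in> G} \<inter> {p \<in> topspace weak_pair. X f g (fst p) (snd p) \<in> {..<r + e / 4}}"
  have W: "openin weak_pair W"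
    unfolding W_def
    by (intro openin_Int openin_continuous_map_preimage[OF continuous_map_snd G]
        openin_continuous_map_preimage[OF continuous_map_joint_rate[OF f g]]) simp
  \<comment> \<open>Pairs at which a competitor beats \<open>(f, g)\<close> by more than the margin
    in the third component. Outside \<open>W\<close> some competitor wins strictly, by the previous
    lemma.\<close>
  define U where "U i = {p \<in> topspace weak_pair. X (fst i) (fst (snd i)) (fst p) (snd p) - X f g (fst p) (snd p) \<in> {snd (snd i)<..}}"
    for i :: "(real \<Rightarrow> real) \<times> (real \<Rightarrow> real) \<times> real"
  define K where "K = {i :: (real \<Rightarrow> real) \<times> (real \<Rightarrow> real) \<times> real. continuous_on {0..1} (fst i) \<and> continuous_on {0..1} (fst (snd i)) \<and> 0 < snd (snd i)}"
  have "openin weak_pair V" if V: "V \<in> U ` K" for V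
  proof -
    obtain i where i: "V = U i" "i \<in> K" using V by (elim imageE)
    have cont: "continuous_on {0..1} (fst i)" "continuous_on {0..1} (fst (snd i))" using i(2) by (simp_all add: K_def)
    show ?thesis
      unfolding i(1) U_def
      by (intro openin_continuous_map_preimage[OF continuous_map_diff[OF continuous_map_joint_rate[OF cont] continuous_map_joint_rate[OF f g]]]) simp
  qed
  moreover have "compactin weak_pair (topspace weak_pair - W)"
    using W by (intro closedin_compact_space[OF compact_space_pair]) (simp only: closedin_diff closedin_topspace)
  moreover have "topspace weak_pair - W \<subseteq> \<Union> (U ` K)"
  proof
    fix p assume p: "p \<in> topspace weak_pair - W"
    have pM: "fst p \<in> M1" "snd p \<in> M1" using p by auto
    have "\<exists>f' g'. continuous_on {0..1} f' \<and> continuous_on {0..1} g' \<and> X f g (fst p) (snd p) < X f' g' (fst p) (snd p)"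
    proof (rule ccontr)
      assume "\<not> ?thesis"
      then have max: "X f' g' (fst p) (snd p) \<le> X f g (fst p) (snd p)"
        if "continuous_on {0..1} f'" "continuous_on {0..1} g'" for f' g'
        using that by (meson not_le)
      have m: "snd p \<in> G" "X f g (fst p) (snd p) = X f g \<nu>' \<mu>'"
        using tilt_maximiser_in_neighbourhood[OF M' pM G f g t1 t2 max] by blast+
      have "X f g (fst p) (snd p) < r + e / 4" using m(2) rate e by simp
      then have "p \<in> W" using m(1) p unfolding W_def by simp
      then show False using p by simp
    qed
    then obtain f' g' where fg: "continuous_on {0..1} f'" "continuous_on {0..1} g'"
      "X f g (fst p) (snd p) < X f' g' (fst p) (snd p)" by (elim exE conjE)
    \<comment> \<open>Half of the advantage as margin keeps the inequality strict at
      \<open>p\<close> itself.\<close>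
    let ?i = "(f', g', (X f' g' (fst p) (snd p) - X f g (fst p) (snd p)) / 2)"
    have "?i \<in> K" using fg by (simp add: K_def)
    moreover have "p \<in> U ?i" using fg(3) p unfolding U_def by (simp add: field_simps)
    ultimately show "p \<in> \<Union> (U ` K)" by (rule UN_I)
  qed
  ultimately obtain \<F> where \<F>: "finite \<F>" "\<F> \<subseteq> U ` K" "topspace weak_pair - W \<subseteq> \<Union>\<F>"
    using compactinD[of weak_pair "topspace weak_pair - W" "U ` K"] by metis
  obtain I where I: "I \<subseteq> K" "finite I" "\<F> = U ` I" using finite_subset_image[OF \<F>(1,2)] by metis
  \<comment> \<open>The 1 keeps the set nonempty when \<open>I\<close> is empty.\<close>
  define \<eta> where "\<eta> = Min (insert 1 ((\<lambda>i. snd (snd i)) ` I))"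
  have \<eta>: "0 < \<eta>" "\<And>i. i \<in> I \<Longrightarrow> \<eta> \<le> snd (snd i)"
  proof -
    show "0 < \<eta>" unfolding \<eta>_def using I(1,2) by (subst Min_gr_iff) (auto simp: K_def)
    show "\<eta> \<le> snd (snd i)" if "i \<in> I" for i unfolding \<eta>_def using I(2) that by (intro Min_le) auto
  qed
  \<comment> \<open>The error between a tilt and its limit occurs once inside \<open>W\<close>,
    where \<open>e / 4\<close> is available, and twice outside, where half of the margin \<eta> must
    remain.\<close>
  define \<delta> where "\<delta> = min (e / 4) (\<eta> / 4)"
  have \<delta>: "0 < \<delta>" "\<delta> \<le> e / 4" "\<delta> \<le> \<eta> / 4" using e \<eta>(1) by (auto simp: \<delta>_def)
  have "eventually (\<lambda>n. \<forall>i\<in>I. \<forall>\<nu>\<in>M1. \<forall>\<mu>\<in>M1. \<bar>tilt n (fst i) (fst (snd i)) \<nu> \<mu> - speed n * X (fst i) (fst (snd i)) \<nu> \<mu>\<bar> \<le> speed n * \<delta>) sequentially"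
  proof (rule eventually_ball_finite[OF I(2)], rule ballI)
    fix i assume "i \<in> I"
    then have "continuous_on {0..1} (fst i)" "continuous_on {0..1} (fst (snd i))" using I(1) by (auto simp: K_def)
    then show "eventually (\<lambda>n. \<forall>\<nu>\<in>M1. \<forall>\<mu>\<in>M1. \<bar>tilt n (fst i) (fst (snd i)) \<nu> \<mu> - speed n * X (fst i) (fst (snd i)) \<nu> \<mu>\<bar> \<le> speed n * \<delta>) sequentially"
      by (rule tilt_approx[OF _ _ \<delta>(1)])
  qed
  moreover note tilt_approx[OF f g \<delta>(1)]
  moreover have "eventually (\<lambda>n. 2 * real (card I) \<le> exp (speed n * (\<eta> / 2))) sequentially"
    using \<eta>(1) by (intro eventually_exp_speed) simp
  moreover have "eventually (\<lambda>n. 2 \<le> exp (speed n * (e / 2))) sequentially"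
    using e by (intro eventually_exp_speed) simp
  ultimately show ?thesis
  proof eventually_elim
    case (elim n)
    note s = speed_pos[of n]
    interpret prob_space "P n" by (rule hierarchical_dirichlet_process_emeasure(1)[OF \<alpha> \<beta> \<nu>\<^sub>0])
    have Gs: "G \<in> sets weak_borel" by (rule borel_of_openin[OF G])
    let ?w = "\<lambda>f g \<nu> \<mu>. ennreal (exp (\<alpha> n * gibbs \<nu>\<^sub>0 \<nu> f + \<beta> n * gibbs \<nu> \<mu> g))"
    define C where "C = exp (speed n * (r + e / 2))"
    define D where "D = exp (- (speed n * (\<eta> / 2)))"
    have pointwise: "?w f g \<nu> \<mu> \<le> ennreal C * indicator G \<mu> + ennreal D * (\<Sum>i\<in>I. ?w (fst i) (fst (snd i)) \<nu> \<mu>)"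
      if M: "\<nu> \<in> M1" "\<mu> \<in> M1" for \<nu> \<mu>
    proof (cases "(\<nu>, \<mu>) \<in> W")
      case True
      then have "\<mu> \<in> G" and x: "X f g \<nu> \<mu> < r + e / 4" by (auto simp: W_def)
      have "speed n * X f g \<nu> \<mu> \<le> speed n * (r + e / 4)" using x s by (intro mult_left_mono) auto
      moreover have "\<bar>tilt n f g \<nu> \<mu> - speed n * X f g \<nu> \<mu>\<bar> \<le> speed n * \<delta>" using elim(2) M by simp
      moreover have "speed n * \<delta> \<le> speed n * (e / 4)" using \<delta>(2) s by (intro mult_left_mono) auto
      moreover have "speed n * (r + e / 4) + speed n * (e / 4) = speed n * (r + e / 2)" by (simp add: algebra_simps)
      ultimately have "tilt n f g \<nu> \<mu> \<le> speed n * (r + e / 2)" by linarith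
      then have "?w f g \<nu> \<mu> \<le> ennreal C * indicator G \<mu>"
        using \<open>\<mu> \<in> G\<close> by (simp add: C_def tilt_def ennreal_leI)
      also have "\<dots> \<le> ennreal C * indicator G \<mu> + ennreal D * (\<Sum>i\<in>I. ?w (fst i) (fst (snd i)) \<nu> \<mu>)"
        by (rule add_increasing2) simp_all
      finally show ?thesis .
    next
      case False
      then have "(\<nu>, \<mu>) \<in> \<Union> (U ` I)" using \<F>(3) I(3) M by auto
      then obtain i where i: "i \<in> I" "snd (snd i) < X (fst i) (fst (snd i)) \<nu> \<mu> - X f g \<nu> \<mu>"
        by (auto simp: U_def)
      have "\<eta> \<le> X (fst i) (fst (snd i)) \<nu> \<mu> - X f g \<nu> \<mu>" using i(2) \<eta>(2)[OF i(1)] by linarith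
      then have "speed n * \<eta> \<le> speed n * (X (fst i) (fst (snd i)) \<nu> \<mu> - X f g \<nu> \<mu>)" using s by (intro mult_left_mono) auto
      then have "speed n * \<eta> \<le> speed n * X (fst i) (fst (snd i)) \<nu> \<mu> - speed n * X f g \<nu> \<mu>" by (simp add: right_diff_distrib)
      moreover have "\<bar>tilt n f g \<nu> \<mu> - speed n * X f g \<nu> \<mu>\<bar> \<le> speed n * \<delta>" using elim(2) M by simp
      moreover have "\<bar>tilt n (fst i) (fst (snd i)) \<nu> \<mu> - speed n * X (fst i) (fst (snd i)) \<nu> \<mu>\<bar> \<le> speed n * \<delta>"
        using elim(1) i(1) M by simp
      moreover have "speed n * \<delta> \<le> speed n * (\<eta> / 4)" using \<delta>(3) s by (intro mult_left_mono) auto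
      moreover have "speed n * (\<eta> / 4) + speed n * (\<eta> / 4) = speed n * (\<eta> / 2)" "speed n * \<eta> = speed n * (\<eta> / 2) + speed n * (\<eta> / 2)" by (simp_all add: algebra_simps)
      ultimately have "tilt n f g \<nu> \<mu> \<le> - (speed n * (\<eta> / 2)) + tilt n (fst i) (fst (snd i)) \<nu> \<mu>" by linarith
      then have "exp (tilt n f g \<nu> \<mu>) \<le> D * exp (tilt n (fst i) (fst (snd i)) \<nu> \<mu>)"
        by (simp add: D_def exp_add[symmetric])
      then have "?w f g \<nu> \<mu> \<le> ennreal D * ?w (fst i) (fst (snd i)) \<nu> \<mu>"
        by (simp add: tilt_def ennreal_mult'[symmetric] D_def ennreal_leI)
      also have "\<dots> \<le> ennreal D * (\<Sum>i\<in>I. ?w (fst i) (fst (snd i)) \<nu> \<mu>)"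
        by (intro mult_left_mono member_le_sum[OF i(1)] I) auto
      also have "\<dots> \<le> ennreal C * indicator G \<mu> + ennreal D * (\<Sum>i\<in>I. ?w (fst i) (fst (snd i)) \<nu> \<mu>)"
        by (rule add_increasing) simp_all
      finally show ?thesis .
    qed
    \<comment> \<open>A single tilt, written as a sum over the one-element type so that
      \<open>iterated_integral_tilts\<close> yields its mean.\<close>
    have "1 = (\<integral>\<^sup>+\<nu>. \<integral>\<^sup>+\<mu>. 0 * indicator G \<mu> + 1 * (\<Sum>i\<in>{()}. ?w f g \<nu> \<mu>)
        \<partial>dirichlet_process (\<beta> n) \<nu> \<partial>dirichlet_process (\<alpha> n) \<nu>\<^sub>0)"
      by (subst iterated_integral_tilts[OF \<alpha> \<beta> \<nu>\<^sub>0 Gs]) (auto intro: f g)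
    also have "\<dots> \<le> (\<integral>\<^sup>+\<nu>. \<integral>\<^sup>+\<mu>. ennreal C * indicator G \<mu> + ennreal D * (\<Sum>i\<in>I. ?w (fst i) (fst (snd i)) \<nu> \<mu>)
        \<partial>dirichlet_process (\<beta> n) \<nu> \<partial>dirichlet_process (\<alpha> n) \<nu>\<^sub>0)"
    proof (rule nn_integral_mono, rule nn_integral_mono)
      fix \<nu> \<mu> assume \<nu>: "\<nu> \<in> space (dirichlet_process (\<alpha> n) \<nu>\<^sub>0)" and \<mu>: "\<mu> \<in> space (dirichlet_process (\<beta> n) \<nu>)"
      have "\<nu> \<in> M1" using \<nu> by (simp only: space_dirichlet_process[OF \<alpha> \<nu>\<^sub>0])
      moreover have "\<mu> \<in> M1" using \<mu> by (simp only: space_dirichlet_process[OF \<beta> \<open>\<nu> \<in> M1\<close>])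
      ultimately show "0 * indicator G \<mu> + 1 * (\<Sum>i\<in>{()}. ?w f g \<nu> \<mu>) \<le> ennreal C * indicator G \<mu> + ennreal D * (\<Sum>i\<in>I. ?w (fst i) (fst (snd i)) \<nu> \<mu>)"
        using pointwise by simp
    qed
    also have "\<dots> = ennreal C * emeasure (P n) G + ennreal D * of_nat (card I)"
      by (rule iterated_integral_tilts[OF \<alpha> \<beta> \<nu>\<^sub>0 Gs I(2)]) (use I(1) in \<open>auto simp: K_def\<close>)
    also have "\<dots> = ennreal (C * measure (P n) G + D * real (card I))"
      by (simp add: emeasure_eq_measure ennreal_of_nat_eq_real_of_nat ennreal_mult'[symmetric] C_def D_def flip: ennreal_plus)
    finally have "ennreal 1 \<le> ennreal (C * measure (P n) G + D * real (card I))" by simp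
    then have 1: "1 \<le> C * measure (P n) G + D * real (card I)"
      by (subst (asm) ennreal_le_iff) (auto simp: C_def D_def intro!: add_nonneg_nonneg)
    \<comment> \<open>For large \<open>n\<close> the competing tilts contribute at most one half.
      The factor \<open>1 / 2\<close> left for \<open>G\<close> is absorbed by the remaining
      \<open>e / 2\<close> in the exponent.\<close>
    have "D * (2 * real (card I)) \<le> D * exp (speed n * (\<eta> / 2))"
      using elim(3) by (intro mult_left_mono) (auto simp: D_def)
    also have "\<dots> = 1" by (simp add: D_def exp_add[symmetric])
    finally have "1 / 2 \<le> C * measure (P n) G" using 1 by linarith
    then have "exp (- speed n * (r + e / 2)) * (1 / 2) \<le> exp (- speed n * (r + e / 2)) * (C * measure (P n) G)"
      by (intro mult_left_mono) auto
    also have "\<dots> = measure (P n) G" by (simp add: C_def mult.assoc[symmetric] exp_add[symmetric])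
    finally have 2: "exp (- speed n * (r + e / 2)) * (1 / 2) \<le> measure (P n) G" .
    have "exp (- speed n * (r + e)) * exp (speed n * (e / 2)) = exp (- speed n * (r + e / 2))"
      by (simp add: exp_add[symmetric] algebra_simps)
    moreover have "exp (- speed n * (r + e)) * 2 \<le> exp (- speed n * (r + e)) * exp (speed n * (e / 2))"
      using elim(4) by (intro mult_left_mono) auto
    ultimately show ?case using 2 by linarith
  qed
qed

section \<open>Lower and upper limits for measurable sets\<close>

lemma sets_P: "A \<in> sets (P n) \<longleftrightarrow> A \<in> sets weak_borel"
  using hierarchical_dirichlet_process_emeasure(2)[OF \<alpha>[of n] \<beta>[of n] \<nu>\<^sub>0] by simp

lemma Liminf_bound:
  assumes A: "A \<in> sets weak_borel"
  shows "- (INF \<mu>\<in>weak_topology interior_of A. J \<mu>) \<le> Liminf sequentially (\<lambda>n. ereal (1 / speed n) * ln_ext (measure (P n) A))"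
    (is "_ \<le> ?L")
proof -
  have "- ?L \<le> J \<mu>" if \<mu>: "\<mu> \<in> weak_topology interior_of A" for \<mu>
  proof (rule ccontr)
    assume "\<not> - ?L \<le> J \<mu>"
    then have "J \<mu> < - ?L" by simp
    then obtain r where r: "J \<mu> < ereal r" "ereal r < - ?L" using ereal_dense2 by blast
    \<comment> \<open>A second intermediate value provides the slack \<open>r' - r\<close> that
      \<open>lower_bound\<close> consumes.\<close>
    obtain r' where r': "ereal r < ereal r'" "ereal r' < - ?L" using ereal_dense2[OF r(2)] by blast
    have "0 < r' - r" using r'(1) by simp
    from lower_bound[OF openin_interior_of \<mu> r(1) this]
    have "eventually (\<lambda>n. ereal (- r') \<le> ereal (1 / speed n) * ln_ext (measure (P n) A)) sequentially"
    proof eventually_elim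
      case (elim n)
      interpret prob_space "P n" by (rule hierarchical_dirichlet_process_emeasure(1)[OF \<alpha> \<beta> \<nu>\<^sub>0])
      have "measure (P n) (weak_topology interior_of A) \<le> measure (P n) A"
        by (rule finite_measure_mono[OF interior_of_subset]) (simp only: sets_P A)
      with elim have "exp (speed n * (- r')) \<le> measure (P n) A" by simp
      from le_ln_ext[OF this speed_pos[of n]] show ?case using speed_pos[of n] by simp
    qed
    then have "ereal (- r') \<le> ?L" by (rule Liminf_bounded)
    from leD[OF this] have "\<not> ?L < ereal (- r')" .
    moreover have "?L < ereal (- r')"
      using ereal_less_uminus_reorder[THEN iffD1, OF r'(2)] by (simp only: uminus_ereal.simps)
    ultimately show False by contradiction
  qed
  then have "- ?L \<le> (INF \<mu>\<in>weak_topology interior_of A. J \<mu>)" by (rule INF_greatest)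
  then show ?thesis by (simp add: ereal_uminus_le_reorder)
qed

lemma Limsup_bound:
  assumes A: "A \<in> sets weak_borel"
  shows "Limsup sequentially (\<lambda>n. ereal (1 / speed n) * ln_ext (measure (P n) A)) \<le> - (INF \<mu>\<in>weak_topology closure_of A. J \<mu>)"
    (is "?L \<le> - ?I")
proof (rule ccontr)
  assume "\<not> ?L \<le> - ?I"
  then have "- ?I < ?L" by simp
  then obtain s where s: "- ?I < ereal s" "ereal s < ?L" using ereal_dense2 by blast
  obtain s' where s': "ereal s < ereal s'" "ereal s' < ?L" using ereal_dense2[OF s(2)] by blast
  have I: "ereal (- s) < ?I"
    using ereal_uminus_less_reorder[THEN iffD1, OF s(1)] by (simp only: uminus_ereal.simps)
  have r: "ereal (- s) < J \<mu>" if "\<mu> \<in> weak_topology closure_of A" for \<mu>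
    using I INF_lower[OF that, of J] by (rule less_le_trans)
  have "0 < s' - s" using s'(1) by simp
  then have "eventually (\<lambda>n. measure (P n) (weak_topology closure_of A) \<le> exp (- speed n * (- s - (s' - s)))) sequentially"
    by (intro upper_bound[OF closedin_closure_of] r)
  then have "eventually (\<lambda>n. ereal (1 / speed n) * ln_ext (measure (P n) A) \<le> ereal s') sequentially"
  proof eventually_elim
    case (elim n)
    interpret prob_space "P n" by (rule hierarchical_dirichlet_process_emeasure(1)[OF \<alpha> \<beta> \<nu>\<^sub>0])
    have "A \<subseteq> topspace weak_topology" using sets.sets_into_space[OF A] by simp
    then have sub: "A \<subseteq> weak_topology closure_of A" by (rule closure_of_subset)
    have "weak_topology closure_of A \<in> sets weak_borel"
    proof -
      have "topspace weak_topology - weak_topology closure_of A \<in> sets weak_borel"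
        by (intro borel_of_openin openin_diff openin_topspace closedin_closure_of)
      then have "space weak_borel - (topspace weak_topology - weak_topology closure_of A) \<in> sets weak_borel" by (rule sets.compl_sets)
      then show ?thesis by (simp add: double_diff[OF closure_of_subset_topspace] del: topspace_weak)
    qed
    then have "measure (P n) A \<le> measure (P n) (weak_topology closure_of A)"
      by (intro finite_measure_mono[OF sub]) (simp only: sets_P)
    with elim have "measure (P n) A \<le> exp (speed n * s')" by simp
    from ln_ext_le[OF measure_nonneg this speed_pos[of n]] show ?case using speed_pos[of n] by simp
  qed
  then have "?L \<le> ereal s'" by (rule Limsup_bounded)
  with s'(2) show False by simp
qed

end

theorem theorem3p3:
  fixes \<nu>\<^sub>0 :: "real measure" and c :: real and \<alpha> \<beta> :: "nat \<Rightarrow> real"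
  assumes "\<nu>\<^sub>0 \<in> M1"
    and "0 < c"
    and "\<And>n. 0 < \<alpha> n" and "\<And>n. 0 < \<beta> n"
    and "filterlim \<alpha> at_top sequentially"
    and "filterlim \<beta> at_top sequentially"
    and "(\<lambda>n. \<alpha> n / \<beta> n) \<longlonglongrightarrow> c"
  shows "large_deviation_principle weak_topology sequentially
           (\<lambda>n. hierarchical_dirichlet_process (\<alpha> n) (\<beta> n) \<nu>\<^sub>0)
           (\<lambda>n. max (\<alpha> n) (\<beta> n))
           (rate_J c \<nu>\<^sub>0)"
proof -
  interpret hdp_limit \<nu>\<^sub>0 c \<alpha> \<beta> by unfold_locales (fact assms)+
  have speed: "(\<lambda>n. max (\<alpha> n) (\<beta> n)) = speed" by (simp add: speed_def fun_eq_iff)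
  show ?thesis
    unfolding large_deviation_principle_def speed
  proof (intro conjI allI ballI impI)
    show "filterlim speed at_top sequentially" by (rule speed_top)
    show "0 \<le> rate_J c \<nu>\<^sub>0 s" if "s \<in> topspace weak_topology" for s
      using that by (intro rate_J_nonneg) simp
    show "compactin weak_topology {s \<in> topspace weak_topology. rate_J c \<nu>\<^sub>0 s \<le> ereal r}" for r
      by (rule compact_level_set)
    fix n
    show "prob_space (P n)" "sets (P n) = sets weak_borel"
      by (rule hierarchical_dirichlet_process_emeasure[OF \<alpha> \<beta> \<nu>\<^sub>0])+
  qed (auto intro: Liminf_bound Limsup_bound Liminf_le_Limsup)
qed

end
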